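(* Let $g$ be a non-negative operator monotone decreasing function on $(0,\infty)$, let $p,q>1$ with $\frac1p+\frac1q=1$, and let $A,B$ be positive definite operators on a Hilbert space $\mathcal{H}$ such that $0 < sA^p\le B^q\le A^p$ for a constant $s>0$. For $\alpha\in[0,1]$ put $M_\alpha(s)=1+\frac{\alpha(1-\alpha)(s-1)^2}{2s^{\alpha+1}}$. Then $$g\big(A^p\sharp_{1/q}B^q\big)\le M_{1/q}(s)\,\big(g(A^p)\sharp_{1/q}g(B^q)\big),$$ and for all $\xi\in\mathcal{H}$ $$\big\langle g(A^p\sharp_{1/q}B^q)\xi,\xi\big\rangle\le M_{1/q}(s)\,\langle g(A^p)\xi,\xi\rangle^{1/p}\,\langle g(B^q)\xi,\xi\rangle^{1/q}.$$
   Context: Operators are bounded linear operators on a Hilbert space. For self-adjoint $A,B$, $A\le B$ means $B-A$ is positive, i.e. $\langle (B-A)x,x\rangle\ge 0$ for all $x$. $A>0$ (positive definite) means $A$ is positive and invertible. Functions and powers of positive definite operators are taken via the continuous functional calculus. A continuous function $g:(0,\infty)\to\mathbb{R}$ is operator monotone decreasing if $A\ge B$ implies $g(A)\le g(B)$ for all positive definite operators $A,B$ (on an arbitrary Hilbert space). For positive definite $A,B$ and $\alpha\in[0,1]$ the $\alpha$-geometric mean is $A\sharp_\alpha B=A^{1/2}(A^{-1/2}BA^{-1/2})^{\alpha}A^{1/2}$, with the convention $0\sharp_\alpha 0=0$ (relevant only if $g\equiv 0$). *)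

theory Defs
  imports "HOL-Analysis.Analysis" "HOL-Computational_Algebra.Polynomial"
    "HOL-Library.Function_Algebras"
begin

text \<open>
  The definition of operator monotonicity quantifies over Hilbert spaces, so a Hilbert space is a
  value here and not a type: a complex linear subspace \<open>carrier H\<close> of a type of
  vectors, with an inner product (linear in the first argument) for which it is complete.
  The scalar multiplication belongs to the structure; addition is that of the type.
  Operators are functions on the whole type of which only the values on the carrier matter.
\<close>

record 'v hspace =
  carrier :: "'v set"
  scale :: "complex \<Rightarrow> 'v \<Rightarrow> 'v"
  ip :: "'v \<Rightarrow> 'v \<Rightarrow> complex"

definition hnorm :: "'v hspace \<Rightarrow> 'v \<Rightarrow> real" where
  "hnorm H x = sqrt (Re (ip H x x))"

locale hilbert_space = vector_space "scale H" for H :: "'v::ab_group_add hspace" +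
  assumes subspace_carrier: "module.subspace (scale H) (carrier H)"
    and ip_add_left:
      "\<And>x y z. x \<in> carrier H \<Longrightarrow> y \<in> carrier H \<Longrightarrow> z \<in> carrier H \<Longrightarrow>
        ip H (x + y) z = ip H x z + ip H y z"
    and ip_scale_left:
      "\<And>c x y. x \<in> carrier H \<Longrightarrow> y \<in> carrier H \<Longrightarrow> ip H (scale H c x) y = c * ip H x y"
    and ip_commute:
      "\<And>x y. x \<in> carrier H \<Longrightarrow> y \<in> carrier H \<Longrightarrow> ip H y x = cnj (ip H x y)"
    and ip_pos:
      "\<And>x. x \<in> carrier H \<Longrightarrow> x \<noteq> 0 \<Longrightarrow> 0 < Re (ip H x x)"
    and complete:
      "\<And>X :: nat \<Rightarrow> 'v. (\<And>n. X n \<in> carrier H) \<Longrightarrow>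
        (\<And>e. 0 < e \<Longrightarrow> \<exists>N. \<forall>m\<ge>N. \<forall>n\<ge>N. hnorm H (X m - X n) < e) \<Longrightarrow>
        \<exists>l\<in>carrier H. (\<lambda>n. hnorm H (X n - l)) \<longlonglongrightarrow> 0"

definition bounded_operator :: "'v::ab_group_add hspace \<Rightarrow> ('v \<Rightarrow> 'v) \<Rightarrow> bool" where
  "bounded_operator H A \<longleftrightarrow>
    (\<forall>x\<in>carrier H. A x \<in> carrier H) \<and>
    (\<forall>x\<in>carrier H. \<forall>y\<in>carrier H. A (x + y) = A x + A y) \<and>
    (\<forall>c. \<forall>x\<in>carrier H. A (scale H c x) = scale H c (A x)) \<and>
    (\<exists>K. \<forall>x\<in>carrier H. hnorm H (A x) \<le> K * hnorm H x)"

definition self_adjoint :: "'v::ab_group_add hspace \<Rightarrow> ('v \<Rightarrow> 'v) \<Rightarrow> bool" where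
  "self_adjoint H A \<longleftrightarrow> bounded_operator H A \<and>
    (\<forall>x\<in>carrier H. \<forall>y\<in>carrier H. ip H (A x) y = ip H x (A y))"

definition positive :: "'v::ab_group_add hspace \<Rightarrow> ('v \<Rightarrow> 'v) \<Rightarrow> bool" where
  "positive H A \<longleftrightarrow> self_adjoint H A \<and> (\<forall>x\<in>carrier H. 0 \<le> Re (ip H (A x) x))"

definition op_le :: "'v::ab_group_add hspace \<Rightarrow> ('v \<Rightarrow> 'v) \<Rightarrow> ('v \<Rightarrow> 'v) \<Rightarrow> bool" where
  "op_le H A B \<longleftrightarrow> self_adjoint H A \<and> self_adjoint H B \<and> positive H (\<lambda>x. B x - A x)"

definition op_invertible :: "'v::ab_group_add hspace \<Rightarrow> ('v \<Rightarrow> 'v) \<Rightarrow> bool" where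
  "op_invertible H A \<longleftrightarrow> bounded_operator H A \<and>
    (\<exists>B. bounded_operator H B \<and> (\<forall>x\<in>carrier H. A (B x) = x \<and> B (A x) = x))"

definition positive_definite :: "'v::ab_group_add hspace \<Rightarrow> ('v \<Rightarrow> 'v) \<Rightarrow> bool" where
  "positive_definite H A \<longleftrightarrow> positive H A \<and> op_invertible H A"

definition spectrum :: "'v::ab_group_add hspace \<Rightarrow> ('v \<Rightarrow> 'v) \<Rightarrow> complex set" where
  "spectrum H A = {z. \<not> op_invertible H (\<lambda>x. A x - scale H z x)}"

definition poly_op :: "'v::ab_group_add hspace \<Rightarrow> real poly \<Rightarrow> ('v \<Rightarrow> 'v) \<Rightarrow> 'v \<Rightarrow> 'v" where
  "poly_op H p A x = (\<Sum>i\<le>degree p. scale H (complex_of_real (coeff p i)) ((A ^^ i) x))"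

text \<open>
  Continuous functional calculus of a self-adjoint operator, whose spectrum is real: \<open>f(A)\<close> is
  the limit in operator norm of \<open>p\<^sub>n(A)\<close> for polynomials \<open>p\<^sub>n\<close> converging to \<open>f\<close> uniformly on
  the spectrum. This determines \<open>f(A)\<close> on the carrier only, hence \<open>SOME\<close>.
\<close>

definition is_op_fun ::
  "'v::ab_group_add hspace \<Rightarrow> (real \<Rightarrow> real) \<Rightarrow> ('v \<Rightarrow> 'v) \<Rightarrow> ('v \<Rightarrow> 'v) \<Rightarrow> bool" where
  "is_op_fun H f A T \<longleftrightarrow> bounded_operator H T \<and>
    (\<exists>p :: nat \<Rightarrow> real poly.
      uniform_limit {t. complex_of_real t \<in> spectrum H A} (\<lambda>n. poly (p n)) f sequentially \<and>
      (\<forall>e>0. \<exists>N. \<forall>n\<ge>N. \<forall>x\<in>carrier H.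
        hnorm H (poly_op H (p n) A x - T x) \<le> e * hnorm H x))"

definition op_fun ::
  "'v::ab_group_add hspace \<Rightarrow> (real \<Rightarrow> real) \<Rightarrow> ('v \<Rightarrow> 'v) \<Rightarrow> ('v \<Rightarrow> 'v)" where
  "op_fun H f A = (SOME T. is_op_fun H f A T)"

definition op_powr :: "'v::ab_group_add hspace \<Rightarrow> ('v \<Rightarrow> 'v) \<Rightarrow> real \<Rightarrow> ('v \<Rightarrow> 'v)" where
  "op_powr H A r = op_fun H (\<lambda>t. t powr r) A"

definition op_scale :: "'v::ab_group_add hspace \<Rightarrow> real \<Rightarrow> ('v \<Rightarrow> 'v) \<Rightarrow> ('v \<Rightarrow> 'v)" where
  "op_scale H c A = (\<lambda>x. scale H (complex_of_real c) (A x))"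

definition geo_mean ::
  "'v::ab_group_add hspace \<Rightarrow> real \<Rightarrow> ('v \<Rightarrow> 'v) \<Rightarrow> ('v \<Rightarrow> 'v) \<Rightarrow> ('v \<Rightarrow> 'v)" where
  "geo_mean H \<alpha> A B =
    (if \<forall>x\<in>carrier H. A x = 0 \<and> B x = 0 then (\<lambda>x. 0)
     else op_powr H A (1/2) \<circ>
       op_powr H (op_powr H A (-1/2) \<circ> B \<circ> op_powr H A (-1/2)) \<alpha> \<circ>
       op_powr H A (1/2))"

text \<open>
  HOL cannot quantify over types inside a formula, so an ``arbitrary Hilbert space'' is one whose
  vectors are taken from the type \<open>'u\<close>. In applications \<open>'u\<close> must be large enough: for a space
  \<open>H\<close> with vectors in \<open>'v\<close> we use the type \<open>nat \<Rightarrow> 'v\<close> of sequences. If \<open>H\<close> is not the zero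
  space, this type accommodates, up to unitary equivalence, all separable Hilbert spaces, \<open>H\<close>
  itself and its finite and countable direct sums.
\<close>

definition operator_monotone_decreasing ::
  "'u::ab_group_add itself \<Rightarrow> (real \<Rightarrow> real) \<Rightarrow> bool" where
  "operator_monotone_decreasing U g \<longleftrightarrow> continuous_on {0<..} g \<and>
    (\<forall>K :: 'u hspace. hilbert_space K \<longrightarrow>
      (\<forall>A B. positive_definite K A \<longrightarrow> positive_definite K B \<longrightarrow> op_le K B A \<longrightarrow>
        op_le K (op_fun K g A) (op_fun K g B)))"

definition M_const :: "real \<Rightarrow> real \<Rightarrow> real" where
  "M_const \<alpha> s = 1 + \<alpha> * (1 - \<alpha>) * (s - 1)\<^sup>2 / (2 * s powr (\<alpha> + 1))"

end

theory Submission
  imports Defs "HOL-Computational_Algebra.Fundamental_Theorem_Algebra"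
begin

text \<open>
  Put \<open>C = A\<^sup>p\<close>, \<open>D = B\<^sup>q\<close>, \<open>\<alpha> = 1/q\<close>, so that \<open>1 - \<alpha> = 1/p\<close>, and let \<open>X = C #\<^sub>\<alpha> D\<close> and \<open>M = M_const \<alpha> s\<close>. The
  proof compares the geometric mean with the arithmetic mean of \<open>C\<close> and \<open>D\<close> from one side and with the
  harmonic mean of \<open>g(C)\<close> and \<open>g(D)\<close> from the other; the function \<open>g\<close> links these two means.

  \<^item> Since \<open>s C \<le> D \<le> C\<close>, a reverse Young inequality on \<open>[s, 1]\<close> gives
    \<open>(1 - \<alpha>) C + \<alpha> D \<le> M X\<close> (\<open>arithmetic_le_geo_mean\<close>).
  \<^item> An operator monotone decreasing \<open>g \<ge> 0\<close> maps arithmetic means below harmonic means: if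
    \<open>N ((1 - \<alpha>) C + \<alpha> D) \<le> T\<close> for some \<open>N > 1\<close>, then
    \<open>\<langle>g(T) z, z\<rangle> \<le> (1 - \<alpha>) \<langle>g(C) u, u\<rangle> + \<alpha> \<langle>g(D) v, v\<rangle>\<close> whenever \<open>z = (1 - \<alpha>) u + \<alpha> v\<close>
    (\<open>operator_monotone_decreasing_parallel_sum\<close>). This comes from applying monotonicity on \<open>H \<oplus> H\<close> to a
    rotation of \<open>C \<oplus> D\<close>.
  \<^item> The same inequality for multiples of the identity shows that \<open>t g(t)\<close> is nondecreasing, whence
    \<open>g(X) \<le> M g(M X)\<close> (\<open>operator_monotone_decreasing_scaling\<close>).

  Together, \<open>\<langle>g(X) z, z\<rangle> \<le> M ((1 - \<alpha>) \<langle>g(C) u, u\<rangle> + \<alpha> \<langle>g(D) v, v\<rangle>)\<close> for all decompositions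
  \<open>z = (1 - \<alpha>) u + \<alpha> v\<close> (\<open>operator_monotone_decreasing_mean_bound\<close>). The best decomposition makes the
  right-hand side \<open>M\<close> times the form of the harmonic mean of \<open>g(C)\<close> and \<open>g(D)\<close>, which is below that of
  the geometric mean (\<open>harmonic_le_geo_mean\<close>): this is the first claim. If only multiples of \<open>z = \<xi>\<close> are
  used, one obtains \<open>M\<close> times the harmonic mean of the two numbers \<open>\<langle>g(C) \<xi>, \<xi>\<rangle>\<close> and \<open>\<langle>g(D) \<xi>, \<xi>\<rangle>\<close>, and their
  geometric mean is larger: this is the second claim.

  The functional calculus is developed from the definition of \<open>op_fun\<close>. Its basis is that \<open>p(A)\<close> is
  positive if the polynomial \<open>p\<close> is nonnegative on the spectrum of \<open>A\<close> (\<open>poly_op_nonneg\<close>), which follows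
  from two facts: the infimum of the form of a self-adjoint operator is in its spectrum, and
  polynomials split over the complex numbers.
\<close>

section \<open>Real parts of inner products\<close>

context hilbert_space
begin

lemma zero_in [simp]: "0 \<in> carrier H"
  by (rule subspace_0[OF subspace_carrier])

lemma add_in [simp]: "x \<in> carrier H \<Longrightarrow> y \<in> carrier H \<Longrightarrow> x + y \<in> carrier H"
  by (rule subspace_add[OF subspace_carrier])

lemma diff_in [simp]: "x \<in> carrier H \<Longrightarrow> y \<in> carrier H \<Longrightarrow> x - y \<in> carrier H"
  by (rule subspace_diff[OF subspace_carrier])

lemma scale_in [simp]: "x \<in> carrier H \<Longrightarrow> scale H c x \<in> carrier H"
  by (rule subspace_scale[OF subspace_carrier])

lemma ip_add_right:
  assumes "x \<in> carrier H" "y \<in> carrier H" "z \<in> carrier H"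
  shows "ip H z (x + y) = ip H z x + ip H z y"
  using assms by (metis add_in complex_cnj_add ip_add_left ip_commute)

lemma ip_scale_right:
  assumes "x \<in> carrier H" "y \<in> carrier H"
  shows "ip H y (scale H c x) = cnj c * ip H y x"
  using assms by (metis complex_cnj_mult ip_commute ip_scale_left scale_in)

lemma ip_diff_left:
  assumes "x \<in> carrier H" "y \<in> carrier H" "z \<in> carrier H"
  shows "ip H (x - y) z = ip H x z - ip H y z"
  using ip_add_left[of "x - y" y z] assms by simp

lemma ip_diff_right:
  assumes "x \<in> carrier H" "y \<in> carrier H" "z \<in> carrier H"
  shows "ip H z (x - y) = ip H z x - ip H z y"
  using ip_add_right[of "x - y" y z] assms by simp

lemma ip_zero_left [simp]: "x \<in> carrier H \<Longrightarrow> ip H 0 x = 0"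
  using ip_diff_left[of x x x] by simp

lemma ip_zero_right [simp]: "x \<in> carrier H \<Longrightarrow> ip H x 0 = 0"
  using ip_diff_right[of x x x] by simp

text \<open>
  The arguments below use real parts of inner products: they form a real inner product, and it
  determines the complex one since \<open>Im \<langle>x, y\<rangle> = Re \<langle>x, \<i> y\<rangle>\<close>.
\<close>

abbreviation ri :: "'v \<Rightarrow> 'v \<Rightarrow> real" where
  "ri x y \<equiv> Re (ip H x y)"

abbreviation rscale :: "real \<Rightarrow> 'v \<Rightarrow> 'v" where
  "rscale c x \<equiv> scale H (complex_of_real c) x"

lemma ri_commute: "x \<in> carrier H \<Longrightarrow> y \<in> carrier H \<Longrightarrow> ri x y = ri y x"
  using ip_commute[of x y] by simp

lemma ri_simps [simp]:
  assumes "x \<in> carrier H" "y \<in> carrier H" "z \<in> carrier H"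
  shows "ri (x + y) z = ri x z + ri y z" "ri z (x + y) = ri z x + ri z y"
    "ri (x - y) z = ri x z - ri y z" "ri z (x - y) = ri z x - ri z y"
  using assms by (simp_all add: ip_add_left ip_add_right ip_diff_left ip_diff_right)

lemma ri_rscale [simp]:
  assumes "x \<in> carrier H" "y \<in> carrier H"
  shows "ri (rscale c x) y = c * ri x y" "ri y (rscale c x) = c * ri y x"
  using assms by (simp_all add: ip_scale_left ip_scale_right)

lemma ri_self_nonneg [simp]: "x \<in> carrier H \<Longrightarrow> 0 \<le> ri x x"
  using ip_pos[of x] by (cases "x = 0") auto

lemma hnorm_nonneg [simp]: "x \<in> carrier H \<Longrightarrow> 0 \<le> hnorm H x"
  by (simp add: hnorm_def)

lemma hnorm_sq: "x \<in> carrier H \<Longrightarrow> (hnorm H x)\<^sup>2 = ri x x"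
  by (simp add: hnorm_def)

lemma hnorm_eq_0_iff [simp]: "x \<in> carrier H \<Longrightarrow> hnorm H x = 0 \<longleftrightarrow> x = 0"
  using ip_pos[of x] by (cases "x = 0") (auto simp: hnorm_def)

lemma hnorm_zero [simp]: "hnorm H 0 = 0"
  by simp

lemma hnorm_scale:
  assumes "x \<in> carrier H" shows "hnorm H (scale H c x) = cmod c * hnorm H x"
proof -
  have "ip H (scale H c x) (scale H c x) = of_real ((cmod c)\<^sup>2) * ip H x x"
    using assms by (simp add: ip_scale_left ip_scale_right complex_norm_square mult.assoc mult.commute
        del: of_real_power)
  then show ?thesis by (simp add: hnorm_def real_sqrt_mult)
qed

lemma hnorm_diff_commute:
  assumes "x \<in> carrier H" "y \<in> carrier H" shows "hnorm H (x - y) = hnorm H (y - x)"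
proof -
  have "ri (x - y) (x - y) = ri (y - x) (y - x)"
    using assms by simp
  then show ?thesis by (simp only: hnorm_def)
qed

text \<open>
  The quadratic polynomial \<open>t \<mapsto> \<langle>T (x + t y), x + t y\<rangle>\<close> is nonnegative, so its discriminant is not
  positive. The case \<open>T = 1\<close> is the usual inequality; for other positive operators it leads to a
  bound of \<open>T x\<close> in norm.
\<close>

lemma positive_form_Cauchy_Schwarz:
  assumes T: "\<And>x. x \<in> carrier H \<Longrightarrow> T x \<in> carrier H"
    and add: "\<And>x y. x \<in> carrier H \<Longrightarrow> y \<in> carrier H \<Longrightarrow> T (x + y) = T x + T y"
    and scale: "\<And>c x. x \<in> carrier H \<Longrightarrow> T (rscale c x) = rscale c (T x)"
    and sym: "\<And>x y. x \<in> carrier H \<Longrightarrow> y \<in> carrier H \<Longrightarrow> ri (T x) y = ri x (T y)"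
    and pos: "\<And>x. x \<in> carrier H \<Longrightarrow> 0 \<le> ri (T x) x"
    and x: "x \<in> carrier H" and y: "y \<in> carrier H"
  shows "(ri (T x) y)\<^sup>2 \<le> ri (T x) x * ri (T y) y"
proof -
  define a b c where "a = ri (T y) y" and "b = ri (T x) y" and "c = ri (T x) x"
  have b': "ri (T y) x = b" unfolding b_def using sym[OF y x] ri_commute[of y "T x"] x y T by simp
  have *: "0 \<le> c + 2 * t * b + t\<^sup>2 * a" for t
  proof -
    have "0 \<le> ri (T (x + rscale t y)) (x + rscale t y)"
      using x y by (intro pos) simp
    also have "\<dots> = c + 2 * t * b + t\<^sup>2 * a"
      using x y b' by (simp add: add scale T a_def b_def c_def power2_eq_square algebra_simps)
    finally show ?thesis .
  qed
  have a: "0 \<le> a" and c: "0 \<le> c" using pos x y by (auto simp: a_def c_def)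
  have "b\<^sup>2 \<le> c * a"
  proof (cases "a = 0")
    case True
    have "b = 0"
    proof (rule ccontr)
      assume "b \<noteq> 0"
      then show False using *[of "- (c + 1) / (2 * b)"] True by (simp add: field_simps)
    qed
    then show ?thesis using True by simp
  next
    case False
    then show ?thesis using *[of "- b / a"] a
      by (simp add: field_simps power2_eq_square)
  qed
  then show ?thesis by (simp add: a_def b_def c_def)
qed

lemma ri_Cauchy_Schwarz:
  assumes "x \<in> carrier H" "y \<in> carrier H"
  shows "\<bar>ri x y\<bar> \<le> hnorm H x * hnorm H y"
proof -
  have "(ri x y)\<^sup>2 \<le> ri x x * ri y y"
    using assms by (intro positive_form_Cauchy_Schwarz[of "\<lambda>x. x"]) auto
  then show ?thesis
    using assms by (simp add: hnorm_def real_sqrt_mult[symmetric] real_le_rsqrt)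
qed

lemma hnorm_triangle:
  assumes "x \<in> carrier H" "y \<in> carrier H"
  shows "hnorm H (x + y) \<le> hnorm H x + hnorm H y"
proof (rule power2_le_imp_le)
  have "(hnorm H (x + y))\<^sup>2 = (hnorm H x)\<^sup>2 + (hnorm H y)\<^sup>2 + 2 * ri x y"
    using assms by (simp add: hnorm_sq ri_commute)
  also have "\<dots> \<le> (hnorm H x + hnorm H y)\<^sup>2"
    using ri_Cauchy_Schwarz[OF assms] by (simp add: power2_sum)
  finally show "(hnorm H (x + y))\<^sup>2 \<le> (hnorm H x + hnorm H y)\<^sup>2" .
qed (use assms in auto)

lemma hnorm_diff_triangle:
  assumes "x \<in> carrier H" "y \<in> carrier H" "z \<in> carrier H"
  shows "hnorm H (x - z) \<le> hnorm H (x - y) + hnorm H (y - z)"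
  using hnorm_triangle[of "x - y" "y - z"] assms by simp

lemma ri_eqI:
  assumes "x \<in> carrier H" "x' \<in> carrier H" "\<And>y. y \<in> carrier H \<Longrightarrow> ri x y = ri x' y"
  shows "x = x'"
proof -
  have "(hnorm H (x - x'))\<^sup>2 = 0" using assms by (simp add: hnorm_sq)
  then show ?thesis using assms by simp
qed

section \<open>Bounded and self-adjoint operators\<close>

lemma bo_in [simp]: "bounded_operator H A \<Longrightarrow> x \<in> carrier H \<Longrightarrow> A x \<in> carrier H"
  by (simp add: bounded_operator_def)

lemma bo_add:
  "bounded_operator H A \<Longrightarrow> x \<in> carrier H \<Longrightarrow> y \<in> carrier H \<Longrightarrow> A (x + y) = A x + A y"
  by (simp add: bounded_operator_def)

lemma bo_scale:
  "bounded_operator H A \<Longrightarrow> x \<in> carrier H \<Longrightarrow> A (scale H c x) = scale H c (A x)"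
  by (simp add: bounded_operator_def)

lemma bo_zero: "bounded_operator H A \<Longrightarrow> A 0 = 0"
  using bo_add[of A 0 0] by simp

lemma bo_diff:
  "bounded_operator H A \<Longrightarrow> x \<in> carrier H \<Longrightarrow> y \<in> carrier H \<Longrightarrow> A (x - y) = A x - A y"
  using bo_add[of A "x - y" y] by simp

lemma bo_bound:
  assumes "bounded_operator H A"
  obtains K where "0 < K" "\<And>x. x \<in> carrier H \<Longrightarrow> hnorm H (A x) \<le> K * hnorm H x"
proof -
  obtain K where K: "\<And>x. x \<in> carrier H \<Longrightarrow> hnorm H (A x) \<le> K * hnorm H x"
    using assms unfolding bounded_operator_def by blast
  have "hnorm H (A x) \<le> max K 1 * hnorm H x" if "x \<in> carrier H" for x
    using K[OF that] mult_right_mono[of K "max K 1" "hnorm H x"] that by simp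
  then show ?thesis by (intro that[of "max K 1"]) auto
qed

lemma bounded_operatorI:
  assumes "\<And>x. x \<in> carrier H \<Longrightarrow> A x \<in> carrier H"
    and "\<And>x y. x \<in> carrier H \<Longrightarrow> y \<in> carrier H \<Longrightarrow> A (x + y) = A x + A y"
    and "\<And>c x. x \<in> carrier H \<Longrightarrow> A (scale H c x) = scale H c (A x)"
    and "\<And>x. x \<in> carrier H \<Longrightarrow> hnorm H (A x) \<le> K * hnorm H x"
  shows "bounded_operator H A"
  unfolding bounded_operator_def using assms by blast

lemma bounded_operator_cong:
  assumes "bounded_operator H A" "\<And>x. x \<in> carrier H \<Longrightarrow> A x = B x"
  shows "bounded_operator H B"
  using assms by (simp add: bounded_operator_def)

lemma bounded_operator_ident: "bounded_operator H (\<lambda>x. x)"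
  by (rule bounded_operatorI[where K = 1]) auto

lemma bounded_operator_zero: "bounded_operator H (\<lambda>x. 0)"
  by (rule bounded_operatorI[where K = 0]) auto

lemma bounded_operator_scale:
  assumes "bounded_operator H A" shows "bounded_operator H (\<lambda>x. scale H c (A x))"
proof -
  obtain K where K: "\<And>x. x \<in> carrier H \<Longrightarrow> hnorm H (A x) \<le> K * hnorm H x"
    using bo_bound[OF assms] by blast
  show ?thesis
    by (rule bounded_operatorI[where K = "cmod c * K"])
      (use assms in \<open>auto simp: bo_add bo_scale scale_right_distrib scale_left_commute hnorm_scale
        mult.assoc intro!: mult_left_mono K\<close>)
qed

lemma bounded_operator_add:
  assumes "bounded_operator H A" "bounded_operator H B"
  shows "bounded_operator H (\<lambda>x. A x + B x)"
proof -
  obtain K where K: "\<And>x. x \<in> carrier H \<Longrightarrow> hnorm H (A x) \<le> K * hnorm H x"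
    using bo_bound[OF assms(1)] by blast
  obtain L where L: "\<And>x. x \<in> carrier H \<Longrightarrow> hnorm H (B x) \<le> L * hnorm H x"
    using bo_bound[OF assms(2)] by blast
  show ?thesis
  proof (rule bounded_operatorI[where K = "K + L"])
    fix x assume "x \<in> carrier H"
    then show "hnorm H (A x + B x) \<le> (K + L) * hnorm H x"
      using hnorm_triangle[of "A x" "B x"] K[of x] L[of x] assms by (simp add: algebra_simps)
  qed (use assms in \<open>auto simp: bo_add bo_scale scale_right_distrib\<close>)
qed

lemma bounded_operator_diff:
  assumes "bounded_operator H A" "bounded_operator H B"
  shows "bounded_operator H (\<lambda>x. A x - B x)"
  using bounded_operator_add[OF assms(1) bounded_operator_scale[OF assms(2), of "-1"]] by simp

lemma bounded_operator_comp:
  assumes "bounded_operator H A" "bounded_operator H B"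
  shows "bounded_operator H (\<lambda>x. A (B x))"
proof -
  obtain K where K: "0 < K" "\<And>x. x \<in> carrier H \<Longrightarrow> hnorm H (A x) \<le> K * hnorm H x"
    using bo_bound[OF assms(1)] by blast
  obtain L where L: "\<And>x. x \<in> carrier H \<Longrightarrow> hnorm H (B x) \<le> L * hnorm H x"
    using bo_bound[OF assms(2)] by blast
  show ?thesis
  proof (rule bounded_operatorI[where K = "K * L"])
    fix x assume x: "x \<in> carrier H"
    have "hnorm H (A (B x)) \<le> K * hnorm H (B x)" using K(2)[of "B x"] x assms by simp
    also have "\<dots> \<le> K * (L * hnorm H x)" using L[OF x] K(1) by simp
    finally show "hnorm H (A (B x)) \<le> K * L * hnorm H x" by (simp add: mult.assoc)
  qed (use assms in \<open>auto simp: bo_add bo_scale\<close>)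
qed

lemma sa_bounded [simp]: "self_adjoint H A \<Longrightarrow> bounded_operator H A"
  by (simp add: self_adjoint_def)

lemma sa_ri: "self_adjoint H A \<Longrightarrow> x \<in> carrier H \<Longrightarrow> y \<in> carrier H \<Longrightarrow> ri (A x) y = ri x (A y)"
  by (simp add: self_adjoint_def)

text \<open>
  Replacing \<open>x\<close> by \<open>\<i> x\<close> turns the real part of \<open>\<langle>A x, y\<rangle>\<close> into the negative of its imaginary part,
  so symmetry of real parts suffices.
\<close>

lemma self_adjointI:
  assumes A: "bounded_operator H A"
    and sym: "\<And>x y. x \<in> carrier H \<Longrightarrow> y \<in> carrier H \<Longrightarrow> ri (A x) y = ri x (A y)"
  shows "self_adjoint H A"
  unfolding self_adjoint_def
proof (intro conjI ballI A)
  fix x y assume x: "x \<in> carrier H" and y: "y \<in> carrier H"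
  have "Im (ip H (A x) y) = - ri (A (scale H \<i> x)) y"
    using A x y by (simp add: bo_scale ip_scale_left)
  also have "\<dots> = - ri (scale H \<i> x) (A y)" using sym[of "scale H \<i> x" y] x y by simp
  also have "\<dots> = Im (ip H x (A y))" using A x y by (simp add: ip_scale_left)
  finally show "ip H (A x) y = ip H x (A y)"
    using sym[OF x y] by (simp add: complex_eq_iff)
qed

lemma sa_ident: "self_adjoint H (\<lambda>x. x)"
  by (rule self_adjointI) (auto intro: bounded_operator_ident)

lemma sa_zero: "self_adjoint H (\<lambda>x. 0)"
  by (rule self_adjointI) (auto intro: bounded_operator_zero)

lemma sa_rscale: "self_adjoint H A \<Longrightarrow> self_adjoint H (\<lambda>x. rscale c (A x))"
  by (rule self_adjointI) (auto intro: bounded_operator_scale simp: sa_ri)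

lemma sa_add: "self_adjoint H A \<Longrightarrow> self_adjoint H B \<Longrightarrow> self_adjoint H (\<lambda>x. A x + B x)"
  by (rule self_adjointI) (auto intro: bounded_operator_add simp: sa_ri)

lemma sa_diff: "self_adjoint H A \<Longrightarrow> self_adjoint H B \<Longrightarrow> self_adjoint H (\<lambda>x. A x - B x)"
  by (rule self_adjointI) (auto intro: bounded_operator_diff simp: sa_ri)

lemma sa_conj:
  assumes "self_adjoint H S" "self_adjoint H A" shows "self_adjoint H (\<lambda>x. S (A (S x)))"
proof (rule self_adjointI)
  have "bounded_operator H S" "bounded_operator H A" using assms by auto
  from bounded_operator_comp[OF this(1) bounded_operator_comp[OF this(2,1)]]
  show "bounded_operator H (\<lambda>x. S (A (S x)))" .
  fix x y assume "x \<in> carrier H" "y \<in> carrier H"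
  then show "ri (S (A (S x))) y = ri x (S (A (S y)))"
    using assms sa_ri[of S "A (S x)" y] sa_ri[of A "S x" "S y"] sa_ri[of S x "A (S y)"] by simp
qed

lemma sa_form_bounds:
  assumes A: "self_adjoint H A"
  obtains k where "0 < k" "\<And>x. x \<in> carrier H \<Longrightarrow> \<bar>ri (A x) x\<bar> \<le> k * ri x x"
proof -
  obtain K where K: "0 < K" "\<And>x. x \<in> carrier H \<Longrightarrow> hnorm H (A x) \<le> K * hnorm H x"
    using bo_bound[of A] A by auto
  have "\<bar>ri (A x) x\<bar> \<le> K * ri x x" if x: "x \<in> carrier H" for x
  proof -
    have "\<bar>ri (A x) x\<bar> \<le> hnorm H (A x) * hnorm H x"
      using ri_Cauchy_Schwarz[of "A x" x] x A by simp
    also have "\<dots> \<le> K * hnorm H x * hnorm H x"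
      using K(2)[OF x] x by (intro mult_right_mono) auto
    finally show ?thesis using hnorm_sq[OF x] by (simp add: power2_eq_square mult.assoc)
  qed
  then show ?thesis using K(1) that by blast
qed

lemma op_leI:
  assumes "self_adjoint H A" "self_adjoint H B"
    and "\<And>x. x \<in> carrier H \<Longrightarrow> ri (A x) x \<le> ri (B x) x"
  shows "op_le H A B"
  using assms sa_diff[of B A] by (simp add: op_le_def positive_def)

lemma op_leD: "op_le H A B \<Longrightarrow> x \<in> carrier H \<Longrightarrow> ri (A x) x \<le> ri (B x) x"
  by (auto simp: op_le_def positive_def self_adjoint_def bounded_operator_def)

text \<open>
  Cauchy--Schwarz for the form of \<open>A\<close>, applied to \<open>x\<close> and \<open>A x\<close>, turns bounds of the form into a bound
  of the norm without any spectral theory.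
\<close>

lemma positive_hnorm_sq_le:
  assumes A: "self_adjoint H A"
    and pos: "\<And>x. x \<in> carrier H \<Longrightarrow> 0 \<le> ri (A x) x"
    and le: "\<And>x. x \<in> carrier H \<Longrightarrow> ri (A x) x \<le> k * ri x x"
    and x: "x \<in> carrier H"
  shows "ri (A x) (A x) \<le> k * ri (A x) x"
proof -
  have bo: "bounded_operator H A" using A by simp
  let ?n = "ri (A x) (A x)"
  have "?n\<^sup>2 \<le> ri (A x) x * ri (A (A x)) (A x)"
    using x A by (intro positive_form_Cauchy_Schwarz[of A]) (auto simp: bo_add[OF bo] bo_scale[OF bo] intro: sa_ri[OF A] pos)
  also have "\<dots> \<le> ri (A x) x * (k * ?n)"
    using x A pos[OF x] by (intro mult_left_mono le) auto
  finally have "?n * ?n \<le> ?n * (k * ri (A x) x)" by (simp add: power2_eq_square algebra_simps)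
  moreover have "0 \<le> ?n" using x bo by simp
  moreover have "0 \<le> k * ri (A x) x" if "?n = 0"
  proof -
    have "A x = 0" using that x bo hnorm_sq[of "A x"] by simp
    then show ?thesis using x by simp
  qed
  ultimately show ?thesis by (cases "?n = 0") (auto simp: mult_le_cancel_left)
qed

end

section \<open>Polynomials of an operator\<close>

context hilbert_space
begin

text \<open>
  Complex coefficients serve to split polynomials into linear factors.
\<close>

definition cpoly :: "complex poly \<Rightarrow> ('v \<Rightarrow> 'v) \<Rightarrow> 'v \<Rightarrow> 'v" where
  "cpoly p A x = (\<Sum>i\<le>degree p. scale H (coeff p i) ((A ^^ i) x))"

lemma cpoly_eq_sum:
  assumes "degree p \<le> n"
  shows "cpoly p A x = (\<Sum>i\<le>n. scale H (coeff p i) ((A ^^ i) x))"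
  unfolding cpoly_def using assms
  by (intro sum.mono_neutral_left) (auto simp: coeff_eq_0)

lemma cpoly_0 [simp]: "cpoly 0 A x = 0"
  by (simp add: cpoly_def)

lemma cpoly_pCons: "cpoly (pCons a p) A x = scale H a x + cpoly p A (A x)"
  unfolding cpoly_eq_sum[OF degree_pCons_le] sum.atMost_Suc_shift
  by (simp add: cpoly_def funpow_swap1)

lemma cpoly_add: "cpoly (p + q) A x = cpoly p A x + cpoly q A x"
proof -
  define n where "n = max (degree p) (degree q)"
  have "degree p \<le> n" "degree q \<le> n" "degree (p + q) \<le> n"
    by (auto simp: n_def degree_add_le_max)
  then show ?thesis
    by (simp add: cpoly_eq_sum[where n = n] scale_left_distrib sum.distrib)
qed

lemma cpoly_smult: "cpoly (smult c p) A x = scale H c (cpoly p A x)"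
  by (simp add: cpoly_eq_sum[OF degree_smult_le] cpoly_def scale_sum_right)

lemma bounded_cpoly: "bounded_operator H A \<Longrightarrow> bounded_operator H (cpoly p A)"
proof (induction p)
  case 0
  then show ?case using bounded_operator_zero by (simp add: cpoly_def[abs_def])
next
  case (pCons a p)
  have "bounded_operator H (\<lambda>x. scale H a x + cpoly p A (A x))"
    using bounded_operator_add[OF bounded_operator_scale[OF bounded_operator_ident]
        bounded_operator_comp[OF pCons.IH[OF pCons.prems] pCons.prems]] .
  then show ?case by (simp add: cpoly_pCons[abs_def] fun_eq_iff)
qed

lemma cpoly_commute:
  assumes A: "bounded_operator H A" and x: "x \<in> carrier H"
  shows "cpoly p A (A x) = A (cpoly p A x)"
  using x
proof (induction p arbitrary: x)
  case 0
  then show ?case by (simp add: bo_zero[OF A])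
next
  case (pCons a p)
  then show ?case
    using A bounded_cpoly[OF A, of p] by (simp add: cpoly_pCons bo_add[OF A] bo_scale[OF A])
qed

lemma cpoly_mult:
  assumes A: "bounded_operator H A" and x: "x \<in> carrier H"
  shows "cpoly (p * q) A x = cpoly p A (cpoly q A x)"
  using x
proof (induction p arbitrary: x)
  case 0
  then show ?case by simp
next
  case (pCons a p)
  then show ?case
    using A bounded_cpoly[OF A] by (simp add: cpoly_pCons cpoly_add cpoly_smult cpoly_commute[OF A])
qed

lemma poly_op_eq_cpoly: "poly_op H p A = cpoly (map_poly complex_of_real p) A"
  by (rule ext) (simp add: poly_op_def cpoly_def degree_map_poly coeff_map_poly)

lemma poly_op_0 [simp]: "poly_op H 0 A x = 0"
  by (simp add: poly_op_def)

lemma poly_op_pCons: "poly_op H (pCons a p) A x = rscale a x + poly_op H p A (A x)"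
  by (simp add: poly_op_eq_cpoly map_poly_pCons cpoly_pCons)

lemma poly_op_add: "poly_op H (p + q) A x = poly_op H p A x + poly_op H q A x"
proof -
  have "map_poly complex_of_real (p + q) = map_poly of_real p + map_poly of_real q"
    by (rule poly_eqI) (simp add: coeff_map_poly)
  then show ?thesis by (simp add: poly_op_eq_cpoly cpoly_add)
qed

lemma poly_op_diff: "poly_op H (p - q) A x = poly_op H p A x - poly_op H q A x"
  using poly_op_add[of "p - q" q A x] by simp

lemma poly_op_mult:
  assumes "bounded_operator H A" "x \<in> carrier H"
  shows "poly_op H (p * q) A x = poly_op H p A (poly_op H q A x)"
proof -
  have "map_poly complex_of_real (p * q) = map_poly of_real p * map_poly of_real q"
    by (rule poly_eqI) (simp add: coeff_map_poly coeff_mult)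
  then show ?thesis using assms by (simp add: poly_op_eq_cpoly cpoly_mult)
qed

lemma bounded_poly_op: "bounded_operator H A \<Longrightarrow> bounded_operator H (poly_op H p A)"
  by (simp add: poly_op_eq_cpoly bounded_cpoly)

lemma sa_poly_op:
  assumes A: "self_adjoint H A" shows "self_adjoint H (poly_op H p A)"
proof (rule self_adjointI)
  show bo: "bounded_operator H (poly_op H p A)" for p using A by (simp add: bounded_poly_op)
  fix x y assume "x \<in> carrier H" "y \<in> carrier H"
  then show "ri (poly_op H p A x) y = ri x (poly_op H p A y)"
  proof (induction p arbitrary: x)
    case (pCons a p)
    have "ri (poly_op H p A (A x)) y = ri x (A (poly_op H p A y))"
      using pCons A bo[of p] by (simp add: sa_ri[OF A])
    also have "A (poly_op H p A y) = poly_op H p A (A y)"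
      using pCons A by (simp add: poly_op_eq_cpoly cpoly_commute)
    finally show ?case using pCons A bo[of p] by (simp add: poly_op_pCons)
  qed simp
qed

section \<open>Invertible operators\<close>

lemma op_invertibleI:
  assumes A: "bounded_operator H A" and L: "bounded_operator H L" and R: "bounded_operator H R"
    and LA: "\<And>x. x \<in> carrier H \<Longrightarrow> L (A x) = x" and AR: "\<And>x. x \<in> carrier H \<Longrightarrow> A (R x) = x"
  shows "op_invertible H A"
proof -
  have "L x = R x" if "x \<in> carrier H" for x
    using LA[of "R x"] AR[of x] R that by simp
  then show ?thesis
    unfolding op_invertible_def using A L LA AR by (intro conjI exI[of _ L]) auto
qed

lemma op_invertibleE:
  assumes "op_invertible H A"
  obtains B where "bounded_operator H A" "bounded_operator H B"
    "\<And>x. x \<in> carrier H \<Longrightarrow> A (B x) = x" "\<And>x. x \<in> carrier H \<Longrightarrow> B (A x) = x"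
  using assms unfolding op_invertible_def by blast

lemma op_invertible_cong:
  assumes "op_invertible H A" "\<And>x. x \<in> carrier H \<Longrightarrow> A x = B x"
  shows "op_invertible H B"
proof -
  obtain C where C: "bounded_operator H A" "bounded_operator H C"
    "\<And>x. x \<in> carrier H \<Longrightarrow> A (C x) = x" "\<And>x. x \<in> carrier H \<Longrightarrow> C (A x) = x"
    using op_invertibleE[OF assms(1)] by blast
  show ?thesis
  proof (rule op_invertibleI[OF bounded_operator_cong[OF C(1) assms(2)] C(2) C(2)])
    fix x assume x: "x \<in> carrier H"
    show "C (B x) = x" using C(4)[OF x] assms(2)[OF x] by simp
    show "B (C x) = x" using C(3)[OF x] assms(2)[of "C x"] C(2) x by simp
  qed
qed

lemma op_invertible_comp:
  assumes "op_invertible H A" "op_invertible H B"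
  shows "op_invertible H (\<lambda>x. A (B x))"
proof -
  obtain C where C: "bounded_operator H A" "bounded_operator H C"
    "\<And>x. x \<in> carrier H \<Longrightarrow> A (C x) = x" "\<And>x. x \<in> carrier H \<Longrightarrow> C (A x) = x"
    using op_invertibleE[OF assms(1)] by blast
  obtain D where D: "bounded_operator H B" "bounded_operator H D"
    "\<And>x. x \<in> carrier H \<Longrightarrow> B (D x) = x" "\<And>x. x \<in> carrier H \<Longrightarrow> D (B x) = x"
    using op_invertibleE[OF assms(2)] by blast
  note DC = bounded_operator_comp[OF D(2) C(2)]
  show ?thesis
    by (rule op_invertibleI[OF bounded_operator_comp[OF C(1) D(1)] DC DC]) (use C D in auto)
qed

text \<open>
  A factor of an invertible product of commuting operators is invertible: with \<open>T = A B = B A\<close>, the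
  operators \<open>T\<^sup>-\<^sup>1 B\<close> and \<open>B T\<^sup>-\<^sup>1\<close> are a left and a right inverse of \<open>A\<close>.
\<close>

lemma op_invertible_commuting_factor:
  assumes A: "bounded_operator H A" and B: "bounded_operator H B" and T: "op_invertible H T"
    and AB: "\<And>x. x \<in> carrier H \<Longrightarrow> A (B x) = T x" and BA: "\<And>x. x \<in> carrier H \<Longrightarrow> B (A x) = T x"
  shows "op_invertible H A"
proof -
  obtain S where S: "bounded_operator H T" "bounded_operator H S"
    "\<And>x. x \<in> carrier H \<Longrightarrow> T (S x) = x" "\<And>x. x \<in> carrier H \<Longrightarrow> S (T x) = x"
    using op_invertibleE[OF T] by blast
  show ?thesis
    by (rule op_invertibleI[OF A bounded_operator_comp[OF S(2) B] bounded_operator_comp[OF B S(2)]])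
      (use S AB BA in auto)
qed

lemma op_invertible_scale:
  assumes "c \<noteq> 0" shows "op_invertible H (\<lambda>x. scale H c x)"
  by (rule op_invertibleI[of _ "\<lambda>x. scale H (inverse c) x" "\<lambda>x. scale H (inverse c) x"])
    (use assms in \<open>auto intro: bounded_operator_scale[OF bounded_operator_ident]\<close>)

text \<open>
  A self-adjoint operator \<open>T \<ge> m > 0\<close> is invertible: if \<open>k\<close> is an upper bound of \<open>T\<close>, then
  \<open>1 - T / k\<close> lies between \<open>0\<close> and \<open>1 - m / k\<close>, hence is a contraction, and a solution of
  \<open>T x = y\<close> is a fixed point of \<open>x \<mapsto> (1 - T / k) x + y / k\<close>.
\<close>

lemma coercive_surj:
  assumes T: "self_adjoint H T" and m: "0 < m"
    and low: "\<And>x. x \<in> carrier H \<Longrightarrow> m * ri x x \<le> ri (T x) x"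
    and y: "y \<in> carrier H"
  shows "\<exists>x\<in>carrier H. T x = y"
proof -
  have bo: "bounded_operator H T" using T by simp
  obtain k0 where k0: "0 < k0" "\<And>x. x \<in> carrier H \<Longrightarrow> \<bar>ri (T x) x\<bar> \<le> k0 * ri x x"
    using sa_form_bounds[OF T] by blast
  \<comment> \<open>\<open>k \<ge> m\<close> makes the contraction constant \<open>\<rho>\<close> nonnegative\<close>
  define k where "k = max k0 m"
  have k: "0 < k" "m \<le> k" using m by (auto simp: k_def)
  have up: "ri (T x) x \<le> k * ri x x" if "x \<in> carrier H" for x
    using k0(2)[OF that] mult_right_mono[of k0 k "ri x x"] that by (simp add: k_def)
  define c where "c = 1 / k"
  define \<rho> where "\<rho> = 1 - m / k"
  have \<rho>: "0 \<le> \<rho>" "\<rho> < 1" using k m by (auto simp: \<rho>_def)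
  define S where "S = (\<lambda>x. x - rscale c (T x))"
  have S: "self_adjoint H S"
    unfolding S_def by (intro sa_diff[OF sa_ident] sa_rscale T)
  have Sin: "S x \<in> carrier H" if "x \<in> carrier H" for x using that S by simp
  have Sform: "ri (S x) x = ri x x - c * ri (T x) x" if "x \<in> carrier H" for x
    using that bo by (simp add: S_def)
  have S0: "0 \<le> ri (S x) x" if "x \<in> carrier H" for x
    using up[OF that] k by (simp add: Sform[OF that] c_def field_simps)
  have S1: "ri (S x) x \<le> \<rho> * ri x x" if "x \<in> carrier H" for x
    using low[OF that] k by (simp add: Sform[OF that] \<rho>_def c_def field_simps)
  have contr: "hnorm H (S x) \<le> \<rho> * hnorm H x" if x: "x \<in> carrier H" for x
  proof (rule power2_le_imp_le)
    have "ri (S x) (S x) \<le> \<rho> * ri (S x) x" by (rule positive_hnorm_sq_le[OF S S0 S1 x])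
    also have "\<dots> \<le> \<rho> * (\<rho> * ri x x)" using S1[OF x] \<rho> by (intro mult_left_mono)
    finally show "(hnorm H (S x))\<^sup>2 \<le> (\<rho> * hnorm H x)\<^sup>2"
      using x Sin by (simp add: hnorm_sq power_mult_distrib power2_eq_square[of \<rho>] mult.assoc)
  qed (use \<rho> x in auto)
  \<comment> \<open>Outside the carrier the norm need not be symmetric, hence the cut-off.\<close>
  define d where "d = (\<lambda>x y. if x \<in> carrier H \<and> y \<in> carrier H then hnorm H (x - y) else 0)"
  interpret M: Metric_space "carrier H" d
    by unfold_locales (auto simp: d_def hnorm_diff_commute intro: hnorm_diff_triangle)
  have "M.mcomplete"
    unfolding M.mcomplete_def
  proof (intro allI impI)
    fix X assume "M.MCauchy X"
    then have X: "\<And>n. X n \<in> carrier H"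
      and C: "\<And>e. 0 < e \<Longrightarrow> \<exists>N. \<forall>n n'. N \<le> n \<longrightarrow> N \<le> n' \<longrightarrow> d (X n) (X n') < e"
      unfolding M.MCauchy_def by auto
    obtain l where "l \<in> carrier H" and l: "(\<lambda>n. hnorm H (X n - l)) \<longlonglongrightarrow> 0"
      using complete[of X] X C by (auto simp: d_def)
    moreover have "\<exists>N. \<forall>n\<ge>N. X n \<in> carrier H \<and> d (X n) l < e" if "0 < e" for e
      using order_tendstoD(2)[OF l that] X \<open>l \<in> carrier H\<close>
      by (auto simp: d_def eventually_sequentially)
    ultimately show "\<exists>x. limitin M.mtopology X x sequentially"
      unfolding M.limit_metric_sequentially by blast
  qed
  moreover have "(\<lambda>x. S x + rscale c y) \<in> carrier H \<rightarrow> carrier H"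
    using S y by simp
  moreover have "d (S x + rscale c y) (S z + rscale c y) \<le> \<rho> * d x z"
    if "x \<in> carrier H" "z \<in> carrier H" for x z
    using that contr[of "x - z"] S y by (simp add: d_def bo_diff)
  ultimately obtain x where x: "x \<in> carrier H" "S x + rscale c y = x"
    using M.Banach_fixedpoint_thm[of "\<lambda>x. S x + rscale c y" \<rho>] \<rho> zero_in by blast
  then have "rscale c y = rscale c (T x)"
    by (simp add: S_def algebra_simps)
  moreover have "c \<noteq> 0" using k by (simp add: c_def)
  ultimately have "y = T x" by simp
  then show ?thesis using x by blast
qed

lemma coercive_invertible:
  assumes T: "self_adjoint H T" and m: "0 < m"
    and low: "\<And>x. x \<in> carrier H \<Longrightarrow> m * ri x x \<le> ri (T x) x"
  shows "op_invertible H T"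
proof -
  have bo: "bounded_operator H T" using T by simp
  have le: "hnorm H x \<le> (1 / m) * hnorm H (T x)" if x: "x \<in> carrier H" for x
  proof (cases "x = 0")
    case False
    have "m * (hnorm H x * hnorm H x) \<le> hnorm H (T x) * hnorm H x"
      using low[OF x] ri_Cauchy_Schwarz[of "T x" x] x bo
      by (simp add: hnorm_sq[symmetric] power2_eq_square)
    moreover have "0 < hnorm H x" using False x by (simp add: less_le)
    ultimately show ?thesis using m by (simp add: field_simps)
  qed (use bo m in auto)
  define R where "R = (\<lambda>y. SOME x. x \<in> carrier H \<and> T x = y)"
  have R: "R y \<in> carrier H \<and> T (R y) = y" if "y \<in> carrier H" for y
    unfolding R_def using coercive_surj[OF assms that] by (intro someI_ex[of "\<lambda>x. x \<in> carrier H \<and> T x = y"]) blast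
  have inj: "x = x'" if "x \<in> carrier H" "x' \<in> carrier H" "T x = T x'" for x x'
    using le[of "x - x'"] that bo by (simp add: bo_diff) (metis diff_in eq_iff_diff_eq_0 hnorm_eq_0_iff hnorm_nonneg order_antisym)
  have "bounded_operator H R"
  proof (rule bounded_operatorI[where K = "1 / m"])
    fix x y assume xy: "x \<in> carrier H" "y \<in> carrier H"
    show "R (x + y) = R x + R y"
      using R[of "x + y"] R[of x] R[of y] xy bo by (intro inj[of "R (x + y)" "R x + R y"]) (auto simp: bo_add[OF bo])
  next
    fix c x assume x: "x \<in> carrier H"
    show "R (scale H c x) = scale H c (R x)"
      using R[of "scale H c x"] R[of x] x bo by (intro inj[of "R (scale H c x)" "scale H c (R x)"]) (auto simp: bo_scale[OF bo])
  next
    fix x assume x: "x \<in> carrier H"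
    show "hnorm H (R x) \<le> 1 / m * hnorm H x" using le[of "R x"] R[OF x] by simp
  qed (use R in auto)
  moreover have "R (T x) = x" if "x \<in> carrier H" for x
    using inj[of "R (T x)" x] R[of "T x"] that bo by simp
  ultimately show ?thesis
    using bo R by (intro op_invertibleI[of T R R]) auto
qed

lemma positive_definiteI:
  assumes "self_adjoint H T" "0 < m" "\<And>x. x \<in> carrier H \<Longrightarrow> m * ri x x \<le> ri (T x) x"
  shows "positive_definite H T"
proof -
  have "0 \<le> ri (T x) x" if "x \<in> carrier H" for x
    using assms(3)[OF that] assms(2) that by (meson mult_nonneg_nonneg order_trans less_imp_le ri_self_nonneg)
  then show ?thesis
    using assms coercive_invertible by (auto simp: positive_definite_def positive_def)
qed

lemma positive_definite_sa [simp]: "positive_definite H T \<Longrightarrow> self_adjoint H T"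
  by (simp add: positive_definite_def positive_def)

text \<open>
  With \<open>R\<close> the inverse of \<open>T\<close>, \<open>\<parallel>x\<parallel>\<^sup>2 = \<parallel>R (T x)\<parallel>\<^sup>2 \<le> c\<^sup>2 \<parallel>T x\<parallel>\<^sup>2 \<le> c\<^sup>2 k \<langle>T x, x\<rangle>\<close>. So the positive definite
  operators are the self-adjoint ones with a positive lower bound, which is how they are handled
  from here on.
\<close>

lemma positive_definite_coercive:
  assumes "positive_definite H T"
  obtains m where "0 < m" "\<And>x. x \<in> carrier H \<Longrightarrow> m * ri x x \<le> ri (T x) x"
proof -
  have T: "self_adjoint H T" and pos: "\<And>x. x \<in> carrier H \<Longrightarrow> 0 \<le> ri (T x) x" and inv: "op_invertible H T"
    using assms by (auto simp: positive_definite_def positive_def)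
  obtain k where k: "0 < k" "\<And>x. x \<in> carrier H \<Longrightarrow> \<bar>ri (T x) x\<bar> \<le> k * ri x x"
    using sa_form_bounds[OF T] by blast
  obtain R where R: "bounded_operator H R" "\<And>x. x \<in> carrier H \<Longrightarrow> R (T x) = x"
    by (rule op_invertibleE[OF inv]) (rule that; assumption)
  obtain c where c: "0 < c" "\<And>x. x \<in> carrier H \<Longrightarrow> hnorm H (R x) \<le> c * hnorm H x"
    using bo_bound[OF R(1)] by blast
  have "1 / (c\<^sup>2 * k) * ri x x \<le> ri (T x) x" if x: "x \<in> carrier H" for x
  proof -
    have "hnorm H x \<le> c * hnorm H (T x)" using c(2)[of "T x"] R(2)[OF x] x T by simp
    then have "(hnorm H x)\<^sup>2 \<le> (c * hnorm H (T x))\<^sup>2" using x by (intro power_mono) auto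
    then have "ri x x \<le> c\<^sup>2 * ri (T x) (T x)" using x T by (simp add: hnorm_sq power_mult_distrib)
    also have "\<dots> \<le> c\<^sup>2 * (k * ri (T x) x)"
      using k(2) by (intro mult_left_mono positive_hnorm_sq_le[OF T pos _ x]) (auto simp: abs_le_iff)
    finally show ?thesis using c k by (simp add: field_simps)
  qed
  moreover have "0 < 1 / (c\<^sup>2 * k)" using c k by simp
  ultimately show ?thesis using that by blast
qed

section \<open>The real spectrum\<close>

definition rspec :: "('v \<Rightarrow> 'v) \<Rightarrow> real set" where
  "rspec A = {t. complex_of_real t \<in> spectrum H A}"

lemma rspec_iff: "t \<in> rspec A \<longleftrightarrow> \<not> op_invertible H (\<lambda>x. A x - rscale t x)"
  by (simp add: rspec_def spectrum_def)

lemma rspec_subset: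
  assumes A: "self_adjoint H A"
    and low: "\<And>x. x \<in> carrier H \<Longrightarrow> m * ri x x \<le> ri (A x) x"
    and up: "\<And>x. x \<in> carrier H \<Longrightarrow> ri (A x) x \<le> k * ri x x"
  shows "rspec A \<subseteq> {m..k}"
proof
  fix t assume t: "t \<in> rspec A"
  have sa: "self_adjoint H (\<lambda>x. A x - rscale t x)"
    by (intro sa_diff sa_rscale A sa_ident)
  have "m \<le> t"
  proof (rule ccontr)
    assume "\<not> m \<le> t"
    then have "op_invertible H (\<lambda>x. A x - rscale t x)"
      using low A by (intro coercive_invertible[of _ "m - t"] sa) (auto simp: algebra_simps)
    then show False using t by (simp add: rspec_iff)
  qed
  moreover have "t \<le> k"
  proof (rule ccontr)
    assume "\<not> t \<le> k"
    then have "op_invertible H (\<lambda>x. rscale t x - A x)"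
      using up A by (intro coercive_invertible[of _ "t - k"] sa_diff sa_rscale A sa_ident)
        (auto simp: algebra_simps)
    from op_invertible_comp[OF op_invertible_scale[of "-1"] this]
    have "op_invertible H (\<lambda>x. A x - rscale t x)" by (simp add: scale_right_diff_distrib)
    then show False using t by (simp add: rspec_iff)
  qed
  ultimately show "t \<in> {m..k}" by simp
qed

text \<open>
  The greatest lower bound \<open>m\<close> of the form belongs to the spectrum: otherwise \<open>T - m\<close> would be
  positive definite, and a larger lower bound would exist.
\<close>

lemma form_infimum_in_rspec:
  assumes T: "self_adjoint H T" and nz: "carrier H \<noteq> {0}"
  obtains m where "m \<in> rspec T" "\<And>x. x \<in> carrier H \<Longrightarrow> m * ri x x \<le> ri (T x) x"
proof -
  have bo: "bounded_operator H T" using T by simp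
  obtain k where k: "0 < k" "\<And>x. x \<in> carrier H \<Longrightarrow> \<bar>ri (T x) x\<bar> \<le> k * ri x x"
    using sa_form_bounds[OF T] by blast
  define F where "F = {ri (T x) x / ri x x | x. x \<in> carrier H \<and> x \<noteq> 0}"
  have pos: "0 < ri x x" if "x \<in> carrier H" "x \<noteq> 0" for x using that ip_pos by blast
  obtain x0 where "x0 \<in> carrier H" "x0 \<noteq> 0" using nz zero_in by blast
  then have ne: "F \<noteq> {}" by (auto simp: F_def)
  have bdd: "bdd_below F"
  proof (rule bdd_belowI[of _ "- k"])
    fix a assume "a \<in> F"
    then obtain x where "x \<in> carrier H" "x \<noteq> 0" "a = ri (T x) x / ri x x" by (auto simp: F_def)
    then have "- k * ri x x \<le> a * ri x x" using k(2)[of x] pos[of x] by (simp add: abs_le_iff)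
    then show "- k \<le> a" using mult_le_cancel_right_pos[OF pos[of x]] \<open>x \<in> carrier H\<close> \<open>x \<noteq> 0\<close> by blast
  qed
  define m where "m = Inf F"
  have low: "m * ri x x \<le> ri (T x) x" if x: "x \<in> carrier H" for x
  proof (cases "x = 0")
    case False
    then have "m \<le> ri (T x) x / ri x x"
      unfolding m_def using x by (intro cInf_lower bdd) (auto simp: F_def)
    then show ?thesis using pos[OF x False] by (simp add: field_simps)
  qed (use bo in simp)
  have "\<not> op_invertible H (\<lambda>x. T x - rscale m x)"
  proof
    assume "op_invertible H (\<lambda>x. T x - rscale m x)"
    moreover have "self_adjoint H (\<lambda>x. T x - rscale m x)" by (intro sa_diff sa_rscale T sa_ident)
    ultimately have "positive_definite H (\<lambda>x. T x - rscale m x)"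
      using low bo by (simp add: positive_definite_def positive_def)
    then obtain e where e: "0 < e" "\<And>x. x \<in> carrier H \<Longrightarrow> e * ri x x \<le> ri (T x - rscale m x) x"
      by (rule positive_definite_coercive) (rule that; assumption)
    have "m + e \<le> Inf F"
    proof (rule cInf_greatest[OF ne])
      fix a assume "a \<in> F"
      then obtain x where x: "x \<in> carrier H" "x \<noteq> 0" "a = ri (T x) x / ri x x" by (auto simp: F_def)
      then have "(m + e) * ri x x \<le> a * ri x x"
        using e(2)[of x] pos[of x] bo by (simp add: algebra_simps)
      then show "m + e \<le> a" using mult_le_cancel_right_pos[OF pos[of x]] x by blast
    qed
    then show False using e by (simp add: m_def)
  qed
  then show ?thesis using that low by (simp add: rspec_iff)
qed

text \<open>
  The spectrum is real since \<open>(A - Re z)\<^sup>2 + (Im z)\<^sup>2 \<ge> (Im z)\<^sup>2 > 0\<close> is invertible, and this is the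
  product of the commuting operators \<open>A - z\<close> and \<open>A - z\<^sup>*\<close>.
\<close>

lemma spectrum_real:
  assumes A: "self_adjoint H A" and z: "Im z \<noteq> 0"
  shows "op_invertible H (\<lambda>x. A x - scale H z x)"
proof -
  have bo: "bounded_operator H A" using A by simp
  define B where "B = (\<lambda>x. A x - rscale (Re z) x)"
  have B: "self_adjoint H B" unfolding B_def by (intro sa_diff sa_rscale A sa_ident)
  have boB: "bounded_operator H B" using B by simp
  define T where "T = (\<lambda>x. B (B x) + rscale ((Im z)\<^sup>2) x)"
  have Tsa: "self_adjoint H T"
    unfolding T_def by (intro sa_add sa_rscale sa_ident self_adjointI)
      (use B boB in \<open>auto intro: bounded_operator_comp simp: sa_ri[OF B]\<close>)
  have T: "op_invertible H T"
  proof (rule coercive_invertible[OF Tsa])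
    show "0 < (Im z)\<^sup>2" using z by simp
    fix x assume x: "x \<in> carrier H"
    have "0 \<le> ri (B x) (B x)" using x boB by simp
    also have "\<dots> = ri (B (B x)) x" using sa_ri[OF B, of "B x" x] x boB by simp
    finally show "(Im z)\<^sup>2 * ri x x \<le> ri (T x) x" using x boB
      by (simp add: T_def del: of_real_power)
  qed
  have z_eq: "z = complex_of_real (Re z) + \<i> * complex_of_real (Im z)" by (simp add: complex_eq_iff)
  define J where "J = (\<lambda>x. scale H (\<i> * complex_of_real (Im z)) x)"
  have eq: "A x - scale H z x = B x - J x" for x
    by (subst z_eq) (simp add: B_def J_def scale_left_distrib diff_diff_eq)
  have boJ: "bounded_operator H J" unfolding J_def by (rule bounded_operator_scale[OF bounded_operator_ident])
  have JJ: "J (J x) = - rscale ((Im z)\<^sup>2) x" for x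
    by (simp add: J_def power2_eq_square) (simp flip: scale_minus_left of_real_mult add: algebra_simps)
  have BJ: "B (J x) = J (B x)" if "x \<in> carrier H" for x
    using that by (simp add: J_def bo_scale[OF boB])
  have "op_invertible H (\<lambda>x. B x - J x)"
    by (rule op_invertible_commuting_factor[OF bounded_operator_diff[OF boB boJ]
          bounded_operator_add[OF boB boJ] T])
      (use boB boJ in \<open>auto simp: bo_add bo_diff BJ JJ T_def\<close>)
  then show ?thesis by (simp add: eq)
qed

text \<open>
  Over the complex numbers \<open>q\<close> is a product of linear factors, hence \<open>q(A)\<close> is a product of
  invertible operators.
\<close>

lemma cpoly_invertible:
  assumes A: "bounded_operator H A" and "q \<noteq> 0"
    and "\<And>z. poly q z = 0 \<Longrightarrow> op_invertible H (\<lambda>x. A x - scale H z x)"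
  shows "op_invertible H (cpoly q A)"
  using assms(2,3)
proof (induction "degree q" arbitrary: q)
  case 0
  then obtain c where "q = [:c:]" "c \<noteq> 0" by (metis degree_eq_zeroE pCons_0_0)
  then show ?case using op_invertible_scale[of c] by (simp add: cpoly_pCons[abs_def])
next
  case (Suc n)
  have "\<not> constant (poly q)" using Suc.hyps(2) by (simp add: constant_degree)
  then obtain z where z: "poly q z = 0" using fundamental_theorem_of_algebra by blast
  then obtain r where r: "q = [:- z, 1:] * r" by (auto simp: poly_eq_0_iff_dvd)
  have "r \<noteq> 0" using r Suc.prems(1) by auto
  then have "degree q = Suc (degree r)" unfolding r by (subst degree_mult_eq) auto
  then have "op_invertible H (cpoly r A)"
    using Suc.hyps \<open>r \<noteq> 0\<close> Suc.prems(2) by (intro Suc.hyps(1)) (auto simp: r)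
  from op_invertible_comp[OF Suc.prems(2)[OF z] this]
  show ?case
    by (rule op_invertible_cong) (use A in \<open>auto simp: r cpoly_mult cpoly_pCons simp del: mult_pCons_left\<close>)
qed

text \<open>
  If \<open>p(A)\<close> were not positive, the infimum \<open>m < 0\<close> of its form would be in the spectrum of \<open>p(A)\<close>;
  factoring \<open>p - m\<close> over the complex numbers, a root would be in the spectrum of \<open>A\<close>, and \<open>p\<close> would take
  the value \<open>m\<close> there. The whole functional calculus rests on this case of the spectral theorem.
\<close>

theorem poly_op_nonneg:
  assumes A: "self_adjoint H A" and p: "\<And>t. t \<in> rspec A \<Longrightarrow> 0 \<le> poly p t"
    and x: "x \<in> carrier H"
  shows "0 \<le> ri (poly_op H p A x) x"
proof (cases "carrier H = {0}")
  case False
  have bo: "bounded_operator H A" using A by simp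
  obtain m where m: "m \<in> rspec (poly_op H p A)"
    "\<And>x. x \<in> carrier H \<Longrightarrow> m * ri x x \<le> ri (poly_op H p A x) x"
    using form_infimum_in_rspec[OF sa_poly_op[OF A] False] by blast
  have "\<exists>t\<in>rspec A. poly p t = m"
  proof (cases "p = [:m:]")
    case True
    then show ?thesis using form_infimum_in_rspec[OF A False] by auto
  next
    case False
    define q where "q = map_poly complex_of_real (p - [:m:])"
    have "p - [:m:] \<noteq> 0" using False by simp
    then have "q \<noteq> 0" unfolding q_def by (subst map_poly_eq_0_iff) auto
    have eq: "cpoly q A x = poly_op H p A x - rscale m x" for x
      unfolding q_def poly_op_eq_cpoly[symmetric] by (simp add: poly_op_diff poly_op_pCons)
    have "\<not> op_invertible H (cpoly q A)"
      using m(1) op_invertible_cong[of "cpoly q A" "\<lambda>x. poly_op H p A x - rscale m x"] eq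
      by (auto simp: rspec_iff)
    with \<open>q \<noteq> 0\<close> obtain z where z: "poly q z = 0" "\<not> op_invertible H (\<lambda>x. A x - scale H z x)"
      using cpoly_invertible[OF bo, of q] by blast
    then have "z = complex_of_real (Re z)" using spectrum_real[OF A, of z] by (auto simp: complex_eq_iff)
    then obtain t where t: "z = complex_of_real t" by blast
    have "poly q z = complex_of_real (poly (p - [:m:]) t)"
      by (simp add: q_def t poly_altdef coeff_map_poly degree_map_poly)
    then have "poly p t = m" using z(1) by simp
    moreover have "t \<in> rspec A" using z(2) by (simp add: rspec_iff t)
    ultimately show ?thesis by blast
  qed
  then have "0 \<le> m" using p by auto
  then have "0 \<le> m * ri x x" using x by simp
  then show ?thesis using m(2)[OF x] by linarith
next
  case True
  then have "poly_op H p A x = 0" using x A bounded_poly_op[of A p] bo_zero by auto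
  then show ?thesis using x by simp
qed

text \<open>
  This is positivity of \<open>(e\<^sup>2 - p\<^sup>2)(A)\<close>. It makes \<open>p \<mapsto> p(A)\<close> continuous for uniform convergence on the
  spectrum.
\<close>

lemma poly_op_hnorm_le:
  assumes A: "self_adjoint H A" and p: "\<And>t. t \<in> rspec A \<Longrightarrow> \<bar>poly p t\<bar> \<le> e" and e: "0 \<le> e"
    and x: "x \<in> carrier H"
  shows "hnorm H (poly_op H p A x) \<le> e * hnorm H x"
proof (rule power2_le_imp_le)
  have bo: "bounded_operator H A" using A by simp
  have "0 \<le> ri (poly_op H ([:e\<^sup>2:] - p * p) A x) x"
  proof (rule poly_op_nonneg[OF A _ x])
    fix t assume "t \<in> rspec A"
    then have "\<bar>poly p t\<bar>\<^sup>2 \<le> e\<^sup>2" using p by (intro power_mono) auto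
    then show "0 \<le> poly ([:e\<^sup>2:] - p * p) t" by (simp add: power2_eq_square)
  qed
  also have "\<dots> = e\<^sup>2 * ri x x - ri (poly_op H p A x) (poly_op H p A x)"
    using x bo bounded_poly_op[OF bo] sa_ri[OF sa_poly_op[OF A], of "poly_op H p A x" x p]
    by (simp add: poly_op_diff poly_op_mult poly_op_pCons del: of_real_power)
  finally show "(hnorm H (poly_op H p A x))\<^sup>2 \<le> (e * hnorm H x)\<^sup>2"
    using x bo bounded_poly_op[OF bo] by (simp add: hnorm_sq power_mult_distrib)
qed (use e x in auto)

end

section \<open>The functional calculus of positive definite operators\<close>

lemma real_poly_approx:
  fixes f :: "real \<Rightarrow> real"
  assumes "continuous_on {a..b} f" "0 < e"
  obtains p where "\<And>t. t \<in> {a..b} \<Longrightarrow> \<bar>poly p t - f t\<bar> < e"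
proof -
  obtain g where g: "real_polynomial_function g" "\<And>t. t \<in> {a..b} \<Longrightarrow> \<bar>f t - g t\<bar> < e"
    using Stone_Weierstrass_real_polynomial_function[OF _ assms] by auto
  obtain c n where "g = (\<lambda>x. \<Sum>i\<le>n. c i * x ^ i)"
    using g(1) real_polynomial_function_iff_sum by blast
  then have "poly (\<Sum>i\<le>n. monom (c i) i) t = g t" for t
    by (simp add: poly_sum poly_monom)
  with g(2) show ?thesis
    by (intro that[of "\<Sum>i\<le>n. monom (c i) i"]) (simp add: abs_minus_commute)
qed

lemma real_poly_uniform_limit:
  fixes f :: "real \<Rightarrow> real"
  assumes "continuous_on {a..b} f"
  obtains P :: "nat \<Rightarrow> real poly" where "uniform_limit {a..b} (\<lambda>n. poly (P n)) f sequentially"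
proof -
  have "\<exists>p. \<forall>t\<in>{a..b}. \<bar>poly p t - f t\<bar> < 1 / Suc n" for n
    using real_poly_approx[OF assms, of "1 / Suc n"] by (metis of_nat_0_less_iff zero_less_Suc zero_less_divide_1_iff)
  then obtain P where P: "\<And>n t. t \<in> {a..b} \<Longrightarrow> \<bar>poly (P n) t - f t\<bar> < 1 / Suc n" by metis
  have "uniform_limit {a..b} (\<lambda>n. poly (P n)) f sequentially"
  proof (rule uniform_limitI)
    fix e :: real assume "0 < e"
    from order_tendstoD(2)[OF LIMSEQ_Suc[OF lim_1_over_n] this]
    show "\<forall>\<^sub>F n in sequentially. \<forall>t\<in>{a..b}. dist (poly (P n) t) (f t) < e"
      by (rule eventually_mono) (use P in \<open>auto simp only: dist_real_def intro: less_trans\<close>)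
  qed
  then show ?thesis using that by blast
qed

context hilbert_space
begin

text \<open>
  Convergence of vectors is mostly used through inner products, which determine the limit.
\<close>

definition hlim :: "(nat \<Rightarrow> 'v) \<Rightarrow> 'v \<Rightarrow> bool" where
  "hlim X l \<longleftrightarrow> (\<forall>n. X n \<in> carrier H) \<and> l \<in> carrier H \<and> (\<lambda>n. hnorm H (X n - l)) \<longlonglongrightarrow> 0"

lemma hlim_const: "x \<in> carrier H \<Longrightarrow> hlim (\<lambda>n. x) x"
  by (simp add: hlim_def)

lemma hlim_ri:
  assumes X: "hlim X x" and Y: "hlim Y y"
  shows "(\<lambda>n. ri (X n) (Y n)) \<longlonglongrightarrow> ri x y"
proof -
  have in_carrier: "X n \<in> carrier H" "Y n \<in> carrier H" "x \<in> carrier H" "y \<in> carrier H" for n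
    using X Y by (auto simp: hlim_def)
  let ?a = "\<lambda>n. hnorm H (X n - x)" and ?b = "\<lambda>n. hnorm H (Y n - y)"
  have lim: "?a \<longlonglongrightarrow> 0" "?b \<longlonglongrightarrow> 0" using X Y by (auto simp: hlim_def)
  have le: "norm (ri (X n) (Y n) - ri x y) \<le> ?a n * ?b n + ?a n * hnorm H y + hnorm H x * ?b n" for n
  proof -
    have "ri (X n) (Y n) - ri x y = ri (X n - x) (Y n - y) + ri (X n - x) y + ri x (Y n - y)"
      using in_carrier by simp
    then show ?thesis
      using ri_Cauchy_Schwarz[of "X n - x" "Y n - y"] ri_Cauchy_Schwarz[of "X n - x" y]
        ri_Cauchy_Schwarz[of x "Y n - y"] in_carrier by auto
  qed
  have "(\<lambda>n. ?a n * ?b n + ?a n * hnorm H y + hnorm H x * ?b n) \<longlonglongrightarrow> 0"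
    using lim by (auto intro!: tendsto_eq_intros)
  then have "(\<lambda>n. ri (X n) (Y n) - ri x y) \<longlonglongrightarrow> 0"
    by (rule Lim_null_comparison[OF always_eventually[OF allI[OF le]]])
  then show ?thesis using LIM_zero_iff by blast
qed

lemma hlim_ri_left:
  assumes "hlim X x" "y \<in> carrier H" shows "(\<lambda>n. ri (X n) y) \<longlonglongrightarrow> ri x y"
  using hlim_ri[OF assms(1) hlim_const[OF assms(2)]] .

lemma hlim_unique:
  assumes "hlim X x" "hlim X x'" shows "x = x'"
proof (rule ri_eqI)
  show "x \<in> carrier H" "x' \<in> carrier H" using assms by (auto simp: hlim_def)
  fix y assume "y \<in> carrier H"
  then show "ri x y = ri x' y"
    using LIMSEQ_unique[OF hlim_ri_left[OF assms(1)] hlim_ri_left[OF assms(2)]] by blast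
qed

lemma hlim_hnorm: "hlim X x \<Longrightarrow> (\<lambda>n. hnorm H (X n)) \<longlonglongrightarrow> hnorm H x"
  unfolding hnorm_def by (intro tendsto_real_sqrt hlim_ri)

lemma hlim_add:
  assumes "hlim X x" "hlim Y y" shows "hlim (\<lambda>n. X n + Y n) (x + y)"
proof -
  have c: "X n \<in> carrier H" "Y n \<in> carrier H" "x \<in> carrier H" "y \<in> carrier H" for n
    using assms by (auto simp: hlim_def)
  have lim: "(\<lambda>n. hnorm H (X n - x) + hnorm H (Y n - y)) \<longlonglongrightarrow> 0"
    using assms tendsto_add[of "\<lambda>n. hnorm H (X n - x)" 0 sequentially "\<lambda>n. hnorm H (Y n - y)" 0]
    by (simp add: hlim_def)
  have "norm (hnorm H (X n + Y n - (x + y))) \<le> hnorm H (X n - x) + hnorm H (Y n - y)" for n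
    using hnorm_triangle[of "X n - x" "Y n - y"] c by (simp add: add_diff_add)
  from Lim_null_comparison[OF always_eventually[OF allI[OF this]] lim]
  have "(\<lambda>n. hnorm H (X n + Y n - (x + y))) \<longlonglongrightarrow> 0" .
  then show ?thesis using c by (simp add: hlim_def)
qed

lemma hlim_scale:
  assumes "hlim X x" shows "hlim (\<lambda>n. scale H c (X n)) (scale H c x)"
proof -
  have c: "X n \<in> carrier H" "x \<in> carrier H" for n using assms by (auto simp: hlim_def)
  have "(\<lambda>n. cmod c * hnorm H (X n - x)) \<longlonglongrightarrow> 0"
    using assms by (auto simp: hlim_def intro!: tendsto_eq_intros)
  then show ?thesis using c by (simp add: hlim_def flip: scale_right_diff_distrib hnorm_scale)
qed

text \<open>
  A polynomial that is close to \<open>f\<close> on the spectrum is close there to the polynomials of the sequence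
  that defines \<open>f(A)\<close>, hence so are their values at \<open>A\<close>. In particular \<open>f(A)\<close> does not depend on that
  sequence.
\<close>

lemma is_op_fun_approx:
  assumes A: "self_adjoint H A" and T: "is_op_fun H f A T"
    and p: "\<And>t. t \<in> rspec A \<Longrightarrow> \<bar>poly p t - f t\<bar> \<le> e" and e: "0 \<le> e" and x: "x \<in> carrier H"
  shows "hnorm H (poly_op H p A x - T x) \<le> e * hnorm H x"
proof (rule field_le_epsilon)
  fix d0 :: real assume "0 < d0"
  define d where "d = d0 / (2 * hnorm H x + 1)"
  have "0 < 2 * hnorm H x + 1" using x by (simp add: add_nonneg_pos)
  then have d: "0 < d" "2 * d * hnorm H x \<le> d0"
    using \<open>0 < d0\<close> x by (auto simp: d_def field_simps)
  obtain P where ul: "uniform_limit (rspec A) (\<lambda>n. poly (P n)) f sequentially"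
    and P: "\<And>e. 0 < e \<Longrightarrow> \<exists>N. \<forall>n\<ge>N. \<forall>x\<in>carrier H. hnorm H (poly_op H (P n) A x - T x) \<le> e * hnorm H x"
    and bo: "bounded_operator H T"
    using T unfolding is_op_fun_def rspec_def by blast
  have "eventually (\<lambda>n. \<forall>t\<in>rspec A. dist (poly (P n) t) (f t) < d) sequentially"
    using uniform_limitD[OF ul d(1)] .
  moreover have "eventually (\<lambda>n. \<forall>x\<in>carrier H. hnorm H (poly_op H (P n) A x - T x) \<le> d * hnorm H x) sequentially"
    using P[OF d(1)] by (simp add: eventually_sequentially)
  ultimately have "eventually (\<lambda>n. (\<forall>t\<in>rspec A. dist (poly (P n) t) (f t) < d) \<and>
      (\<forall>x\<in>carrier H. hnorm H (poly_op H (P n) A x - T x) \<le> d * hnorm H x)) sequentially"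
    by (rule eventually_conj)
  then obtain n where n: "\<And>t. t \<in> rspec A \<Longrightarrow> \<bar>poly (P n) t - f t\<bar> < d"
    "hnorm H (poly_op H (P n) A x - T x) \<le> d * hnorm H x"
    using x unfolding eventually_sequentially dist_real_def by blast
  have "hnorm H (poly_op H (p - P n) A x) \<le> (e + d) * hnorm H x"
  proof (rule poly_op_hnorm_le[OF A _ _ x])
    fix t assume "t \<in> rspec A"
    from n(1)[OF this] p[OF this] show "\<bar>poly (p - P n) t\<bar> \<le> e + d" by simp
  qed (use e d in simp)
  moreover have "hnorm H (poly_op H p A x - T x) \<le>
      hnorm H (poly_op H p A x - poly_op H (P n) A x) + hnorm H (poly_op H (P n) A x - T x)"
    using A bo x by (intro hnorm_diff_triangle) (simp_all add: bounded_poly_op)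
  ultimately show "hnorm H (poly_op H p A x - T x) \<le> e * hnorm H x + d0"
    using n(2) d(2) by (simp add: poly_op_diff algebra_simps)
qed

lemma positive_definite_rspec:
  assumes "positive_definite H A"
  obtains m k where "0 < m" "m \<le> k" "rspec A \<subseteq> {m..k}"
proof -
  have A: "self_adjoint H A" using assms by simp
  obtain m where m: "0 < m" "\<And>x. x \<in> carrier H \<Longrightarrow> m * ri x x \<le> ri (A x) x"
    by (rule positive_definite_coercive[OF assms]) (rule that; assumption)
  obtain k where k: "0 < k" "\<And>x. x \<in> carrier H \<Longrightarrow> \<bar>ri (A x) x\<bar> \<le> k * ri x x"
    by (rule sa_form_bounds[OF A]) (rule that; assumption)
  have "rspec A \<subseteq> {m..k}" using rspec_subset[OF A m(2), of k] k(2) by (auto simp: abs_le_iff)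
  then show ?thesis using m(1) by (intro that[of m "max m k"]) auto
qed

text \<open>
  Approximating polynomials are chosen on an interval around the spectrum, where the values of the
  polynomials at the operator form a Cauchy sequence.
\<close>

lemma is_op_fun_op_fun:
  assumes pd: "positive_definite H A" and f: "continuous_on {0<..} f"
  shows "is_op_fun H f A (op_fun H f A)"
proof -
  have A: "self_adjoint H A" and bo: "bounded_operator H A" using pd by auto
  obtain m k where mk: "0 < m" "rspec A \<subseteq> {m..k}"
    by (rule positive_definite_rspec[OF pd]) (rule that; assumption)
  have "continuous_on {m..k} f" using f mk(1) by (auto intro: continuous_on_subset)
  then obtain P where ul: "uniform_limit {m..k} (\<lambda>n. poly (P n)) f sequentially"
    by (rule real_poly_uniform_limit)
  have ulr: "uniform_limit (rspec A) (\<lambda>n. poly (P n)) f sequentially"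
    using uniform_limit_on_subset[OF ul mk(2)] .
  have Pin: "poly_op H p A x \<in> carrier H" if "x \<in> carrier H" for p x
    using that bo by (simp add: bounded_poly_op)
  have Cauchy: "\<exists>N. \<forall>i\<ge>N. \<forall>j\<ge>N. \<forall>x\<in>carrier H.
      hnorm H (poly_op H (P i) A x - poly_op H (P j) A x) \<le> e * hnorm H x" if e: "0 < e" for e
  proof -
    have "\<forall>\<^sub>F n in sequentially. \<forall>t\<in>rspec A. dist (poly (P n) t) (f t) < e / 2"
      using uniform_limitD[OF ulr, of "e / 2"] e by simp
    then obtain N where N: "\<And>n t. N \<le> n \<Longrightarrow> t \<in> rspec A \<Longrightarrow> \<bar>poly (P n) t - f t\<bar> < e / 2"
      unfolding eventually_sequentially dist_real_def by blast
    have "hnorm H (poly_op H (P i - P j) A x) \<le> e * hnorm H x"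
      if "N \<le> i" "N \<le> j" "x \<in> carrier H" for i j x
    proof (rule poly_op_hnorm_le[OF A _ _ that(3)])
      fix t assume "t \<in> rspec A"
      from N[OF that(1) this] N[OF that(2) this] show "\<bar>poly (P i - P j) t\<bar> \<le> e"
        unfolding poly_diff by (auto simp: abs_if field_simps split: if_splits)
    qed (use e in simp)
    then show ?thesis by (auto simp: poly_op_diff)
  qed
  have "\<exists>l. hlim (\<lambda>n. poly_op H (P n) A x) l" if x: "x \<in> carrier H" for x
  proof -
    have "\<exists>N. \<forall>i\<ge>N. \<forall>j\<ge>N. hnorm H (poly_op H (P i) A x - poly_op H (P j) A x) < e" if e: "0 < e" for e
    proof -
      have p: "0 < hnorm H x + 1" using x by (simp add: add_nonneg_pos)
      then have "0 < e / (hnorm H x + 1)" using e by simp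
      from Cauchy[OF this] obtain N where N: "\<And>i j. N \<le> i \<Longrightarrow> N \<le> j \<Longrightarrow>
        hnorm H (poly_op H (P i) A x - poly_op H (P j) A x) \<le> e / (hnorm H x + 1) * hnorm H x"
        using x by blast
      have "e / (hnorm H x + 1) * hnorm H x < e" using e p x by (simp add: field_simps)
      then show ?thesis using N by (meson le_less_trans)
    qed
    then show ?thesis using complete[of "\<lambda>n. poly_op H (P n) A x"] Pin[OF x] by (auto simp: hlim_def)
  qed
  then obtain T where T: "\<And>x. x \<in> carrier H \<Longrightarrow> hlim (\<lambda>n. poly_op H (P n) A x) (T x)" by metis
  have Tin: "T x \<in> carrier H" if "x \<in> carrier H" for x using T[OF that] by (simp add: hlim_def)
  have conv: "\<exists>N. \<forall>n\<ge>N. \<forall>x\<in>carrier H. hnorm H (poly_op H (P n) A x - T x) \<le> e * hnorm H x"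
    if e: "0 < e" for e
  proof -
    obtain N where N: "\<And>i j x. N \<le> i \<Longrightarrow> N \<le> j \<Longrightarrow> x \<in> carrier H \<Longrightarrow>
        hnorm H (poly_op H (P i) A x - poly_op H (P j) A x) \<le> e * hnorm H x"
      using Cauchy[OF e] by blast
    have "hnorm H (poly_op H (P n) A x - T x) \<le> e * hnorm H x" if n: "N \<le> n" and x: "x \<in> carrier H" for n x
    proof (rule LIMSEQ_le_const2)
      have "hlim (\<lambda>j. poly_op H (P n) A x + scale H (- 1) (poly_op H (P j) A x))
        (poly_op H (P n) A x + scale H (- 1) (T x))"
        by (intro hlim_add hlim_const hlim_scale T Pin x)
      from hlim_hnorm[OF this]
      show "(\<lambda>j. hnorm H (poly_op H (P n) A x - poly_op H (P j) A x)) \<longlonglongrightarrow> hnorm H (poly_op H (P n) A x - T x)"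
        by simp
      show "\<exists>N. \<forall>j\<ge>N. hnorm H (poly_op H (P n) A x - poly_op H (P j) A x) \<le> e * hnorm H x"
        using N[OF n _ x] by blast
    qed
    then show ?thesis by blast
  qed
  have boT: "bounded_operator H T"
  proof -
    obtain n where n: "\<And>x. x \<in> carrier H \<Longrightarrow> hnorm H (poly_op H (P n) A x - T x) \<le> 1 * hnorm H x"
      using conv[of 1] by auto
    have boP: "bounded_operator H (poly_op H p A)" for p using bo by (rule bounded_poly_op)
    obtain L where L: "\<And>x. x \<in> carrier H \<Longrightarrow> hnorm H (poly_op H (P n) A x) \<le> L * hnorm H x"
      by (rule bo_bound[OF boP[of "P n"]]) (rule that; assumption)
    show ?thesis
    proof (rule bounded_operatorI[where K = "L + 1"])
      fix x y assume xy: "x \<in> carrier H" "y \<in> carrier H"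
      have "hlim (\<lambda>n. poly_op H (P n) A (x + y)) (T x + T y)"
        using hlim_add[OF T[OF xy(1)] T[OF xy(2)]] xy by (simp add: bo_add[OF boP])
      then show "T (x + y) = T x + T y" using T[of "x + y"] xy by (blast intro: hlim_unique add_in)
    next
      fix c x assume x: "x \<in> carrier H"
      have "hlim (\<lambda>n. poly_op H (P n) A (scale H c x)) (scale H c (T x))"
        using hlim_scale[OF T[OF x]] x by (simp add: bo_scale[OF boP])
      then show "T (scale H c x) = scale H c (T x)" using T[of "scale H c x"] x
        by (blast intro: hlim_unique scale_in)
    next
      fix x assume x: "x \<in> carrier H"
      have "hnorm H (T x) \<le> hnorm H (T x - poly_op H (P n) A x) + hnorm H (poly_op H (P n) A x)"
        using hnorm_triangle[of "T x - poly_op H (P n) A x" "poly_op H (P n) A x"] x Tin Pin by simp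
      also have "\<dots> \<le> (L + 1) * hnorm H x"
        using n[OF x] L[OF x] hnorm_diff_commute[of "T x"] x Tin Pin by (simp add: algebra_simps)
      finally show "hnorm H (T x) \<le> (L + 1) * hnorm H x" .
    qed (rule Tin)
  qed
  have "is_op_fun H f A T"
    unfolding is_op_fun_def using boT ulr conv by (auto simp: rspec_def)
  then show ?thesis unfolding op_fun_def by (rule someI[of "is_op_fun H f A"])
qed

text \<open>
  Any polynomials converging uniformly to \<open>f\<close> on a set that contains the spectrum compute \<open>f(A)\<close>, so
  algebraic identities pass from polynomials to continuous functions.
\<close>

lemma op_fun_hlim:
  assumes pd: "positive_definite H A" and f: "continuous_on {0<..} f"
    and ul: "uniform_limit S (\<lambda>n. poly (P n)) f sequentially" and S: "rspec A \<subseteq> S"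
    and x: "x \<in> carrier H"
  shows "hlim (\<lambda>n. poly_op H (P n) A x) (op_fun H f A x)"
proof -
  have A: "self_adjoint H A" using pd by simp
  have F: "is_op_fun H f A (op_fun H f A)" by (rule is_op_fun_op_fun[OF pd f])
  then have bo: "bounded_operator H (op_fun H f A)" by (simp add: is_op_fun_def)
  have ulr: "uniform_limit (rspec A) (\<lambda>n. poly (P n)) f sequentially"
    using uniform_limit_on_subset[OF ul S] .
  have "(\<lambda>n. hnorm H (poly_op H (P n) A x - op_fun H f A x)) \<longlonglongrightarrow> 0"
  proof (rule tendstoI)
    fix e0 :: real assume e0: "0 < e0"
    define e where "e = e0 / (hnorm H x + 1)"
    have p: "0 < hnorm H x + 1" using x by (simp add: add_nonneg_pos)
    then have e: "0 < e" "e * hnorm H x < e0" using e0 x by (auto simp: e_def field_simps)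
    from uniform_limitD[OF ulr e(1)]
    show "\<forall>\<^sub>F n in sequentially. dist (hnorm H (poly_op H (P n) A x - op_fun H f A x)) 0 < e0"
    proof (rule eventually_mono)
      fix n assume "\<forall>t\<in>rspec A. dist (poly (P n) t) (f t) < e"
      then have "hnorm H (poly_op H (P n) A x - op_fun H f A x) \<le> e * hnorm H x"
        using e(1) x by (intro is_op_fun_approx[OF A F]) (auto simp: dist_real_def intro: less_imp_le)
      then show "dist (hnorm H (poly_op H (P n) A x - op_fun H f A x)) 0 < e0"
        using e(2) x A bo by (simp add: bounded_poly_op)
    qed
  qed
  then show ?thesis using x A bo by (simp add: hlim_def bounded_poly_op)
qed

lemma op_fun_bounded:
  "positive_definite H A \<Longrightarrow> continuous_on {0<..} f \<Longrightarrow> bounded_operator H (op_fun H f A)"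
  using is_op_fun_op_fun by (simp add: is_op_fun_def)

lemma op_fun_in [simp]:
  "positive_definite H A \<Longrightarrow> continuous_on {0<..} f \<Longrightarrow> x \<in> carrier H \<Longrightarrow> op_fun H f A x \<in> carrier H"
  using op_fun_bounded by simp

lemma spectral_approximation:
  assumes pd: "positive_definite H A" and f: "continuous_on {0<..} f"
  obtains P m k where "0 < m" "rspec A \<subseteq> {m..k}" "uniform_limit {m..k} (\<lambda>n. poly (P n)) f sequentially"
proof -
  obtain m k where mk: "0 < m" "rspec A \<subseteq> {m..k}"
    by (rule positive_definite_rspec[OF pd]) (rule that; assumption)
  have "continuous_on {m..k} f" using f mk(1) by (auto intro: continuous_on_subset)
  then obtain P where "uniform_limit {m..k} (\<lambda>n. poly (P n)) f sequentially"
    by (rule real_poly_uniform_limit)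
  with mk show ?thesis using that by blast
qed

lemma op_fun_sa:
  assumes pd: "positive_definite H A" and f: "continuous_on {0<..} f"
  shows "self_adjoint H (op_fun H f A)"
proof (rule self_adjointI[OF op_fun_bounded[OF pd f]])
  obtain P :: "nat \<Rightarrow> real poly" and m k where P: "rspec A \<subseteq> {m..k}" "uniform_limit {m..k} (\<lambda>n. poly (P n)) f sequentially"
    by (rule spectral_approximation[OF pd f]) (rule that; assumption)
  have A: "self_adjoint H A" using pd by simp
  fix x y assume xy: "x \<in> carrier H" "y \<in> carrier H"
  note lim = op_fun_hlim[OF pd f P(2,1)]
  have "(\<lambda>n. ri (poly_op H (P n) A x) y) \<longlonglongrightarrow> ri (op_fun H f A x) y"
    by (rule hlim_ri_left[OF lim[OF xy(1)] xy(2)])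
  moreover have "(\<lambda>n. ri (poly_op H (P n) A x) y) \<longlonglongrightarrow> ri x (op_fun H f A y)"
    using hlim_ri[OF hlim_const[OF xy(1)] lim[OF xy(2)]] xy by (simp add: sa_ri[OF sa_poly_op[OF A]])
  ultimately show "ri (op_fun H f A x) y = ri x (op_fun H f A y)" by (rule LIMSEQ_unique)
qed

text \<open>
  Multiplicativity is tested on inner products: \<open>\<langle>p\<^sub>n(A) r\<^sub>n(A) x, y\<rangle> = \<langle>r\<^sub>n(A) x, p\<^sub>n(A) y\<rangle>\<close> converges because
  both vectors on the right do, so convergence at single vectors suffices.
\<close>

lemma op_fun_mult:
  assumes pd: "positive_definite H A" and f: "continuous_on {0<..} f" and g: "continuous_on {0<..} g"
    and x: "x \<in> carrier H"
  shows "op_fun H (\<lambda>t. f t * g t) A x = op_fun H f A (op_fun H g A x)"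
proof (rule ri_eqI)
  have A: "self_adjoint H A" "bounded_operator H A" using pd by auto
  have fg: "continuous_on {0<..} (\<lambda>t. f t * g t)" using f g by (rule continuous_on_mult)
  show "op_fun H (\<lambda>t. f t * g t) A x \<in> carrier H" "op_fun H f A (op_fun H g A x) \<in> carrier H"
    using pd f g fg x by auto
  obtain m k where mk: "0 < m" "rspec A \<subseteq> {m..k}"
    by (rule positive_definite_rspec[OF pd]) (rule that; assumption)
  have cf: "continuous_on {m..k} f" and cg: "continuous_on {m..k} g"
    using f g mk(1) by (auto intro: continuous_on_subset)
  obtain P where P: "uniform_limit {m..k} (\<lambda>n. poly (P n)) f sequentially"
    by (rule real_poly_uniform_limit[OF cf])
  obtain R where R: "uniform_limit {m..k} (\<lambda>n. poly (R n)) g sequentially"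
    by (rule real_poly_uniform_limit[OF cg])
  have "uniform_limit {m..k} (\<lambda>n t. poly (P n) t * poly (R n) t) (\<lambda>t. f t * g t) sequentially"
    by (intro uniform_lim_mult P R compact_imp_bounded compact_continuous_image cf cg compact_Icc)
  then have PR: "uniform_limit {m..k} (\<lambda>n. poly (P n * R n)) (\<lambda>t. f t * g t) sequentially"
    by (simp add: fun_eq_iff poly_mult[abs_def])
  fix y assume y: "y \<in> carrier H"
  have "(\<lambda>n. ri (poly_op H (P n * R n) A x) y) \<longlonglongrightarrow> ri (op_fun H (\<lambda>t. f t * g t) A x) y"
    by (rule hlim_ri_left[OF op_fun_hlim[OF pd fg PR mk(2) x] y])
  moreover have "ri (poly_op H (P n * R n) A x) y = ri (poly_op H (R n) A x) (poly_op H (P n) A y)" for n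
    using x y A bounded_poly_op[OF A(2)] by (simp add: poly_op_mult sa_ri[OF sa_poly_op[OF A(1)]])
  moreover have "(\<lambda>n. ri (poly_op H (R n) A x) (poly_op H (P n) A y)) \<longlonglongrightarrow> ri (op_fun H g A x) (op_fun H f A y)"
    by (rule hlim_ri[OF op_fun_hlim[OF pd g R mk(2) x] op_fun_hlim[OF pd f P mk(2) y]])
  ultimately have "ri (op_fun H (\<lambda>t. f t * g t) A x) y = ri (op_fun H g A x) (op_fun H f A y)"
    by (simp add: LIMSEQ_unique)
  then show "ri (op_fun H (\<lambda>t. f t * g t) A x) y = ri (op_fun H f A (op_fun H g A x)) y"
    using sa_ri[OF op_fun_sa[OF pd f]] pd g x y by simp
qed

lemma op_fun_add:
  assumes pd: "positive_definite H A" and f: "continuous_on {0<..} f" and g: "continuous_on {0<..} g"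
    and x: "x \<in> carrier H"
  shows "op_fun H (\<lambda>t. f t + g t) A x = op_fun H f A x + op_fun H g A x"
proof -
  have fg: "continuous_on {0<..} (\<lambda>t. f t + g t)" using f g by (rule continuous_on_add)
  obtain m k where mk: "0 < m" "rspec A \<subseteq> {m..k}"
    by (rule positive_definite_rspec[OF pd]) (rule that; assumption)
  have cf: "continuous_on {m..k} f" and cg: "continuous_on {m..k} g"
    using f g mk(1) by (auto intro: continuous_on_subset)
  obtain P where P: "uniform_limit {m..k} (\<lambda>n. poly (P n)) f sequentially"
    by (rule real_poly_uniform_limit[OF cf])
  obtain R where R: "uniform_limit {m..k} (\<lambda>n. poly (R n)) g sequentially"
    by (rule real_poly_uniform_limit[OF cg])
  have PR: "uniform_limit {m..k} (\<lambda>n. poly (P n + R n)) (\<lambda>t. f t + g t) sequentially"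
    using uniform_limit_add[OF P R] by (simp add: fun_eq_iff poly_add[abs_def])
  show ?thesis
    using hlim_unique[OF op_fun_hlim[OF pd fg PR mk(2) x]]
      hlim_add[OF op_fun_hlim[OF pd f P mk(2) x] op_fun_hlim[OF pd g R mk(2) x]]
    by (simp add: poly_op_add)
qed

lemma op_fun_poly:
  assumes pd: "positive_definite H A" and x: "x \<in> carrier H"
  shows "op_fun H (poly p) A x = poly_op H p A x"
proof -
  have c: "continuous_on {0<..} (poly p)" by (intro continuous_intros)
  have "hlim (\<lambda>n. poly_op H p A x) (op_fun H (poly p) A x)"
    using op_fun_hlim[OF pd c uniform_limit_const subset_UNIV x] .
  moreover have "hlim (\<lambda>n. poly_op H p A x) (poly_op H p A x)"
    using x pd by (intro hlim_const) (simp add: bounded_poly_op)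
  ultimately show ?thesis by (rule hlim_unique)
qed

lemma op_fun_const:
  assumes "positive_definite H A" "x \<in> carrier H" shows "op_fun H (\<lambda>t. c) A x = rscale c x"
  using op_fun_poly[OF assms, of "[:c:]"] by (simp add: poly_op_pCons poly_pCons[abs_def])

lemma op_fun_ident:
  assumes "positive_definite H A" "x \<in> carrier H" shows "op_fun H (\<lambda>t. t) A x = A x"
  using op_fun_poly[OF assms, of "[:0, 1:]"] by (simp add: poly_op_pCons poly_pCons[abs_def])

lemma op_fun_cmult:
  assumes "positive_definite H A" "continuous_on {0<..} f" "x \<in> carrier H"
  shows "op_fun H (\<lambda>t. c * f t) A x = rscale c (op_fun H f A x)"
  using op_fun_mult[OF assms(1) continuous_on_const assms(2,3)] assms by (simp add: op_fun_const)

text \<open>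
  A polynomial within \<open>e\<close> of \<open>f\<close> is at least \<open>- e\<close> on the spectrum, so its value at \<open>A\<close> is at least \<open>- e\<close>.
\<close>

lemma op_fun_nonneg:
  assumes pd: "positive_definite H A" and f: "continuous_on {0<..} f"
    and nn: "\<And>t. t \<in> rspec A \<Longrightarrow> 0 \<le> f t" and x: "x \<in> carrier H"
  shows "0 \<le> ri (op_fun H f A x) x"
proof -
  have A: "self_adjoint H A" using pd by simp
  obtain P :: "nat \<Rightarrow> real poly" and m k where P: "rspec A \<subseteq> {m..k}" "uniform_limit {m..k} (\<lambda>n. poly (P n)) f sequentially"
    by (rule spectral_approximation[OF pd f]) (rule that; assumption)
  have "- (e * ri x x) \<le> ri (op_fun H f A x) x" if e: "0 < e" for e
  proof -
    have ev: "\<forall>\<^sub>F n in sequentially. \<forall>t\<in>{m..k}. dist (poly (P n) t) (f t) < e"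
      by (rule uniform_limitD[OF P(2) e])
    have "\<forall>\<^sub>F n in sequentially. - (e * ri x x) \<le> ri (poly_op H (P n) A x) x"
      using ev
    proof (rule eventually_mono)
      fix n assume n: "\<forall>t\<in>{m..k}. dist (poly (P n) t) (f t) < e"
      have "0 \<le> ri (poly_op H (P n + [:e:]) A x) x"
      proof (rule poly_op_nonneg[OF A _ x])
        fix t assume t: "t \<in> rspec A"
        then have "dist (poly (P n) t) (f t) < e" using n P(1) by blast
        then show "0 \<le> poly (P n + [:e:]) t" using nn[OF t] by (simp add: dist_real_def)
      qed
      then show "- (e * ri x x) \<le> ri (poly_op H (P n) A x) x"
        using x A by (simp add: poly_op_add poly_op_pCons bounded_poly_op)
    qed
    then show ?thesis
      by (intro tendsto_lowerbound[OF hlim_ri_left[OF op_fun_hlim[OF pd f P(2,1) x] x]]) auto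
  qed
  from this[of "d / (ri x x + 1)" for d] have "0 \<le> ri (op_fun H f A x) x + d" if d: "0 < d" for d
  proof -
    have p: "0 < ri x x + 1" using x by (simp add: add_nonneg_pos)
    then have "- (d / (ri x x + 1) * ri x x) \<le> ri (op_fun H f A x) x"
      using d by (intro \<open>\<And>e. 0 < e \<Longrightarrow> - (e * ri x x) \<le> ri (op_fun H f A x) x\<close>) simp
    moreover have "d / (ri x x + 1) * ri x x \<le> d" using p d by (simp add: field_simps)
    ultimately show ?thesis by linarith
  qed
  then show ?thesis by (rule field_le_epsilon)
qed

lemma op_fun_form_mono:
  assumes pd: "positive_definite H A" and f: "continuous_on {0<..} f" and g: "continuous_on {0<..} g"
    and le: "\<And>t. t \<in> rspec A \<Longrightarrow> f t \<le> g t" and x: "x \<in> carrier H"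
  shows "ri (op_fun H f A x) x \<le> ri (op_fun H g A x) x"
proof -
  have c: "continuous_on {0<..} (\<lambda>t. (- 1) * f t)" using f by (intro continuous_intros)
  have c2: "continuous_on {0<..} (\<lambda>t. g t + (- 1) * f t)" using f g by (intro continuous_intros)
  have "0 \<le> ri (op_fun H (\<lambda>t. g t + (- 1) * f t) A x) x"
    using le by (intro op_fun_nonneg[OF pd c2 _ x]) simp
  also have "op_fun H (\<lambda>t. g t + (- 1) * f t) A x = op_fun H g A x + rscale (- 1) (op_fun H f A x)"
    by (simp only: op_fun_add[OF pd g c x] op_fun_cmult[OF pd f x])
  finally show ?thesis using x f g pd by (simp del: of_real_minus)
qed

lemma op_fun_cong:
  assumes pd: "positive_definite H A" and f: "continuous_on {0<..} f"
    and eq: "\<And>t. 0 < t \<Longrightarrow> f t = g t" and x: "x \<in> carrier H"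
  shows "op_fun H f A x = op_fun H g A x"
proof -
  have g: "continuous_on {0<..} g" using f continuous_on_cong[of "{0<..}" "{0<..}" f g] eq by simp
  obtain P :: "nat \<Rightarrow> real poly" and m k where P: "0 < m" "rspec A \<subseteq> {m..k}" "uniform_limit {m..k} (\<lambda>n. poly (P n)) f sequentially"
    by (rule spectral_approximation[OF pd f]) (rule that; assumption)
  have "uniform_limit {m..k} (\<lambda>n. poly (P n)) g sequentially"
    by (rule uniform_limit_cong'[THEN iffD1, OF _ _ P(3)]) (use eq P(1) in auto)
  then show ?thesis
    by (intro hlim_unique[OF op_fun_hlim[OF pd f P(3,2) x]] op_fun_hlim[OF pd g _ P(2) x])
qed

lemma op_fun_positive_definite:
  assumes pd: "positive_definite H A" and f: "continuous_on {0<..} f" and pos: "\<And>t. 0 < t \<Longrightarrow> 0 < f t"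
  shows "positive_definite H (op_fun H f A)"
proof -
  obtain m k where mk: "0 < m" "m \<le> k" "rspec A \<subseteq> {m..k}"
    by (rule positive_definite_rspec[OF pd]) (rule that; assumption)
  have "continuous_on {m..k} f" using f mk(1) by (auto intro: continuous_on_subset)
  then obtain t0 where t0: "t0 \<in> {m..k}" "\<And>t. t \<in> {m..k} \<Longrightarrow> f t0 \<le> f t"
    using continuous_attains_inf[of "{m..k}" f] mk(2) by auto
  show ?thesis
  proof (rule positive_definiteI[OF op_fun_sa[OF pd f]])
    show "0 < f t0" using pos t0(1) mk(1) by simp
    fix x assume x: "x \<in> carrier H"
    have "ri (op_fun H (\<lambda>t. f t0) A x) x \<le> ri (op_fun H f A x) x"
      using t0(2) mk(3) by (intro op_fun_form_mono[OF pd _ f _ x] continuous_on_const) auto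
    then show "f t0 * ri x x \<le> ri (op_fun H f A x) x" using x by (simp add: op_fun_const[OF pd])
  qed
qed

end

text \<open>
  This is clear for polynomials and preserved by limits. With \<open>c = 1\<close> it compares operators on different
  spaces, and with \<open>\<Phi> = 1\<close> it describes the effect of rescaling an operator.
\<close>

lemma op_fun_intertwine:
  fixes K :: "'k::ab_group_add hspace" and H :: "'v::ab_group_add hspace"
  assumes K: "hilbert_space K" and H: "hilbert_space H"
    and A: "positive_definite K A" and B: "positive_definite H B"
    and f: "continuous_on {0<..} f" and c: "0 < c"
    and \<Phi>in: "\<And>x. x \<in> carrier K \<Longrightarrow> \<Phi> x \<in> carrier H"
    and add: "\<And>x y. x \<in> carrier K \<Longrightarrow> y \<in> carrier K \<Longrightarrow> \<Phi> (x + y) = \<Phi> x + \<Phi> y"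
    and scale: "\<And>r x. x \<in> carrier K \<Longrightarrow> \<Phi> (scale K (of_real r) x) = scale H (of_real r) (\<Phi> x)"
    and bound: "\<And>x. x \<in> carrier K \<Longrightarrow> hnorm H (\<Phi> x) \<le> L * hnorm K x"
    and inter: "\<And>x. x \<in> carrier K \<Longrightarrow> \<Phi> (A x) = scale H (of_real c) (B (\<Phi> x))"
    and x: "x \<in> carrier K"
  shows "\<Phi> (op_fun K f A x) = op_fun H (\<lambda>t. f (c * t)) B (\<Phi> x)"
proof -
  interpret K: hilbert_space K by fact
  interpret H: hilbert_space H by fact
  have bo: "bounded_operator K A" "bounded_operator H B" using A B by auto
  have \<Phi>poly: "\<Phi> (poly_op K p A x) = poly_op H (pcompose p [:0, c:]) B (\<Phi> x)"
    if "x \<in> carrier K" for p x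
    using that
  proof (induction p arbitrary: x)
    case 0
    then show ?case using add[of 0 0] by simp
  next
    case (pCons a p)
    have "\<Phi> (poly_op K (pCons a p) A x) =
        H.rscale a (\<Phi> x) + poly_op H (pcompose p [:0, c:]) B (H.rscale c (B (\<Phi> x)))"
      using pCons bo K.bounded_poly_op[OF bo(1)] by (simp add: K.poly_op_pCons add scale inter)
    also have "\<dots> = poly_op H ([:a:] + pcompose p [:0, c:] * [:0, c:]) B (\<Phi> x)"
      using H.poly_op_mult[OF bo(2), of "\<Phi> x" "pcompose p [:0, c:]" "[:0, c:]"] \<Phi>in pCons
      by (simp only: H.poly_op_add) (simp add: H.poly_op_pCons)
    finally show ?case by (simp add: pcompose_pCons mult.commute)
  qed
  obtain m1 k1 where mk1: "0 < m1" "K.rspec A \<subseteq> {m1..k1}"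
    by (rule K.positive_definite_rspec[OF A]) (rule that; assumption)
  obtain m2 k2 where mk2: "0 < m2" "H.rspec B \<subseteq> {m2..k2}"
    by (rule H.positive_definite_rspec[OF B]) (rule that; assumption)
  define m k where "m = min m1 (c * m2)" and "k = max k1 (c * k2)"
  have "0 < m" using mk1 mk2 c by (simp add: m_def)
  then have "continuous_on {m..k} f" using f by (auto intro: continuous_on_subset)
  then obtain P where P: "uniform_limit {m..k} (\<lambda>n. poly (P n)) f sequentially"
    by (rule real_poly_uniform_limit)
  have sub: "K.rspec A \<subseteq> {m..k}"
    using mk1(2) by (rule order_trans) (simp add: m_def k_def)
  have fc: "continuous_on {0<..} (\<lambda>t. f (c * t))"
    using c by (intro continuous_on_compose2[OF f] continuous_intros) auto
  have "uniform_limit {m2..k2} (\<lambda>n. poly (pcompose (P n) [:0, c:])) (\<lambda>t. f (c * t)) sequentially"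
  proof (rule uniform_limitI)
    fix e :: real assume "0 < e"
    from uniform_limitD[OF P this]
    show "\<forall>\<^sub>F n in sequentially. \<forall>t\<in>{m2..k2}. dist (poly (pcompose (P n) [:0, c:]) t) (f (c * t)) < e"
    proof (rule eventually_mono)
      fix n assume n: "\<forall>t\<in>{m..k}. dist (poly (P n) t) (f t) < e"
      have "c * t \<in> {m..k}" if "t \<in> {m2..k2}" for t
        using that c by (auto simp: m_def k_def intro: min.coboundedI2 max.coboundedI2)
      then show "\<forall>t\<in>{m2..k2}. dist (poly (pcompose (P n) [:0, c:]) t) (f (c * t)) < e"
        using n by (simp add: poly_pcompose mult.commute)
    qed
  qed
  then have right: "H.hlim (\<lambda>n. poly_op H (pcompose (P n) [:0, c:]) B (\<Phi> x)) (op_fun H (\<lambda>t. f (c * t)) B (\<Phi> x))"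
    by (rule H.op_fun_hlim[OF B fc _ mk2(2) \<Phi>in[OF x]])
  have diff: "\<Phi> (x - y) = \<Phi> x - \<Phi> y" if "x \<in> carrier K" "y \<in> carrier K" for x y
    using add[of "x - y" y] that by simp
  have "K.hlim (\<lambda>n. poly_op K (P n) A x) (op_fun K f A x)"
    by (rule K.op_fun_hlim[OF A f P sub x])
  then have in_K: "\<And>n. poly_op K (P n) A x \<in> carrier K" "op_fun K f A x \<in> carrier K"
    and lim: "(\<lambda>n. hnorm K (poly_op K (P n) A x - op_fun K f A x)) \<longlonglongrightarrow> 0"
    by (auto simp: K.hlim_def)
  have "(\<lambda>n. hnorm H (\<Phi> (poly_op K (P n) A x) - \<Phi> (op_fun K f A x))) \<longlonglongrightarrow> 0"
  proof (rule Lim_null_comparison[OF always_eventually])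
    show "\<forall>n. norm (hnorm H (\<Phi> (poly_op K (P n) A x) - \<Phi> (op_fun K f A x))) \<le>
        L * hnorm K (poly_op K (P n) A x - op_fun K f A x)"
      using bound in_K \<Phi>in by (simp flip: diff)
    show "(\<lambda>n. L * hnorm K (poly_op K (P n) A x - op_fun K f A x)) \<longlonglongrightarrow> 0"
      using lim by (auto intro!: tendsto_eq_intros)
  qed
  then have "H.hlim (\<lambda>n. \<Phi> (poly_op K (P n) A x)) (\<Phi> (op_fun K f A x))"
    using in_K \<Phi>in by (simp add: H.hlim_def)
  then show ?thesis using right by (simp add: \<Phi>poly[OF x] H.hlim_unique)
qed

section \<open>The orthogonal sum of two copies of a Hilbert space\<close>

text \<open>
  The two summands are the entries at \<open>0\<close> and \<open>1\<close> of a sequence of vectors that vanishes elsewhere, so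
  that operator monotonicity for spaces of sequences applies to \<open>H \<oplus> H\<close>.
\<close>

definition hsum :: "'v::ab_group_add hspace \<Rightarrow> (nat \<Rightarrow> 'v) hspace" where
  "hsum H = \<lparr>carrier = {f. f 0 \<in> carrier H \<and> f 1 \<in> carrier H \<and> (\<forall>n\<ge>2. f n = 0)},
    scale = (\<lambda>c f n. scale H c (f n)),
    ip = (\<lambda>f g. ip H (f 0) (g 0) + ip H (f 1) (g 1))\<rparr>"

definition pair :: "'v::zero \<Rightarrow> 'v \<Rightarrow> nat \<Rightarrow> 'v" where
  "pair x y n = (if n = 0 then x else if n = 1 then y else 0)"

lemma pair_simps [simp]: "pair x y 0 = x" "pair x y (Suc 0) = y"
  by (simp_all add: pair_def)

lemma pair_ge_2 [simp]: "2 \<le> n \<Longrightarrow> pair x y n = 0"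
  by (simp add: pair_def)

lemma carrier_hsum [simp]:
  "f \<in> carrier (hsum H) \<longleftrightarrow> f 0 \<in> carrier H \<and> f (Suc 0) \<in> carrier H \<and> (\<forall>n\<ge>2. f n = 0)"
  by (simp add: hsum_def)

lemma pair_in_hsum [simp]: "pair x y \<in> carrier (hsum H) \<longleftrightarrow> x \<in> carrier H \<and> y \<in> carrier H"
  by (simp add: pair_def)

lemma scale_hsum [simp]: "scale (hsum H) c f n = scale H c (f n)"
  by (simp add: hsum_def)

lemma ip_hsum [simp]: "ip (hsum H) f g = ip H (f 0) (g 0) + ip H (f (Suc 0)) (g (Suc 0))"
  by (simp add: hsum_def)

lemma hsum_eqI:
  assumes "f \<in> carrier (hsum H)" "g \<in> carrier (hsum H)" "f 0 = g 0" "f (Suc 0) = g (Suc 0)"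
  shows "f = g"
proof
  fix n show "f n = g n"
    using assms by (cases "n = 0"; cases "n = 1") auto
qed

context hilbert_space
begin

lemma hilbert_space_hsum: "hilbert_space (hsum H)"
proof -
  interpret K: vector_space "scale (hsum H)"
    by unfold_locales (auto simp: fun_eq_iff scale_right_distrib scale_left_distrib)
  have norm: "hnorm (hsum H) f = sqrt ((hnorm H (f 0))\<^sup>2 + (hnorm H (f (Suc 0)))\<^sup>2)"
    if "f \<in> carrier (hsum H)" for f
    using that by (simp add: hnorm_def)
  show ?thesis
  proof unfold_locales
    show "K.subspace (carrier (hsum H))"
      by (rule K.subspaceI) auto
    fix f g h assume "f \<in> carrier (hsum H)" "g \<in> carrier (hsum H)" "h \<in> carrier (hsum H)"
    then show "ip (hsum H) (f + g) h = ip (hsum H) f h + ip (hsum H) g h"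
      by (simp add: ip_add_left)
  next
    fix c f g assume "f \<in> carrier (hsum H)" "g \<in> carrier (hsum H)"
    then show "ip (hsum H) (scale (hsum H) c f) g = c * ip (hsum H) f g"
      by (simp add: ip_scale_left distrib_left)
  next
    fix f g assume "f \<in> carrier (hsum H)" "g \<in> carrier (hsum H)"
    then show "ip (hsum H) g f = cnj (ip (hsum H) f g)"
      by (simp add: ip_commute[of "f _" "g _"])
  next
    fix f assume f: "f \<in> carrier (hsum H)" "f \<noteq> 0"
    then have "f 0 \<noteq> 0 \<or> f (Suc 0) \<noteq> 0"
      using hsum_eqI[of f H 0] by auto
    then show "0 < Re (ip (hsum H) f f)"
      using f ip_pos[of "f 0"] ip_pos[of "f (Suc 0)"] ri_self_nonneg[of "f 0"] ri_self_nonneg[of "f (Suc 0)"]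
      by (auto intro: add_pos_nonneg add_nonneg_pos)
  next
    fix X :: "nat \<Rightarrow> nat \<Rightarrow> 'v"
    assume X: "\<And>n. X n \<in> carrier (hsum H)"
      and C: "\<And>e. 0 < e \<Longrightarrow> \<exists>N. \<forall>m\<ge>N. \<forall>n\<ge>N. hnorm (hsum H) (X m - X n) < e"
    have Xin: "X n 0 \<in> carrier H" "X n (Suc 0) \<in> carrier H" "\<And>k. 2 \<le> k \<Longrightarrow> X n k = 0" for n
      using X[of n] by auto
    have le: "hnorm H (X m i - X n i) \<le> hnorm (hsum H) (X m - X n)" if "i = 0 \<or> i = Suc 0" for i m n
      using that Xin by (auto simp: norm intro!: real_le_rsqrt)
    have "\<exists>l\<in>carrier H. (\<lambda>n. hnorm H (X n i - l)) \<longlonglongrightarrow> 0" if i: "i = 0 \<or> i = Suc 0" for i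
    proof (rule complete)
      show "X n i \<in> carrier H" for n using i Xin by auto
      show "\<exists>N. \<forall>m\<ge>N. \<forall>n\<ge>N. hnorm H (X m i - X n i) < e" if "0 < e" for e
        using C[OF that] le[OF i] by (meson le_less_trans)
    qed
    then obtain l0 l1 where l: "l0 \<in> carrier H" "l1 \<in> carrier H"
      "(\<lambda>n. hnorm H (X n 0 - l0)) \<longlonglongrightarrow> 0" "(\<lambda>n. hnorm H (X n (Suc 0) - l1)) \<longlonglongrightarrow> 0"
      by metis
    have "(\<lambda>n. sqrt ((hnorm H (X n 0 - l0))\<^sup>2 + (hnorm H (X n (Suc 0) - l1))\<^sup>2)) \<longlonglongrightarrow> sqrt (0\<^sup>2 + 0\<^sup>2)"
      by (intro tendsto_intros l)
    moreover have "X n - pair l0 l1 \<in> carrier (hsum H)" for n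
      using Xin l by (simp add: pair_def)
    ultimately have "(\<lambda>n. hnorm (hsum H) (X n - pair l0 l1)) \<longlonglongrightarrow> 0"
      by (simp add: norm)
    then show "\<exists>l\<in>carrier (hsum H). (\<lambda>n. hnorm (hsum H) (X n - l)) \<longlonglongrightarrow> 0"
      using l by (intro bexI[of _ "pair l0 l1"]) auto
  qed
qed

text \<open>
  Operator matrices with equal entries off the diagonal; conjugating \<open>C \<oplus> D\<close> by a rotation gives one.
\<close>

definition block :: "('v \<Rightarrow> 'v) \<Rightarrow> ('v \<Rightarrow> 'v) \<Rightarrow> ('v \<Rightarrow> 'v) \<Rightarrow> (nat \<Rightarrow> 'v) \<Rightarrow> (nat \<Rightarrow> 'v)" where
  "block P Q S f = pair (P (f 0) + Q (f (Suc 0))) (Q (f 0) + S (f (Suc 0)))"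

lemma hsum_hnorm_component:
  assumes "f \<in> carrier (hsum H)"
  shows "hnorm H (f 0) \<le> hnorm (hsum H) f" "hnorm H (f (Suc 0)) \<le> hnorm (hsum H) f"
  using assms by (auto simp: hnorm_def)

lemma hsum_hnorm_le:
  assumes "f \<in> carrier (hsum H)"
  shows "hnorm (hsum H) f \<le> hnorm H (f 0) + hnorm H (f (Suc 0))"
  using assms sqrt_add_le_add_sqrt by (simp add: hnorm_def)

lemma sa_block:
  assumes P: "self_adjoint H P" and Q: "self_adjoint H Q" and S: "self_adjoint H S"
  shows "self_adjoint (hsum H) (block P Q S)"
proof -
  interpret K: hilbert_space "hsum H" by (rule hilbert_space_hsum)
  have bo: "bounded_operator H P" "bounded_operator H Q" "bounded_operator H S"
    using P Q S by auto
  note linear = bo_add[OF bo(1)] bo_add[OF bo(2)] bo_add[OF bo(3)]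
    bo_scale[OF bo(1)] bo_scale[OF bo(2)] bo_scale[OF bo(3)]
  obtain LP where LP: "0 < LP" "\<And>x. x \<in> carrier H \<Longrightarrow> hnorm H (P x) \<le> LP * hnorm H x"
    by (rule bo_bound[OF bo(1)]) (rule that; assumption)
  obtain LQ where LQ: "0 < LQ" "\<And>x. x \<in> carrier H \<Longrightarrow> hnorm H (Q x) \<le> LQ * hnorm H x"
    by (rule bo_bound[OF bo(2)]) (rule that; assumption)
  obtain LS where LS: "0 < LS" "\<And>x. x \<in> carrier H \<Longrightarrow> hnorm H (S x) \<le> LS * hnorm H x"
    by (rule bo_bound[OF bo(3)]) (rule that; assumption)
  show ?thesis
  proof (rule K.self_adjointI)
    show "bounded_operator (hsum H) (block P Q S)"
    proof (rule K.bounded_operatorI[where K = "LP + LQ + LQ + LS"])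
      fix f assume f: "f \<in> carrier (hsum H)"
      then have f': "f 0 \<in> carrier H" "f (Suc 0) \<in> carrier H" by auto
      show "block P Q S f \<in> carrier (hsum H)" using f' bo by (simp add: block_def)
      then have "hnorm (hsum H) (block P Q S f) \<le>
          hnorm H (P (f 0) + Q (f (Suc 0))) + hnorm H (Q (f 0) + S (f (Suc 0)))"
        using hsum_hnorm_le[of "block P Q S f"] by (simp add: block_def)
      also have "\<dots> \<le> (hnorm H (P (f 0)) + hnorm H (Q (f (Suc 0)))) + (hnorm H (Q (f 0)) + hnorm H (S (f (Suc 0))))"
        using f' bo by (intro add_mono hnorm_triangle) auto
      also have "\<dots> \<le> (LP * hnorm (hsum H) f + LQ * hnorm (hsum H) f) + (LQ * hnorm (hsum H) f + LS * hnorm (hsum H) f)"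
      proof -
        have "hnorm H (A x) \<le> L * hnorm (hsum H) f"
          if "hnorm H (A x) \<le> L * hnorm H x" "0 < L" "hnorm H x \<le> hnorm (hsum H) f" for A L x
          using that mult_left_mono[of "hnorm H x" "hnorm (hsum H) f" L] by linarith
        then show ?thesis
          using f' LP LQ LS hsum_hnorm_component[OF f] by (intro add_mono) blast+
      qed
      finally show "hnorm (hsum H) (block P Q S f) \<le> (LP + LQ + LQ + LS) * hnorm (hsum H) f"
        by (simp add: algebra_simps)
    next
      fix f g assume "f \<in> carrier (hsum H)" "g \<in> carrier (hsum H)"
      then show "block P Q S (f + g) = block P Q S f + block P Q S g"
        using bo by (intro ext) (simp add: block_def pair_def linear)
    next
      fix c f assume "f \<in> carrier (hsum H)"
      then show "block P Q S (scale (hsum H) c f) = scale (hsum H) c (block P Q S f)"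
        using bo by (intro ext) (simp add: block_def pair_def linear scale_right_distrib)
    qed
    fix f g assume "f \<in> carrier (hsum H)" "g \<in> carrier (hsum H)"
    then show "K.ri (block P Q S f) g = K.ri f (block P Q S g)"
      using bo by (simp add: block_def sa_ri[OF P] sa_ri[OF Q] sa_ri[OF S])
  qed
qed

section \<open>Operator monotone decreasing functions\<close>

lemma rspec_pos: "positive_definite H A \<Longrightarrow> t \<in> rspec A \<Longrightarrow> 0 < t"
  by (rule positive_definite_rspec) auto

lemma positive_definite_scalar: "0 < b \<Longrightarrow> positive_definite H (\<lambda>x. rscale b x)"
  by (rule positive_definiteI[where m = b]) (auto intro: sa_rscale sa_ident)

lemma op_fun_scalar_form:
  assumes b: "0 < b" and f: "continuous_on {0<..} f" and x: "x \<in> carrier H"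
  shows "ri (op_fun H f (\<lambda>x. rscale b x) x) x = f b * ri x x"
proof -
  let ?B = "\<lambda>x. rscale b x"
  note pd = positive_definite_scalar[OF b]
  have sub: "rspec ?B \<subseteq> {b..b}" using pd by (intro rspec_subset) auto
  have "ri (op_fun H f ?B x) x \<le> ri (op_fun H (\<lambda>t. f b) ?B x) x"
    using sub by (intro op_fun_form_mono[OF pd f _ _ x] continuous_on_const) auto
  moreover have "ri (op_fun H (\<lambda>t. f b) ?B x) x \<le> ri (op_fun H f ?B x) x"
    using sub by (intro op_fun_form_mono[OF pd _ f _ x] continuous_on_const) auto
  ultimately show ?thesis using x by (simp add: op_fun_const[OF pd])
qed

text \<open>
  This says that \<open>g\<close> of the arithmetic mean is below the harmonic mean of \<open>g(C)\<close> and \<open>g(D)\<close>, the latter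
  in its variational form: the form of the harmonic mean at \<open>z\<close> is the infimum of the right-hand side
  over all decompositions \<open>z = (1 - \<alpha>) u + \<alpha> v\<close>.

  The reason is the rotation argument of Hansen and Pedersen. Rotate \<open>C \<oplus> D\<close> by the angle with cosine
  \<open>c = \<surd>(1 - \<alpha>)\<close> and sine \<open>s = \<surd>\<alpha>\<close>. The result \<open>W\<close> has the arithmetic mean as its first diagonal entry,
  so \<open>W \<le> T \<oplus> l\<close> for a large number \<open>l\<close>; the factor \<open>N > 1\<close> leaves room for the off-diagonal entries.
  Therefore \<open>g(T) \<oplus> g(l) \<le> g(W)\<close>, and \<open>g(W)\<close> is the rotation of \<open>g(C) \<oplus> g(D)\<close>. Comparing the forms at
  the vector that is rotated to \<open>(c u, s v)\<close>, whose first entry is \<open>z\<close>, and dropping \<open>g(l) \<ge> 0\<close> gives the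
  claim.
\<close>

lemma operator_monotone_decreasing_parallel_sum:
  assumes mono: "operator_monotone_decreasing TYPE(nat \<Rightarrow> 'v) g"
    and g0: "\<And>t. 0 < t \<Longrightarrow> 0 \<le> g t"
    and C: "positive_definite H C" and D: "positive_definite H D" and T: "positive_definite H T"
    and \<alpha>: "0 \<le> \<alpha>" "\<alpha> \<le> 1" and N: "1 < N"
    and le: "\<And>x. x \<in> carrier H \<Longrightarrow> N * ((1 - \<alpha>) * ri (C x) x + \<alpha> * ri (D x) x) \<le> ri (T x) x"
    and u: "u \<in> carrier H" and v: "v \<in> carrier H" and z: "z = rscale (1 - \<alpha>) u + rscale \<alpha> v"
  shows "ri (op_fun H g T z) z \<le> (1 - \<alpha>) * ri (op_fun H g C u) u + \<alpha> * ri (op_fun H g D v) v"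
proof -
  interpret K: hilbert_space "hsum H" by (rule hilbert_space_hsum)
  have g: "continuous_on {0<..} g" using mono by (simp add: operator_monotone_decreasing_def)
  have saC: "self_adjoint H C" and saD: "self_adjoint H D" and saT: "self_adjoint H T"
    using C D T by auto
  have boC: "bounded_operator H C" and boD: "bounded_operator H D" and boT: "bounded_operator H T"
    using C D T by auto
  note linear = bo_add[OF boC] bo_add[OF boD] bo_diff[OF boC] bo_diff[OF boD] bo_scale[OF boC] bo_scale[OF boD]
  define c s where "c = sqrt (1 - \<alpha>)" and "s = sqrt \<alpha>"
  have cc: "c * c = 1 - \<alpha>" and ss: "s * s = \<alpha>" using \<alpha> by (auto simp: c_def s_def)
  then have cs: "c * c + s * s = 1" by simp
  \<comment> \<open>The two components of the rotation, which intertwine \<open>W\<close> with \<open>C\<close> and with \<open>D\<close>\<close>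
  define \<Phi> \<Psi> :: "(nat \<Rightarrow> 'v) \<Rightarrow> 'v"
    where "\<Phi> f = rscale c (f 0) - rscale s (f (Suc 0))" and "\<Psi> f = rscale s (f 0) + rscale c (f (Suc 0))" for f
  have \<Phi>in: "\<Phi> f \<in> carrier H" and \<Psi>in: "\<Psi> f \<in> carrier H" if "f \<in> carrier (hsum H)" for f
    using that by (auto simp: \<Phi>_def \<Psi>_def)
  have unitary: "ri (\<Phi> f) (\<Phi> h) + ri (\<Psi> f) (\<Psi> h) = K.ri f h"
    if "f \<in> carrier (hsum H)" "h \<in> carrier (hsum H)" for f h
  proof -
    define a b d e where "a = ri (f 0) (h 0)" "b = ri (f 0) (h (Suc 0))"
      "d = ri (f (Suc 0)) (h 0)" "e = ri (f (Suc 0)) (h (Suc 0))"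
    have "ri (\<Phi> f) (\<Phi> h) + ri (\<Psi> f) (\<Psi> h) =
      c * (c * a) - s * (c * d) - (c * (s * b) - s * (s * e)) + (s * (s * a) + c * (s * d) + (s * (c * b) + c * (c * e)))"
      using that by (simp add: \<Phi>_def \<Psi>_def a_b_d_e_def right_diff_distrib distrib_left)
    also have "\<dots> = (c * c + s * s) * (a + e)" by algebra
    finally show ?thesis by (simp add: cs a_b_d_e_def)
  qed
  define W where "W = block (\<lambda>x. rscale (c * c) (C x) + rscale (s * s) (D x))
    (\<lambda>x. rscale (c * s) (D x - C x)) (\<lambda>x. rscale (s * s) (C x) + rscale (c * c) (D x))"
  have saW: "self_adjoint (hsum H) W"
    unfolding W_def by (intro sa_block sa_add sa_rscale sa_diff saC saD)
  then have boW: "bounded_operator (hsum H) W" by simp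
  have \<Phi>W: "\<Phi> (W f) = C (\<Phi> f)" and \<Psi>W: "\<Psi> (W f) = D (\<Psi> f)" if "f \<in> carrier (hsum H)" for f
  proof -
    have f: "f 0 \<in> carrier H" "f (Suc 0) \<in> carrier H" using that by auto
    have Wf: "W f \<in> carrier (hsum H)" using boW that by (rule K.bo_in)
    have "ri (\<Phi> (W f)) y = ri (C (\<Phi> f)) y" "ri (\<Psi> (W f)) y = ri (D (\<Psi> f)) y" if y: "y \<in> carrier H" for y
    proof -
      define a b d e where "a = ri (C (f 0)) y" "b = ri (C (f (Suc 0))) y"
        "d = ri (D (f 0)) y" "e = ri (D (f (Suc 0))) y"
      have "ri (\<Phi> (W f)) y = c * (c * c * a + s * s * d + c * s * (e - b)) - s * (c * s * (d - a) + (s * s * b + c * c * e))"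
        using f y boC boD by (simp add: \<Phi>_def W_def block_def a_b_d_e_def flip: of_real_mult)
      also have "\<dots> = (c * c + s * s) * (c * a - s * b)" by algebra
      finally show "ri (\<Phi> (W f)) y = ri (C (\<Phi> f)) y"
        using f y boC boD by (simp add: cs \<Phi>_def a_b_d_e_def linear)
      have "ri (\<Psi> (W f)) y = s * (c * c * a + s * s * d + c * s * (e - b)) + c * (c * s * (d - a) + (s * s * b + c * c * e))"
        using f y boC boD by (simp add: \<Psi>_def W_def block_def a_b_d_e_def flip: of_real_mult)
      also have "\<dots> = (c * c + s * s) * (s * d + c * e)" by algebra
      finally show "ri (\<Psi> (W f)) y = ri (D (\<Psi> f)) y"
        using f y boC boD by (simp add: cs \<Psi>_def a_b_d_e_def linear)
    qed
    then show "\<Phi> (W f) = C (\<Phi> f)" "\<Psi> (W f) = D (\<Psi> f)"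
      using that \<Phi>in \<Psi>in Wf boC boD by (auto intro!: ri_eqI)
  qed
  have formW: "K.ri (W f) f = ri (C (\<Phi> f)) (\<Phi> f) + ri (D (\<Psi> f)) (\<Psi> f)" if "f \<in> carrier (hsum H)" for f
    using unitary[of "W f" f] that K.bo_in[OF boW that] by (simp only: \<Phi>W \<Psi>W)
  obtain mC where mC: "0 < mC" "\<And>x. x \<in> carrier H \<Longrightarrow> mC * ri x x \<le> ri (C x) x"
    by (rule positive_definite_coercive[OF C]) (rule that; assumption)
  obtain mD where mD: "0 < mD" "\<And>x. x \<in> carrier H \<Longrightarrow> mD * ri x x \<le> ri (D x) x"
    by (rule positive_definite_coercive[OF D]) (rule that; assumption)
  obtain mT where mT: "0 < mT" "\<And>x. x \<in> carrier H \<Longrightarrow> mT * ri x x \<le> ri (T x) x"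
    by (rule positive_definite_coercive[OF T]) (rule that; assumption)
  obtain kC where kC: "0 < kC" "\<And>x. x \<in> carrier H \<Longrightarrow> \<bar>ri (C x) x\<bar> \<le> kC * ri x x"
    by (rule sa_form_bounds[OF saC]) (rule that; assumption)
  obtain kD where kD: "0 < kD" "\<And>x. x \<in> carrier H \<Longrightarrow> \<bar>ri (D x) x\<bar> \<le> kD * ri x x"
    by (rule sa_form_bounds[OF saD]) (rule that; assumption)
  have weaken: "a * ri x x \<le> r" if "b * ri x x \<le> r" "a \<le> b" "x \<in> carrier H" for a b r x
    using that mult_right_mono[of a b "ri x x"] by (meson order_trans ri_self_nonneg)
  have W: "positive_definite (hsum H) W"
  proof (rule K.positive_definiteI[OF saW])
    show "0 < min mC mD" using mC mD by simp
    fix f assume f: "f \<in> carrier (hsum H)"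
    have "min mC mD * ri (\<Phi> f) (\<Phi> f) \<le> ri (C (\<Phi> f)) (\<Phi> f)" "min mC mD * ri (\<Psi> f) (\<Psi> f) \<le> ri (D (\<Psi> f)) (\<Psi> f)"
      using mC(2)[OF \<Phi>in[OF f]] mD(2)[OF \<Psi>in[OF f]] \<Phi>in[OF f] \<Psi>in[OF f] by (auto intro: weaken)
    then show "min mC mD * K.ri f f \<le> K.ri (W f) f"
      unfolding formW[OF f] unitary[OF f f, symmetric] by (simp add: distrib_left)
  qed
  define \<eta> where "\<eta> = N - 1"
  have \<eta>: "0 < \<eta>" "N = 1 + \<eta>" using N by (auto simp: \<eta>_def)
  define l where "l = (1 + 1 / \<eta>) * (kC + kD)"
  have l: "0 < l" using \<eta> kC kD by (simp add: l_def add_pos_pos)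
  define E where "E = block T (\<lambda>x. 0) (\<lambda>x. rscale l x)"
  have saE: "self_adjoint (hsum H) E"
    unfolding E_def by (intro sa_block saT sa_zero sa_rscale sa_ident)
  then have boE: "bounded_operator (hsum H) E" by simp
  have E: "positive_definite (hsum H) E"
  proof (rule K.positive_definiteI[OF saE])
    show "0 < min mT l" using mT l by simp
    fix f assume f: "f \<in> carrier (hsum H)"
    then have "min mT l * ri (f 0) (f 0) \<le> ri (T (f 0)) (f 0)"
      "min mT l * ri (f (Suc 0)) (f (Suc 0)) \<le> l * ri (f (Suc 0)) (f (Suc 0))"
      using mT(2)[of "f 0"] by (auto intro: weaken)
    then show "min mT l * K.ri f f \<le> K.ri (E f) f"
      using f by (simp add: E_def block_def distrib_left)
  qed
  \<comment> \<open>
    The form of a positive operator satisfies \<open>q(x + y) \<le> (1 + \<eta>) q(x) + (1 + 1 / \<eta>) q(y)\<close>, so the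
    off-diagonal entries of \<open>W\<close> are dominated by a small multiple of its first diagonal entry and a
    large multiple of the identity in the second one.
  \<close>
  have split: "ri (A (x + y)) (x + y) \<le> N * ri (A x) x + (1 + 1 / \<eta>) * ri (A y) y"
    if A: "self_adjoint H A" "\<And>x. x \<in> carrier H \<Longrightarrow> 0 \<le> ri (A x) x" and xy: "x \<in> carrier H" "y \<in> carrier H" for A x y
  proof -
    have boA: "bounded_operator H A" using A by simp
    have sym: "ri (A y) x = ri (A x) y" using sa_ri[OF A(1) xy(2,1)] ri_commute[of y "A x"] xy boA by simp
    have "0 \<le> ri (A (rscale \<eta> x - y)) (rscale \<eta> x - y)" using A(2) xy by simp
    also have "\<dots> = \<eta> * (\<eta> * ri (A x) x + ri (A y) y / \<eta> - 2 * ri (A x) y)"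
      using xy boA \<eta>(1) sym by (simp add: bo_diff[OF boA] bo_scale[OF boA] field_simps)
    finally have "0 \<le> \<eta> * ri (A x) x + ri (A y) y / \<eta> - 2 * ri (A x) y"
      using \<eta>(1) by (simp only: zero_le_mult_iff) auto
    then show ?thesis
      using xy boA sym by (simp add: bo_add[OF boA] \<eta>(2) algebra_simps)
  qed
  have posC: "0 \<le> ri (C x) x" and posD: "0 \<le> ri (D x) x" if "x \<in> carrier H" for x
    using C D that by (auto simp: positive_definite_def positive_def)
  have WE: "op_le (hsum H) W E"
  proof (rule K.op_leI[OF saW saE])
    fix f assume "f \<in> carrier (hsum H)"
    then have f: "f \<in> carrier (hsum H)" and f0: "f 0 \<in> carrier H" and f1: "f (Suc 0) \<in> carrier H" by auto
    define x y where "x = f 0" and "y = f (Suc 0)"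
    have xy: "x \<in> carrier H" "y \<in> carrier H" using f0 f1 by (auto simp: x_def y_def)
    have "ri (C (\<Phi> f)) (\<Phi> f) \<le> N * ((1 - \<alpha>) * ri (C x) x) + (1 + 1 / \<eta>) * (\<alpha> * ri (C y) y)"
    proof -
      have "\<Phi> f = rscale c x + rscale (- s) y" by (simp add: \<Phi>_def x_def y_def)
      then have "ri (C (\<Phi> f)) (\<Phi> f) \<le> N * ri (C (rscale c x)) (rscale c x) + (1 + 1 / \<eta>) * ri (C (rscale (- s) y)) (rscale (- s) y)"
        using split[OF saC posC scale_in[OF xy(1), of "of_real c"] scale_in[OF xy(2), of "of_real (- s)"]]
        by (simp only:)
      also have "ri (C (rscale c x)) (rscale c x) = (1 - \<alpha>) * ri (C x) x"
        using xy boC by (simp add: linear flip: cc)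
      also have "ri (C (rscale (- s) y)) (rscale (- s) y) = \<alpha> * ri (C y) y"
        using xy boC by (simp add: linear del: of_real_minus flip: ss)
      finally show ?thesis .
    qed
    moreover have "ri (D (\<Psi> f)) (\<Psi> f) \<le> N * (\<alpha> * ri (D x) x) + (1 + 1 / \<eta>) * ((1 - \<alpha>) * ri (D y) y)"
    proof -
      have "ri (D (\<Psi> f)) (\<Psi> f) \<le> N * ri (D (rscale s x)) (rscale s x) + (1 + 1 / \<eta>) * ri (D (rscale c y)) (rscale c y)"
        using split[OF saD posD, of "rscale s x" "rscale c y"] xy by (simp add: \<Psi>_def x_def y_def)
      also have "ri (D (rscale s x)) (rscale s x) = \<alpha> * ri (D x) x"
        using xy boD by (simp add: linear flip: ss)
      also have "ri (D (rscale c y)) (rscale c y) = (1 - \<alpha>) * ri (D y) y"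
        using xy boD by (simp add: linear flip: cc)
      finally show ?thesis .
    qed
    moreover have "(1 + 1 / \<eta>) * (\<alpha> * ri (C y) y) + (1 + 1 / \<eta>) * ((1 - \<alpha>) * ri (D y) y) \<le> l * ri y y"
    proof -
      have "\<alpha> * ri (C y) y \<le> kC * ri y y" "(1 - \<alpha>) * ri (D y) y \<le> kD * ri y y"
        using kC(2)[OF xy(2)] kD(2)[OF xy(2)] posC[OF xy(2)] posD[OF xy(2)] \<alpha>
          mult_right_mono[of \<alpha> 1 "ri (C y) y"] mult_right_mono[of "1 - \<alpha>" 1 "ri (D y) y"] by auto
      then have "\<alpha> * ri (C y) y + (1 - \<alpha>) * ri (D y) y \<le> (kC + kD) * ri y y" by (simp add: distrib_right)
      then have "(1 + 1 / \<eta>) * (\<alpha> * ri (C y) y + (1 - \<alpha>) * ri (D y) y) \<le> (1 + 1 / \<eta>) * ((kC + kD) * ri y y)"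
        using \<eta> by (intro mult_left_mono) auto
      then show ?thesis by (simp only: l_def distrib_left[symmetric] mult.assoc)
    qed
    ultimately have "K.ri (W f) f \<le> N * ((1 - \<alpha>) * ri (C x) x + \<alpha> * ri (D x) x) + l * ri y y"
      unfolding formW[OF f] by (simp add: distrib_left)
    also have "\<dots> \<le> ri (T x) x + l * ri y y" using le[OF xy(1)] by simp
    also have "\<dots> = K.ri (E f) f" using xy boT by (simp add: E_def block_def x_def y_def)
    finally show "K.ri (W f) f \<le> K.ri (E f) f" .
  qed
  have le_g: "op_le (hsum H) (op_fun (hsum H) g E) (op_fun (hsum H) g W)"
    using mono hilbert_space_hsum W E WE by (auto simp: operator_monotone_decreasing_def)
  define f where "f = pair z (rscale (c * s) (v - u))"
  have zin: "z \<in> carrier H" using u v by (simp add: z)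
  have f: "f \<in> carrier (hsum H)" using u v zin by (simp add: f_def)
  have \<Phi>f: "\<Phi> f = rscale c u" and \<Psi>f: "\<Psi> f = rscale s v"
  proof -
    have "ri (\<Phi> f) y = ri (rscale c u) y" "ri (\<Psi> f) y = ri (rscale s v) y" if y: "y \<in> carrier H" for y
    proof -
      have "ri (\<Phi> f) y = c * ((1 - \<alpha>) * ri u y + \<alpha> * ri v y) - s * (c * s * (ri v y - ri u y))"
        using u v y by (simp add: \<Phi>_def f_def z flip: of_real_mult of_real_diff)
      also have "\<dots> = c * (c * c * ri u y + s * s * ri v y) - s * (c * s * (ri v y - ri u y))"
        by (simp only: cc ss)
      also have "\<dots> = (c * c + s * s) * c * ri u y" by algebra
      finally show "ri (\<Phi> f) y = ri (rscale c u) y" using u y by (simp add: cs)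
      have "ri (\<Psi> f) y = s * ((1 - \<alpha>) * ri u y + \<alpha> * ri v y) + c * (c * s * (ri v y - ri u y))"
        using u v y by (simp add: \<Psi>_def f_def z flip: of_real_mult of_real_diff)
      also have "\<dots> = s * (c * c * ri u y + s * s * ri v y) + c * (c * s * (ri v y - ri u y))"
        by (simp only: cc ss)
      also have "\<dots> = (c * c + s * s) * s * ri v y" by algebra
      finally show "ri (\<Psi> f) y = ri (rscale s v) y" using v y by (simp add: cs)
    qed
    then show "\<Phi> f = rscale c u" "\<Psi> f = rscale s v"
      using \<Phi>in[OF f] \<Psi>in[OF f] u v by (auto intro!: ri_eqI)
  qed
  have transport: "F (op_fun (hsum H) g A f) = op_fun H g B (F f)"
    if A: "positive_definite (hsum H) A" and B: "positive_definite H B"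
      and F: "F = (\<lambda>f. rscale a (f 0) + rscale b (f (Suc 0)))"
      and FA: "\<And>h. h \<in> carrier (hsum H) \<Longrightarrow> F (A h) = B (F h)" for A B F a b
  proof -
    have "F (op_fun (hsum H) g A f) = op_fun H (\<lambda>t. g (1 * t)) B (F f)"
    proof (rule op_fun_intertwine[OF hilbert_space_hsum hilbert_space_axioms A B g])
      fix h assume h: "h \<in> carrier (hsum H)"
      then have h': "h 0 \<in> carrier H" "h (Suc 0) \<in> carrier H" by auto
      show Fin: "F h \<in> carrier H" using h' by (simp add: F)
      show "F (A h) = rscale 1 (B (F h))" using FA[OF h] by simp
      show "F (scale (hsum H) (of_real r) h) = rscale r (F h)" for r
        by (simp add: F scale_right_distrib mult.commute)
      have "hnorm H (F h) \<le> \<bar>a\<bar> * hnorm H (h 0) + \<bar>b\<bar> * hnorm H (h (Suc 0))"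
        using hnorm_triangle[of "rscale a (h 0)" "rscale b (h (Suc 0))"] h' by (simp add: F hnorm_scale)
      also have "\<dots> \<le> \<bar>a\<bar> * hnorm (hsum H) h + \<bar>b\<bar> * hnorm (hsum H) h"
        using hsum_hnorm_component[OF h] by (intro add_mono mult_left_mono) auto
      finally show "hnorm H (F h) \<le> (\<bar>a\<bar> + \<bar>b\<bar>) * hnorm (hsum H) h" by (simp add: distrib_right)
    qed (use f in \<open>auto simp: F scale_right_distrib\<close>)
    then show ?thesis by simp
  qed
  have gWf: "op_fun (hsum H) g W f \<in> carrier (hsum H)" by (rule K.op_fun_in[OF W g f])
  have gEf: "op_fun (hsum H) g E f \<in> carrier (hsum H)" by (rule K.op_fun_in[OF E g f])
  have "\<Phi> (op_fun (hsum H) g W f) = op_fun H g C (\<Phi> f)"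
    by (rule transport[OF W C, where a = c and b = "- s"]) (auto simp: \<Phi>_def[abs_def] \<Phi>W[unfolded \<Phi>_def])
  moreover have "\<Psi> (op_fun (hsum H) g W f) = op_fun H g D (\<Psi> f)"
    by (rule transport[OF W D, where a = s and b = c]) (auto simp: \<Psi>_def[abs_def] \<Psi>W[unfolded \<Psi>_def])
  ultimately have "K.ri (op_fun (hsum H) g W f) f = c * c * ri (op_fun H g C u) u + s * s * ri (op_fun H g D v) v"
    using unitary[OF gWf f] u v C D g
    by (simp add: \<Phi>f \<Psi>f bo_scale[OF op_fun_bounded[OF C g]] bo_scale[OF op_fun_bounded[OF D g]] mult.assoc)
  then have gW: "K.ri (op_fun (hsum H) g W f) f = (1 - \<alpha>) * ri (op_fun H g C u) u + \<alpha> * ri (op_fun H g D v) v"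
    by (simp only: cc ss)
  have "op_fun (hsum H) g E f 0 = op_fun H g T (f 0)"
    using transport[OF E T, of "\<lambda>f. f 0" 1 0] by (simp add: E_def block_def)
  moreover have "op_fun (hsum H) g E f (Suc 0) = op_fun H g (\<lambda>x. rscale l x) (f (Suc 0))"
    using transport[OF E positive_definite_scalar[OF l], of "\<lambda>f. f (Suc 0)" 0 1] by (simp add: E_def block_def)
  moreover have "0 \<le> ri (op_fun H g (\<lambda>x. rscale l x) (f (Suc 0))) (f (Suc 0))"
    using f g0[OF l] by (simp add: op_fun_scalar_form[OF l g])
  ultimately have gE: "ri (op_fun H g T z) z \<le> K.ri (op_fun (hsum H) g E f) f"
    by (simp add: f_def)
  show ?thesis
    using gE K.op_leD[OF le_g f] gW by linarith
qed

end

section \<open>Scalar inequalities\<close>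

lemma Young_powr:
  fixes a b :: real
  assumes "0 < \<alpha>" "\<alpha> < 1" "0 < a" "0 < b"
  shows "a powr (1 - \<alpha>) * b powr \<alpha> \<le> (1 - \<alpha>) * a + \<alpha> * b"
  using Youngs_inequality_0[of "1 - \<alpha>" \<alpha> a b] assms by simp

lemma harmonic_le_powr:
  fixes t :: real
  assumes \<alpha>: "0 < \<alpha>" "\<alpha> < 1" and t: "0 < t"
  shows "t * (1 / ((1 - \<alpha>) * t + \<alpha>)) \<le> t powr \<alpha>"
proof -
  have "t powr (1 - \<alpha>) \<le> (1 - \<alpha>) * t + \<alpha>"
    using Young_powr[OF \<alpha> t zero_less_one] by simp
  then have "t powr \<alpha> * t powr (1 - \<alpha>) \<le> t powr \<alpha> * ((1 - \<alpha>) * t + \<alpha>)"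
    by (intro mult_left_mono) auto
  moreover have "t powr \<alpha> * t powr (1 - \<alpha>) = t"
    using t by (simp flip: powr_add)
  moreover have "0 < (1 - \<alpha>) * t + \<alpha>" using \<alpha> t by (simp add: add_pos_pos)
  ultimately show ?thesis by (simp add: pos_divide_le_eq)
qed

text \<open>
  The correction term is \<open>\<alpha> (1 - \<alpha>) (1 - r)\<^sup>2 / (2 r)\<close>. Both sides agree at \<open>r = 1\<close>, and their difference is
  decreasing.
\<close>

lemma reverse_Young_aux:
  fixes r :: real
  assumes \<alpha>: "0 < \<alpha>" "\<alpha> < 1" and r: "0 < r" "r \<le> 1"
  shows "(1 - \<alpha>) + \<alpha> * r \<le> r powr \<alpha> + \<alpha> * (1 - \<alpha>) * (r + 1 / r - 2) / 2"
proof -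
  define F where "F x = x powr \<alpha> + \<alpha> * (1 - \<alpha>) * (x + 1 / x - 2) / 2 - (1 - \<alpha>) - \<alpha> * x" for x :: real
  have "F 1 \<le> F r"
  proof (rule DERIV_nonpos_imp_nonincreasing[OF r(2)])
    fix x assume x: "r \<le> x" "x \<le> 1"
    then have x0: "0 < x" using r by simp
    define D where "D = \<alpha> * x powr (\<alpha> - 1) + \<alpha> * (1 - \<alpha>) * (1 - 1 / x\<^sup>2) / 2 - \<alpha>"
    have "(F has_real_derivative D) (at x)"
      unfolding F_def D_def using x0
      by (auto intro!: derivative_eq_intros simp: power2_eq_square field_simps)
    moreover have "D \<le> 0"
    proof -
      \<comment> \<open>Bernoulli: \<open>y\<^sup>\<theta> \<le> 1 + \<theta> (y - 1)\<close> for \<open>y = 1 / x\<^sup>2\<close> and \<open>\<theta> = (1 - \<alpha>) / 2\<close>\<close>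
      have bernoulli: "(1 / x\<^sup>2) powr ((1 - \<alpha>) / 2) \<le> (1 - (1 - \<alpha>) / 2) + (1 - \<alpha>) / 2 * (1 / x\<^sup>2)"
        using Young_powr[of "(1 - \<alpha>) / 2" 1 "1 / x\<^sup>2"] \<alpha> x0 by simp
      have power: "(1 / x\<^sup>2) powr ((1 - \<alpha>) / 2) = x powr (\<alpha> - 1)"
      proof -
        have "1 / x\<^sup>2 = x powr (- 2)" using x0 by (simp add: powr_minus powr_numeral divide_simps)
        moreover have "- 2 * ((1 - \<alpha>) / 2) = \<alpha> - 1" by simp
        ultimately show ?thesis by (simp only: powr_powr)
      qed
      have "a + (1 - \<alpha>) * (1 - y) / 2 - 1 \<le> 0" if "a \<le> (1 - (1 - \<alpha>) / 2) + (1 - \<alpha>) / 2 * y" for a y :: real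
        using that by (simp add: field_simps)
      from this[OF bernoulli[unfolded power]]
      have "x powr (\<alpha> - 1) + (1 - \<alpha>) * (1 - 1 / x\<^sup>2) / 2 - 1 \<le> 0" .
      then have "\<alpha> * (x powr (\<alpha> - 1) + (1 - \<alpha>) * (1 - 1 / x\<^sup>2) / 2 - 1) \<le> 0"
        using \<alpha> by (simp add: mult_le_0_iff)
      then show ?thesis by (simp add: D_def algebra_simps)
    qed
    ultimately show "\<exists>y. (F has_real_derivative y) (at x) \<and> y \<le> 0" by blast
  qed
  then show ?thesis by (simp add: F_def)
qed

text \<open>
  Since \<open>M_const \<alpha> s\<close> is decreasing in \<open>s \<le> 1\<close>, the case \<open>s = r\<close> is the decisive one, and there the claim
  is the preceding inequality.
\<close>

lemma reverse_Young:
  fixes r s :: real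
  assumes \<alpha>: "0 < \<alpha>" "\<alpha> < 1" and s: "0 < s" "s \<le> r" "r \<le> 1"
  shows "(1 - \<alpha>) + \<alpha> * r \<le> M_const \<alpha> s * r powr \<alpha>"
proof -
  have r: "0 < r" using s by simp
  have rp: "r powr (\<alpha> + 1) = r powr \<alpha> * r" using r by (simp add: powr_add)
  have "(r + 1 / r - 2) = (r - 1)\<^sup>2 / r powr (\<alpha> + 1) * r powr \<alpha>"
    unfolding rp using r by (simp add: field_simps power2_eq_square)
  also have "\<dots> \<le> (s - 1)\<^sup>2 / s powr (\<alpha> + 1) * r powr \<alpha>"
  proof (intro mult_right_mono frac_le)
    have "(1 - r)\<^sup>2 \<le> (1 - s)\<^sup>2" using s by (intro power_mono) auto
    then show "(r - 1)\<^sup>2 \<le> (s - 1)\<^sup>2" by (simp only: power2_commute)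
    show "s powr (\<alpha> + 1) \<le> r powr (\<alpha> + 1)" using s \<alpha> by (intro powr_mono2) auto
  qed (use s in auto)
  finally have "\<alpha> * (1 - \<alpha>) / 2 * (r + 1 / r - 2) \<le> \<alpha> * (1 - \<alpha>) / 2 * ((s - 1)\<^sup>2 / s powr (\<alpha> + 1) * r powr \<alpha>)"
    using \<alpha> by (intro mult_left_mono) auto
  moreover have "M_const \<alpha> s * r powr \<alpha> =
      r powr \<alpha> + \<alpha> * (1 - \<alpha>) / 2 * ((s - 1)\<^sup>2 / s powr (\<alpha> + 1) * r powr \<alpha>)"
    by (simp add: M_const_def distrib_right)
  moreover have "\<alpha> * (1 - \<alpha>) * (r + 1 / r - 2) / 2 = \<alpha> * (1 - \<alpha>) / 2 * (r + 1 / r - 2)"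
    by (simp only: times_divide_eq_left)
  ultimately show ?thesis
    using reverse_Young_aux[OF \<alpha> r s(3)] by linarith
qed

lemma M_const_ge_1:
  assumes "0 < \<alpha>" "\<alpha> < 1" shows "1 \<le> M_const \<alpha> s"
  using assms by (simp add: M_const_def)

context hilbert_space
begin

section \<open>Growth of operator monotone decreasing functions\<close>

lemma op_fun_op_scale:
  assumes X: "positive_definite H X" and g: "continuous_on {0<..} g" and c: "0 < c" and z: "z \<in> carrier H"
  shows "positive_definite H (op_scale H c X)" "op_fun H g (op_scale H c X) z = op_fun H (\<lambda>t. g (c * t)) X z"
proof -
  have saX: "self_adjoint H X" using X by simp
  obtain m where m: "0 < m" "\<And>x. x \<in> carrier H \<Longrightarrow> m * ri x x \<le> ri (X x) x"
    by (rule positive_definite_coercive[OF X]) (rule that; assumption)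
  show pd: "positive_definite H (op_scale H c X)"
    unfolding op_scale_def
    by (rule positive_definiteI[where m = "c * m"]) (use saX c m in \<open>auto simp: mult.assoc intro: sa_rscale\<close>)
  show "op_fun H g (op_scale H c X) z = op_fun H (\<lambda>t. g (c * t)) X z"
    by (rule op_fun_intertwine[OF hilbert_space_axioms hilbert_space_axioms pd X g c, where \<Phi> = "\<lambda>x. x" and L = 1])
      (use z in \<open>auto simp: op_scale_def\<close>)
qed

text \<open>
  The first part says that \<open>t g(t)\<close> is nondecreasing. The harmonic mean inequality for numbers \<open>a\<close> and \<open>b\<close>
  contains it: the harmonic mean of \<open>g(a)\<close> and \<open>g(b)\<close> with weights \<open>1 - \<alpha>\<close> and \<open>\<alpha>\<close> is at most \<open>g(b) / \<alpha>\<close>,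
  and \<open>a\<close> may tend to \<open>0\<close>, so that \<open>\<alpha> g(\<alpha> b) \<le> g(b)\<close>. The second part is the inequality for \<open>a = b\<close>.
\<close>

lemma operator_monotone_decreasing_scaling:
  assumes mono: "operator_monotone_decreasing TYPE(nat \<Rightarrow> 'v) g"
    and g0: "\<And>t. 0 < t \<Longrightarrow> 0 \<le> g t" and nz: "carrier H \<noteq> {0}" and t: "0 < t"
  shows "1 < N \<Longrightarrow> g t \<le> N * g (N * t)" "1 < N \<Longrightarrow> g (N * t) \<le> g t"
proof -
  have g: "continuous_on {0<..} g" using mono by (simp add: operator_monotone_decreasing_def)
  obtain x where x: "x \<in> carrier H" "x \<noteq> 0" using nz zero_in by blast
  have px: "0 < ri x x" using ip_pos x by blast
  have scalar: "g (N * ((1 - \<alpha>) * a + \<alpha> * b)) * ri z z \<le> (1 - \<alpha>) * (g a * ri u u) + \<alpha> * (g b * ri v v)"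
    if "0 < a" "0 < b" "0 < \<alpha>" "\<alpha> < 1" "1 < N" "u \<in> carrier H" "v \<in> carrier H"
      "z = rscale (1 - \<alpha>) u + rscale \<alpha> v" for a b \<alpha> N u v z
  proof -
    have ab: "0 < N * ((1 - \<alpha>) * a + \<alpha> * b)" using that by (simp add: add_pos_pos)
    have z: "z \<in> carrier H" using that by simp
    have "ri (op_fun H g (\<lambda>x. rscale (N * ((1 - \<alpha>) * a + \<alpha> * b)) x) z) z
      \<le> (1 - \<alpha>) * ri (op_fun H g (\<lambda>x. rscale a x) u) u + \<alpha> * ri (op_fun H g (\<lambda>x. rscale b x) v) v"
      by (rule operator_monotone_decreasing_parallel_sum[OF mono g0 positive_definite_scalar
            positive_definite_scalar positive_definite_scalar, where N = N and \<alpha> = \<alpha>])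
        (use that ab in \<open>auto simp: algebra_simps simp del: of_real_mult of_real_add of_real_diff\<close>)
    then show ?thesis
      by (simp only: op_fun_scalar_form[OF ab g z] op_fun_scalar_form[OF that(1) g that(6)]
          op_fun_scalar_form[OF that(2) g that(7)])
  qed
  have le: "\<alpha> * g (\<alpha> * b) \<le> g b" if \<alpha>: "0 < \<alpha>" "\<alpha> < 1" and b: "0 < b" for \<alpha> b
  proof -
    \<comment> \<open>The scalar inequality with \<open>u = 0\<close>, in the limit \<open>a \<rightarrow> 0\<close> and \<open>N \<rightarrow> 1\<close>\<close>
    have *: "\<alpha> * g (N * ((1 - \<alpha>) * a + \<alpha> * b)) \<le> g b" if "0 < a" "1 < N" for a N
    proof -
      have "g (N * ((1 - \<alpha>) * a + \<alpha> * b)) * (\<alpha> * (\<alpha> * ri x x)) \<le> \<alpha> * (g b * ri x x)"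
        using scalar[OF that(1) b \<alpha> that(2) zero_in x(1) refl] x by simp
      then have "(\<alpha> * g (N * ((1 - \<alpha>) * a + \<alpha> * b))) * (\<alpha> * ri x x) \<le> g b * (\<alpha> * ri x x)"
        by (simp add: mult_ac)
      then show ?thesis using mult_le_cancel_right_pos[of "\<alpha> * ri x x"] \<alpha> px by simp
    qed
    have "\<exists>n0. \<forall>n\<ge>n0. \<alpha> * g ((1 + 1 / real (Suc n)) * ((1 - \<alpha>) * (1 / real (Suc n)) + \<alpha> * b)) \<le> g b"
      by (intro exI allI impI *) auto
    moreover have "(\<lambda>n. \<alpha> * g ((1 + 1 / real (Suc n)) * ((1 - \<alpha>) * (1 / real (Suc n)) + \<alpha> * b))) \<longlonglongrightarrow> \<alpha> * g (\<alpha> * b)"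
    proof (intro tendsto_mult tendsto_const)
      have "isCont g (\<alpha> * b)"
        using g \<alpha> b continuous_on_interior[of "{0<..}" g "\<alpha> * b"] by (simp add: interior_open)
      moreover have "(\<lambda>n. (1 + 1 / real (Suc n)) * ((1 - \<alpha>) * (1 / real (Suc n)) + \<alpha> * b))
          \<longlonglongrightarrow> (1 + 0) * ((1 - \<alpha>) * 0 + \<alpha> * b)"
        by (intro tendsto_intros LIMSEQ_Suc[OF lim_1_over_n])
      ultimately show "(\<lambda>n. g ((1 + 1 / real (Suc n)) * ((1 - \<alpha>) * (1 / real (Suc n)) + \<alpha> * b))) \<longlonglongrightarrow> g (\<alpha> * b)"
        by (intro isCont_tendsto_compose[of _ g]) auto
    qed
    ultimately show ?thesis by (intro LIMSEQ_le_const2)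
  qed
  show "g t \<le> N * g (N * t)" if N: "1 < N"
    using le[of "1 / N" "N * t"] N t by (simp add: field_simps)
  show "g (N * t) \<le> g t" if N: "1 < N"
  proof -
    have "x = rscale (1 - 1 / 2) x + rscale (1 / 2) x"
      by (simp flip: scale_left_distrib)
    from scalar[OF t t _ _ N x(1) x(1) this]
    have "g (N * t) * ri x x \<le> g t * ri x x" by (simp add: field_simps)
    then show ?thesis using px by simp
  qed
qed

text \<open>
  A zero of \<open>g\<close> spreads to the right because \<open>g\<close> is nonincreasing, and to the left because \<open>t g(t)\<close> is
  nondecreasing. This matters because the geometric mean of \<open>g(C)\<close> and \<open>g(D)\<close> is meaningful only if they
  are positive definite or both zero.
\<close>

lemma operator_monotone_decreasing_zero_or_pos:
  assumes mono: "operator_monotone_decreasing TYPE(nat \<Rightarrow> 'v) g"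
    and g0: "\<And>t. 0 < t \<Longrightarrow> 0 \<le> g t" and nz: "carrier H \<noteq> {0}"
  shows "(\<forall>t>0. g t = 0) \<or> (\<forall>t>0. 0 < g t)"
proof (rule disjCI)
  assume "\<not> (\<forall>t>0. 0 < g t)"
  then obtain t0 where t0: "0 < t0" "g t0 = 0" using g0 by (metis less_eq_real_def)
  have "g t \<le> 0" if t: "0 < t" for t
  proof (cases t t0 rule: linorder_cases)
    case less
    then show ?thesis
      using operator_monotone_decreasing_scaling(1)[OF mono g0 nz t, of "t0 / t"] t t0 by simp
  next
    case greater
    then show ?thesis
      using operator_monotone_decreasing_scaling(2)[OF mono g0 nz t0(1), of "t / t0"] t t0 by simp
  qed (use t0 in simp)
  then show "\<forall>t>0. g t = 0" using g0 by (meson order_antisym)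
qed

text \<open>
  A constant \<open>M\<close> in an upper bound of the arithmetic mean comes out as a factor, because
  \<open>t g(t)\<close> is nondecreasing.
\<close>

lemma operator_monotone_decreasing_mean_bound:
  assumes mono: "operator_monotone_decreasing TYPE(nat \<Rightarrow> 'v) g"
    and g0: "\<And>t. 0 < t \<Longrightarrow> 0 \<le> g t" and nz: "carrier H \<noteq> {0}"
    and C: "positive_definite H C" and D: "positive_definite H D" and X: "positive_definite H X"
    and \<alpha>: "0 \<le> \<alpha>" "\<alpha> \<le> 1" and M: "1 \<le> M"
    and le: "\<And>x. x \<in> carrier H \<Longrightarrow> (1 - \<alpha>) * ri (C x) x + \<alpha> * ri (D x) x \<le> M * ri (X x) x"
    and u: "u \<in> carrier H" and v: "v \<in> carrier H" and z: "z = rscale (1 - \<alpha>) u + rscale \<alpha> v"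
  shows "ri (op_fun H g X z) z \<le> M * ((1 - \<alpha>) * ri (op_fun H g C u) u + \<alpha> * ri (op_fun H g D v) v)"
    (is "?l \<le> M * ?r")
proof (rule field_le_mult_one_interval)
  \<comment> \<open>The factor \<open>N > 1\<close> required below is \<open>1 / y\<close>, and the claim is the limit \<open>y \<rightarrow> 1\<close>.\<close>
  fix y :: real assume y: "0 < y" "y < 1"
  have g: "continuous_on {0<..} g" using mono by (simp add: operator_monotone_decreasing_def)
  have zin: "z \<in> carrier H" using u v by (simp add: z)
  define N where "N = 1 / y"
  have N: "1 < N" using y by (simp add: N_def)
  define c where "c = N * M"
  have c: "1 < c" unfolding c_def using mult_left_mono[of 1 M N] N M by linarith
  have gc: "continuous_on {0<..} (\<lambda>t. g (c * t))"
    using c by (intro continuous_on_compose2[OF g] continuous_intros) auto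
  have gc': "continuous_on {0<..} (\<lambda>t. c * g (c * t))" using gc by (intro continuous_intros)
  have "?l \<le> ri (op_fun H (\<lambda>t. c * g (c * t)) X z) z"
    using rspec_pos[OF X] operator_monotone_decreasing_scaling(1)[OF mono g0 nz _ c]
    by (intro op_fun_form_mono[OF X g gc' _ zin]) auto
  also have "\<dots> = c * ri (op_fun H g (op_scale H c X) z) z"
    using c zin X gc op_fun_op_scale(2)[OF X g _ zin, of c] by (simp add: op_fun_cmult)
  also have "\<dots> \<le> c * ?r"
  proof (intro mult_left_mono operator_monotone_decreasing_parallel_sum[OF mono g0 C D _ \<alpha> N _ u v z])
    show "positive_definite H (op_scale H c X)" using op_fun_op_scale(1)[OF X g _ zin, of c] c by simp
    fix x assume x: "x \<in> carrier H"
    have "N * ((1 - \<alpha>) * ri (C x) x + \<alpha> * ri (D x) x) \<le> N * (M * ri (X x) x)"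
      using le[OF x] N by (intro mult_left_mono) auto
    then show "N * ((1 - \<alpha>) * ri (C x) x + \<alpha> * ri (D x) x) \<le> ri (op_scale H c X x) x"
      using x X by (simp add: op_scale_def c_def mult.assoc del: of_real_mult)
  qed (use c in auto)
  finally show "y * ?l \<le> M * ?r" using y by (simp add: c_def N_def field_simps)
qed

section \<open>The geometric mean\<close>

lemma continuous_powr: "continuous_on {0<..} (\<lambda>t::real. t powr r)"
  by (intro continuous_intros) auto

lemma op_powr_positive_definite:
  "positive_definite H A \<Longrightarrow> positive_definite H (op_powr H A r)"
  unfolding op_powr_def by (intro op_fun_positive_definite continuous_powr) auto

lemma op_powr_add:
  assumes A: "positive_definite H A" and x: "x \<in> carrier H"
  shows "op_powr H A r (op_powr H A s x) = op_fun H (\<lambda>t. t powr (r + s)) A x"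
  unfolding op_powr_def
  by (simp add: powr_add op_fun_mult[OF A continuous_powr continuous_powr x])

text \<open>
  The left inverse of \<open>S\<close> bounds \<open>\<parallel>x\<parallel>\<close> by a multiple of \<open>\<parallel>S x\<parallel>\<close>, which keeps a positive lower bound positive.
\<close>

lemma positive_definite_congruence:
  assumes S: "self_adjoint H S" and S': "bounded_operator H S'" "\<And>x. x \<in> carrier H \<Longrightarrow> S' (S x) = x"
    and A: "positive_definite H A"
  shows "positive_definite H (\<lambda>x. S (A (S x)))"
proof -
  have boS: "bounded_operator H S" using S by simp
  obtain m where m: "0 < m" "\<And>x. x \<in> carrier H \<Longrightarrow> m * ri x x \<le> ri (A x) x"
    by (rule positive_definite_coercive[OF A]) (rule that; assumption)
  obtain L where L: "0 < L" "\<And>x. x \<in> carrier H \<Longrightarrow> hnorm H (S' x) \<le> L * hnorm H x"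
    by (rule bo_bound[OF S'(1)]) (rule that; assumption)
  show ?thesis
  proof (rule positive_definiteI)
    show "self_adjoint H (\<lambda>x. S (A (S x)))" by (rule sa_conj[OF S positive_definite_sa[OF A]])
    show "0 < m / L\<^sup>2" using m L by simp
    fix x assume x: "x \<in> carrier H"
    have Sx: "S x \<in> carrier H" using x boS by simp
    have "hnorm H x \<le> L * hnorm H (S x)" using L(2)[OF Sx] S'(2)[OF x] by simp
    then have "(hnorm H x)\<^sup>2 \<le> (L * hnorm H (S x))\<^sup>2" using x by (intro power_mono) auto
    then have "m * ri x x \<le> m * (L\<^sup>2 * ri (S x) (S x))"
      using m x Sx by (intro mult_left_mono) (auto simp: hnorm_sq power_mult_distrib)
    also have "\<dots> \<le> L\<^sup>2 * ri (A (S x)) (S x)"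
      using m(2)[OF Sx] L by (simp add: mult.left_commute mult_left_mono)
    also have "ri (A (S x)) (S x) = ri (S (A (S x))) x"
      using sa_ri[OF S, of "A (S x)" x] Sx x A by simp
    finally show "m / L\<^sup>2 * ri x x \<le> ri (S (A (S x))) x"
      using L by (simp add: field_simps)
  qed
qed

text \<open>
  Everything needed about \<open>P #\<^sub>\<alpha> Q = S R\<^sup>\<alpha> S\<close> with \<open>S = P\<^bsup>1/2\<^esup>\<close>, \<open>S' = P\<^bsup>-1/2\<^esup>\<close> and
  \<open>R = S' Q S'\<close>: substituting \<open>S' a\<close> turns the forms of \<open>P\<close> and \<open>Q\<close> into those of \<open>1\<close> and \<open>R\<close>.
\<close>

lemma geo_mean_representation:
  assumes nz: "carrier H \<noteq> {0}" and P: "positive_definite H P" and Q: "positive_definite H Q"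
  obtains S S' R where "bounded_operator H S" "bounded_operator H S'"
    "\<And>x. x \<in> carrier H \<Longrightarrow> S' (S x) = x"
    "positive_definite H R"
    "\<And>x. x \<in> carrier H \<Longrightarrow> ri (P (S' x)) (S' x) = ri x x"
    "\<And>x. x \<in> carrier H \<Longrightarrow> ri (Q (S' x)) (S' x) = ri (R x) x"
    "positive_definite H (geo_mean H \<alpha> P Q)"
    "\<And>x. x \<in> carrier H \<Longrightarrow> ri (geo_mean H \<alpha> P Q x) x = ri (op_fun H (\<lambda>t. t powr \<alpha>) R (S x)) (S x)"
proof -
  define S S' where "S = op_powr H P (1/2)" and "S' = op_powr H P (-1/2)"
  define R where "R = S' \<circ> Q \<circ> S'"
  have pdS: "positive_definite H S" "positive_definite H S'"
    using P by (auto simp: S_def S'_def intro: op_powr_positive_definite)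
  then have sa: "self_adjoint H S" "self_adjoint H S'" and bo: "bounded_operator H S" "bounded_operator H S'"
    by auto
  have one: "op_fun H (\<lambda>t. t powr 0) P x = x" if "x \<in> carrier H" for x
    using op_fun_cong[OF P continuous_powr, of 0 "\<lambda>t. 1" x] op_fun_const[OF P that, of 1] that by simp
  have S'S: "S' (S x) = x" if "x \<in> carrier H" for x
    using one[OF that] op_powr_add[OF P that, of "-1/2" "1/2"] by (simp add: S_def S'_def)
  have SS': "S (S' x) = x" if "x \<in> carrier H" for x
    using one[OF that] op_powr_add[OF P that, of "1/2" "-1/2"] by (simp add: S_def S'_def)
  have SS: "S (S x) = P x" if "x \<in> carrier H" for x
    using op_fun_cong[OF P continuous_powr, of 1 "\<lambda>t. t" x] op_fun_ident[OF P that]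
      op_powr_add[OF P that, of "1/2" "1/2"] that by (simp add: S_def)
  have R: "positive_definite H R"
    using positive_definite_congruence[OF sa(2) bo(1) SS' Q] by (simp add: R_def comp_def)
  have nzPQ: "\<not> (\<forall>x\<in>carrier H. P x = 0 \<and> Q x = 0)"
  proof
    assume "\<forall>x\<in>carrier H. P x = 0 \<and> Q x = 0"
    then have "x = 0" if "x \<in> carrier H" for x
      using that SS[OF that] SS'[of "S x"] S'S[of "S x"] S'S[OF that] bo bo_zero[OF bo(2)] by (metis bo_in)
    then show False using nz zero_in by blast
  qed
  have geo: "geo_mean H \<alpha> P Q x = S (op_fun H (\<lambda>t. t powr \<alpha>) R (S x))" for x
    by (simp only: geo_mean_def if_not_P[OF nzPQ] S_def S'_def R_def op_powr_def comp_apply)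
  show ?thesis
  proof (rule that[of S S' R])
    fix x assume x: "x \<in> carrier H"
    have S'x: "S' x \<in> carrier H" using x bo by simp
    show "ri (P (S' x)) (S' x) = ri x x"
      using sa_ri[OF sa(1), of "S (S' x)" "S' x"] x S'x bo by (simp add: SS' flip: SS)
    show "ri (Q (S' x)) (S' x) = ri (R x) x"
      using sa_ri[OF sa(2), of "Q (S' x)" x] x S'x Q by (simp add: R_def)
    show "ri (geo_mean H \<alpha> P Q x) x = ri (op_fun H (\<lambda>t. t powr \<alpha>) R (S x)) (S x)"
      unfolding geo using sa_ri[OF sa(1), of "op_fun H (\<lambda>t. t powr \<alpha>) R (S x)" x] x bo R continuous_powr
      by simp
  next
    have "positive_definite H (op_fun H (\<lambda>t. t powr \<alpha>) R)"
      using op_powr_positive_definite[OF R] by (simp add: op_powr_def)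
    from positive_definite_congruence[OF sa(1) bo(2) S'S this]
    show "positive_definite H (geo_mean H \<alpha> P Q)" by (simp add: geo[abs_def])
  qed (use bo S'S R in auto)
qed

text \<open>
  After the substitution \<open>x = C\<^bsup>-1/2\<^esup> w\<close> this is the reverse Young inequality for
  \<open>R = C\<^bsup>-1/2\<^esup> D C\<^bsup>-1/2\<^esup>\<close>, whose spectrum lies in \<open>[s, 1]\<close>.
\<close>

lemma arithmetic_le_geo_mean:
  assumes nz: "carrier H \<noteq> {0}" and C: "positive_definite H C" and D: "positive_definite H D"
    and \<alpha>: "0 < \<alpha>" "\<alpha> < 1" and s: "0 < s"
    and low: "\<And>x. x \<in> carrier H \<Longrightarrow> s * ri (C x) x \<le> ri (D x) x"
    and up: "\<And>x. x \<in> carrier H \<Longrightarrow> ri (D x) x \<le> ri (C x) x"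
    and x: "x \<in> carrier H"
  shows "(1 - \<alpha>) * ri (C x) x + \<alpha> * ri (D x) x \<le> M_const \<alpha> s * ri (geo_mean H \<alpha> C D x) x"
proof -
  obtain S S' R where S: "bounded_operator H S" "bounded_operator H S'"
    "\<And>x. x \<in> carrier H \<Longrightarrow> S' (S x) = x" and R: "positive_definite H R"
    and CS: "\<And>x. x \<in> carrier H \<Longrightarrow> ri (C (S' x)) (S' x) = ri x x"
    and DS: "\<And>x. x \<in> carrier H \<Longrightarrow> ri (D (S' x)) (S' x) = ri (R x) x"
    and geo: "\<And>x. x \<in> carrier H \<Longrightarrow> ri (geo_mean H \<alpha> C D x) x = ri (op_fun H (\<lambda>t. t powr \<alpha>) R (S x)) (S x)"
    by (rule geo_mean_representation[OF nz C D, of \<alpha>]) (rule that; assumption)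
  define w where "w = S x"
  have w: "w \<in> carrier H" and xw: "x = S' w" using x S by (auto simp: w_def)
  have saR: "self_adjoint H R" using R by simp
  have sub: "rspec R \<subseteq> {s..1}"
  proof (rule rspec_subset[OF saR])
    fix y assume y: "y \<in> carrier H"
    show "s * ri y y \<le> ri (R y) y" "ri (R y) y \<le> 1 * ri y y"
      using low[of "S' y"] up[of "S' y"] y S by (auto simp: CS DS)
  qed
  have c1: "continuous_on {0<..} (\<lambda>t. \<alpha> * t)" by (intro continuous_intros)
  have c2: "continuous_on {0<..} (\<lambda>t. (1 - \<alpha>) + \<alpha> * t)" by (intro continuous_intros)
  have c3: "continuous_on {0<..} (\<lambda>t. M_const \<alpha> s * t powr \<alpha>)"
    by (intro continuous_on_mult continuous_on_const continuous_powr)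
  have "(1 - \<alpha>) * ri (C x) x + \<alpha> * ri (D x) x = (1 - \<alpha>) * ri w w + \<alpha> * ri (R w) w"
    using w by (simp add: xw CS DS)
  also have "\<dots> = ri (op_fun H (\<lambda>t. (1 - \<alpha>) + \<alpha> * t) R w) w"
  proof -
    have "op_fun H (\<lambda>t. (1 - \<alpha>) + \<alpha> * t) R w = rscale (1 - \<alpha>) w + rscale \<alpha> (R w)"
      using op_fun_add[OF R continuous_on_const c1 w, of "1 - \<alpha>"] op_fun_const[OF R w, of "1 - \<alpha>"]
        op_fun_cmult[OF R continuous_on_id w, of \<alpha>] op_fun_ident[OF R w] by simp
    then show ?thesis using w R by (simp del: of_real_diff)
  qed
  also have "\<dots> \<le> ri (op_fun H (\<lambda>t. M_const \<alpha> s * t powr \<alpha>) R w) w"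
    using sub s reverse_Young[OF \<alpha>] by (intro op_fun_form_mono[OF R c2 c3 _ w]) auto
  also have "\<dots> = M_const \<alpha> s * ri (geo_mean H \<alpha> C D x) x"
    using op_fun_cmult[OF R continuous_powr w, of "M_const \<alpha> s" \<alpha>] op_fun_in[OF R continuous_powr w]
      w geo[OF x] by (simp add: w_def)
  finally show ?thesis .
qed

text \<open>
  The decomposition is the optimal one. After the substitutions \<open>u = P\<^bsup>-1/2\<^esup> a\<close> and \<open>v = P\<^bsup>-1/2\<^esup> b\<close> one has
  to split \<open>w = P\<^bsup>1/2\<^esup> z\<close> as \<open>(1 - \<alpha>) a + \<alpha> b\<close>, and the form to be minimised is
  \<open>(1 - \<alpha>) \<parallel>a\<parallel>\<^sup>2 + \<alpha> \<langle>R b, b\<rangle>\<close>. At the minimum \<open>a = R b\<close>, hence \<open>b = ((1 - \<alpha>) R + \<alpha>)\<^sup>-\<^sup>1 w\<close>, and the value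
  \<open>\<langle>R ((1 - \<alpha>) R + \<alpha>)\<^sup>-\<^sup>1 w, w\<rangle>\<close> is at most \<open>\<langle>R\<^sup>\<alpha> w, w\<rangle>\<close> by Young's inequality.
\<close>

lemma harmonic_le_geo_mean:
  assumes nz: "carrier H \<noteq> {0}" and P: "positive_definite H P" and Q: "positive_definite H Q"
    and \<alpha>: "0 < \<alpha>" "\<alpha> < 1" and z: "z \<in> carrier H"
  obtains u v where "u \<in> carrier H" "v \<in> carrier H" "z = rscale (1 - \<alpha>) u + rscale \<alpha> v"
    "(1 - \<alpha>) * ri (P u) u + \<alpha> * ri (Q v) v \<le> ri (geo_mean H \<alpha> P Q z) z"
proof -
  obtain S S' R where S: "bounded_operator H S" "bounded_operator H S'"
    "\<And>x. x \<in> carrier H \<Longrightarrow> S' (S x) = x" and R: "positive_definite H R"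
    and PS: "\<And>x. x \<in> carrier H \<Longrightarrow> ri (P (S' x)) (S' x) = ri x x"
    and QS: "\<And>x. x \<in> carrier H \<Longrightarrow> ri (Q (S' x)) (S' x) = ri (R x) x"
    and geo: "\<And>x. x \<in> carrier H \<Longrightarrow> ri (geo_mean H \<alpha> P Q x) x = ri (op_fun H (\<lambda>t. t powr \<alpha>) R (S x)) (S x)"
    by (rule geo_mean_representation[OF nz P Q, of \<alpha>]) (rule that; assumption)
  define w where "w = S z"
  have w: "w \<in> carrier H" and zw: "z = S' w" using z S by (auto simp: w_def)
  have boR: "bounded_operator H R" and saR: "self_adjoint H R" using R by auto
  define h where "h t = 1 / ((1 - \<alpha>) * t + \<alpha>)" for t
  have den: "0 < (1 - \<alpha>) * t + \<alpha>" if "0 < t" for t using that \<alpha> by (simp add: add_pos_pos)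
  have ch: "continuous_on {0<..} h"
    unfolding h_def using den by (intro continuous_intros) (auto simp: less_le)
  have cth: "continuous_on {0<..} (\<lambda>t. t * h t)" by (intro continuous_intros ch)
  define b where "b = op_fun H h R w"
  define a where "a = R b"
  have b: "b \<in> carrier H" using R ch w by (simp add: b_def)
  have a: "a \<in> carrier H" using b boR by (simp add: a_def)
  have a_eq: "op_fun H (\<lambda>t. t * h t) R w = a"
    using op_fun_mult[OF R continuous_on_id ch w] b by (simp add: a_def b_def op_fun_ident[OF R])
  have w_eq: "rscale (1 - \<alpha>) a + rscale \<alpha> b = w"
  proof -
    have c1: "continuous_on {0<..} (\<lambda>t. (1 - \<alpha>) * (t * h t))" and c2: "continuous_on {0<..} (\<lambda>t. \<alpha> * h t)"
      by (intro continuous_intros cth ch)+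
    have "rscale (1 - \<alpha>) a + rscale \<alpha> b = op_fun H (\<lambda>t. (1 - \<alpha>) * (t * h t) + \<alpha> * h t) R w"
      using op_fun_add[OF R c1 c2 w] op_fun_cmult[OF R cth w] op_fun_cmult[OF R ch w]
      by (simp add: a_eq b_def)
    also have "\<dots> = op_fun H (\<lambda>t. 1) R w"
    proof (rule op_fun_cong[OF R continuous_on_add[OF c1 c2] _ w])
      fix t :: real assume "0 < t"
      then have "(1 - \<alpha>) * t + \<alpha> \<noteq> 0" using den by fastforce
      have "(1 - \<alpha>) * (t * h t) + \<alpha> * h t = ((1 - \<alpha>) * t + \<alpha>) * h t" by (simp add: algebra_simps)
      also have "\<dots> = 1" using \<open>(1 - \<alpha>) * t + \<alpha> \<noteq> 0\<close> by (simp add: h_def)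
      finally show "(1 - \<alpha>) * (t * h t) + \<alpha> * h t = 1" .
    qed
    also have "\<dots> = w" using op_fun_const[OF R w, of 1] by simp
    finally show ?thesis .
  qed
  show ?thesis
  proof (rule that[of "S' a" "S' b"])
    have "rscale (1 - \<alpha>) (S' a) + rscale \<alpha> (S' b) = S' (rscale (1 - \<alpha>) a + rscale \<alpha> b)"
      using a b by (simp only: bo_add[OF S(2)] bo_scale[OF S(2)] scale_in)
    then show "z = rscale (1 - \<alpha>) (S' a) + rscale \<alpha> (S' b)" by (simp only: w_eq zw)
    have "(1 - \<alpha>) * ri (P (S' a)) (S' a) + \<alpha> * ri (Q (S' b)) (S' b) = (1 - \<alpha>) * ri a a + \<alpha> * ri a b"
      using a b by (simp add: PS QS a_def)
    also have "\<dots> = ri a (rscale (1 - \<alpha>) a + rscale \<alpha> b)"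
      using a b by (simp del: of_real_diff)
    also have "\<dots> = ri (op_fun H (\<lambda>t. t * h t) R w) w" by (simp only: w_eq a_eq)
    also have "\<dots> \<le> ri (op_fun H (\<lambda>t. t powr \<alpha>) R w) w"
      using harmonic_le_powr[OF \<alpha>] rspec_pos[OF R]
      by (intro op_fun_form_mono[OF R cth continuous_powr _ w]) (simp add: h_def)
    finally show "(1 - \<alpha>) * ri (P (S' a)) (S' a) + \<alpha> * ri (Q (S' b)) (S' b) \<le> ri (geo_mean H \<alpha> P Q z) z"
      by (simp add: geo[OF z] w_def)
  qed (use a b S in auto)
qed

section \<open>The inequality for the geometric mean\<close>

lemma zero_space_sa:
  assumes "carrier H = {0}" "A 0 = 0" shows "self_adjoint H A"
  using assms by (intro self_adjointI bounded_operatorI[where K = 0]) auto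

lemma zero_space_positive_definite:
  assumes "carrier H = {0}" "A 0 = 0" shows "positive_definite H A"
  using zero_space_sa[of A, OF assms] assms by (intro positive_definiteI[where m = 1]) auto

text \<open>
  The two parts use the same bound with different decompositions of the vector: the optimal operator
  decomposition for the first, and multiples \<open>a \<xi>\<close> and \<open>b \<xi>\<close> of \<open>\<xi>\<close> for the second, which reduces it to
  the scalar inequality between harmonic and geometric mean.

  The zero space is treated apart: there every operator is positive definite and also zero, so
  \<open>geo_mean\<close> takes the value of its convention.
\<close>

lemma geo_mean_inequality:
  assumes mono: "operator_monotone_decreasing TYPE(nat \<Rightarrow> 'v) g"
    and g0: "\<And>t. 0 < t \<Longrightarrow> 0 \<le> g t"
    and C: "positive_definite H C" and D: "positive_definite H D"
    and \<alpha>: "0 < \<alpha>" "\<alpha> < 1" and s: "0 < s"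
    and low: "op_le H (op_scale H s C) D" and up: "op_le H D C"
  shows "op_le H (op_fun H g (geo_mean H \<alpha> C D))
      (op_scale H (M_const \<alpha> s) (geo_mean H \<alpha> (op_fun H g C) (op_fun H g D)))"
    and "\<xi> \<in> carrier H \<Longrightarrow> ri (op_fun H g (geo_mean H \<alpha> C D) \<xi>) \<xi>
      \<le> M_const \<alpha> s * ri (op_fun H g C \<xi>) \<xi> powr (1 - \<alpha>) * ri (op_fun H g D \<xi>) \<xi> powr \<alpha>"
proof -
  have g: "continuous_on {0<..} g" using mono by (simp add: operator_monotone_decreasing_def)
  have bog: "bounded_operator H (op_fun H g C)" "bounded_operator H (op_fun H g D)"
    using op_fun_bounded C D g by auto
  let ?M = "M_const \<alpha> s" and ?X = "geo_mean H \<alpha> C D" and ?Y = "geo_mean H \<alpha> (op_fun H g C) (op_fun H g D)"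
  have M: "1 \<le> ?M" by (rule M_const_ge_1[OF \<alpha>])
  have "op_le H (op_fun H g ?X) (op_scale H ?M ?Y) \<and>
    (\<forall>\<xi>\<in>carrier H. ri (op_fun H g ?X \<xi>) \<xi> \<le> ?M * ri (op_fun H g C \<xi>) \<xi> powr (1 - \<alpha>) * ri (op_fun H g D \<xi>) \<xi> powr \<alpha>)"
  proof (cases "carrier H = {0}")
    case True
    have zero: "T 0 = 0" if "bounded_operator H T" for T using that by (rule bo_zero)
    have X0: "?X 0 = 0" and Y0: "?Y 0 = 0"
      using True zero C D bog by (simp_all add: geo_mean_def)
    have saX: "self_adjoint H (op_fun H g ?X)"
      by (rule op_fun_sa[OF zero_space_positive_definite[of ?X, OF True X0] g])
    have saY: "self_adjoint H (op_scale H ?M ?Y)"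
      by (rule zero_space_sa[OF True]) (simp add: op_scale_def Y0)
    have vanish: "x = 0" if "x \<in> carrier H" for x using that True by simp
    have at_0: "op_fun H g ?X 0 = 0" "op_fun H g C 0 = 0" "op_scale H ?M ?Y 0 = 0"
      using saX saY bog by (auto intro: zero)
    have "op_le H (op_fun H g ?X) (op_scale H ?M ?Y)"
    proof (rule op_leI[OF saX saY])
      fix x assume "x \<in> carrier H"
      from vanish[OF this] show "ri (op_fun H g ?X x) x \<le> ri (op_scale H ?M ?Y x) x"
        by (simp add: at_0)
    qed
    moreover have "ri (op_fun H g ?X x) x \<le> ?M * ri (op_fun H g C x) x powr (1 - \<alpha>) * ri (op_fun H g D x) x powr \<alpha>"
      if "x \<in> carrier H" for x
      using vanish[OF that] by (simp add: at_0)
    ultimately show ?thesis by blast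
  next
    case False
    note nz = this
    have X: "positive_definite H ?X"
      by (rule geo_mean_representation[OF nz C D, of \<alpha>])
    have low': "s * ri (C x) x \<le> ri (D x) x" if "x \<in> carrier H" for x
      using op_leD[OF low that] that C by (simp add: op_scale_def)
    have bound: "ri (op_fun H g ?X z) z \<le> ?M * ((1 - \<alpha>) * ri (op_fun H g C u) u + \<alpha> * ri (op_fun H g D v) v)"
      if "u \<in> carrier H" "v \<in> carrier H" "z = rscale (1 - \<alpha>) u + rscale \<alpha> v" for u v z
      by (rule operator_monotone_decreasing_mean_bound[OF mono g0 nz C D X _ _ M _ that])
        (use \<alpha> arithmetic_le_geo_mean[OF nz C D \<alpha> s low' op_leD[OF up]] in auto)
    have saX: "self_adjoint H (op_fun H g ?X)" by (rule op_fun_sa[OF X g])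
    consider (zero) "\<forall>t>0. g t = 0" | (pos) "\<forall>t>0. 0 < g t"
      using operator_monotone_decreasing_zero_or_pos[OF mono g0 nz] by blast
    then show ?thesis
    proof cases
      case zero
      have vanish: "op_fun H g A x = 0" if "positive_definite H A" "x \<in> carrier H" for A x
        using op_fun_cong[OF that(1) g _ that(2), of "\<lambda>t. 0"] op_fun_const[OF that, of 0] zero by simp
      have "?Y = (\<lambda>x. 0)" using vanish C D by (simp add: geo_mean_def)
      then show ?thesis
        using vanish X C D saX sa_zero by (auto intro!: op_leI simp: op_scale_def)
    next
      case pos
      have P: "positive_definite H (op_fun H g C)" and Q: "positive_definite H (op_fun H g D)"
        using op_fun_positive_definite C D g pos by auto
      have Y: "positive_definite H ?Y"
        by (rule geo_mean_representation[OF nz P Q, of \<alpha>])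
      have "op_le H (op_fun H g ?X) (op_scale H ?M ?Y)"
      proof (rule op_leI[OF saX])
        show "self_adjoint H (op_scale H ?M ?Y)" unfolding op_scale_def using Y by (intro sa_rscale) simp
        fix z assume z: "z \<in> carrier H"
        obtain u v where uv: "u \<in> carrier H" "v \<in> carrier H" "z = rscale (1 - \<alpha>) u + rscale \<alpha> v"
          "(1 - \<alpha>) * ri (op_fun H g C u) u + \<alpha> * ri (op_fun H g D v) v \<le> ri (?Y z) z"
          by (rule harmonic_le_geo_mean[OF nz P Q \<alpha> z]) (rule that; assumption)
        have "ri (op_fun H g ?X z) z \<le> ?M * ri (?Y z) z"
          using bound[OF uv(1-3)] mult_left_mono[OF uv(4), of ?M] M by linarith
        then show "ri (op_fun H g ?X z) z \<le> ri (op_scale H ?M ?Y z) z"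
          using z Y by (simp add: op_scale_def)
      qed
      moreover have "ri (op_fun H g ?X \<xi>) \<xi> \<le> ?M * ri (op_fun H g C \<xi>) \<xi> powr (1 - \<alpha>) * ri (op_fun H g D \<xi>) \<xi> powr \<alpha>"
        if \<xi>: "\<xi> \<in> carrier H" for \<xi>
      proof (cases "\<xi> = 0")
        case False
        define x y where "x = ri (op_fun H g C \<xi>) \<xi>" and "y = ri (op_fun H g D \<xi>) \<xi>"
        have form_pos: "0 < ri (A \<xi>) \<xi>" if A: "positive_definite H A" for A
        proof -
          obtain m where m: "0 < m" "\<And>x. x \<in> carrier H \<Longrightarrow> m * ri x x \<le> ri (A x) x"
            by (rule positive_definite_coercive[OF A]) (rule that; assumption)
          have "0 < m * ri \<xi> \<xi>" using m(1) ip_pos[OF \<xi> False] by simp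
          then show ?thesis using m(2)[OF \<xi>] by linarith
        qed
        have x: "0 < x" and y: "0 < y" using form_pos[OF P] form_pos[OF Q] by (auto simp: x_def y_def)
        \<comment> \<open>The minimum of \<open>(1 - \<alpha>) x a\<^sup>2 + \<alpha> y b\<^sup>2\<close> subject to \<open>(1 - \<alpha>) a + \<alpha> b = 1\<close>\<close>
        define d where "d = (1 - \<alpha>) * y + \<alpha> * x"
        have d: "0 < d" using x y \<alpha> by (simp add: d_def add_pos_pos)
        define a b where "a = y / d" and "b = x / d"
        have ab: "(1 - \<alpha>) * a + \<alpha> * b = 1"
          using d by (simp add: a_def b_def add_divide_distrib[symmetric] d_def)
        have "\<xi> = rscale (1 - \<alpha>) (rscale a \<xi>) + rscale \<alpha> (rscale b \<xi>)"
          by (simp add: ab flip: scale_left_distrib of_real_mult of_real_add del: of_real_diff)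
        from bound[OF _ _ this] \<xi>
        have "ri (op_fun H g ?X \<xi>) \<xi> \<le> ?M * ((1 - \<alpha>) * (a * (a * x)) + \<alpha> * (b * (b * y)))"
          using bog by (simp add: x_def y_def bo_scale[OF bog(1)] bo_scale[OF bog(2)])
        also have "(1 - \<alpha>) * (a * (a * x)) + \<alpha> * (b * (b * y)) = x * y / d"
        proof -
          have "(1 - \<alpha>) * (a * (a * x)) + \<alpha> * (b * (b * y)) = x * y / d * ((1 - \<alpha>) * a + \<alpha> * b)"
            by (simp add: a_def b_def algebra_simps)
          then show ?thesis by (simp add: ab)
        qed
        also have "x * y / d \<le> x powr (1 - \<alpha>) * y powr \<alpha>"
        proof -
          have "y powr (1 - \<alpha>) * x powr \<alpha> \<le> d" unfolding d_def by (rule Young_powr[OF \<alpha> y x])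
          then have "x powr (1 - \<alpha>) * y powr \<alpha> * (y powr (1 - \<alpha>) * x powr \<alpha>) \<le> x powr (1 - \<alpha>) * y powr \<alpha> * d"
            by (intro mult_left_mono) auto
          moreover have "x powr (1 - \<alpha>) * y powr \<alpha> * (y powr (1 - \<alpha>) * x powr \<alpha>)
              = (x powr (1 - \<alpha>) * x powr \<alpha>) * (y powr (1 - \<alpha>) * y powr \<alpha>)"
            by (simp only: mult_ac)
          moreover have "\<dots> = x * y" using x y by (simp flip: powr_add)
          ultimately show ?thesis using d by (simp add: pos_divide_le_eq)
        qed
        finally show ?thesis using M by (simp add: x_def y_def mult.assoc mult_left_mono)
      next
        case True
        then show ?thesis using bo_zero[OF sa_bounded[OF saX]] bo_zero[OF bog(1)] by simp
      qed
      ultimately show ?thesis by blast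
    qed
  qed
  then show "op_le H (op_fun H g ?X) (op_scale H ?M ?Y)"
    "\<xi> \<in> carrier H \<Longrightarrow> ri (op_fun H g ?X \<xi>) \<xi> \<le> ?M * ri (op_fun H g C \<xi>) \<xi> powr (1 - \<alpha>) * ri (op_fun H g D \<xi>) \<xi> powr \<alpha>"
    by auto
qed

end

theorem theorem3p6:
  fixes H :: "'v::ab_group_add hspace"
    and A B :: "'v \<Rightarrow> 'v"
    and g :: "real \<Rightarrow> real"
    and p q s :: real
  assumes "hilbert_space H"
    and "operator_monotone_decreasing TYPE(nat \<Rightarrow> 'v) g"
    and "\<And>t. 0 < t \<Longrightarrow> 0 \<le> g t"
    and "1 < p" and "1 < q" and "1 / p + 1 / q = 1"
    and "positive_definite H A" and "positive_definite H B"
    and "0 < s"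
    and "positive_definite H (op_scale H s (op_powr H A p))"
    and "op_le H (op_scale H s (op_powr H A p)) (op_powr H B q)"
    and "op_le H (op_powr H B q) (op_powr H A p)"
  shows "op_le H
      (op_fun H g (geo_mean H (1 / q) (op_powr H A p) (op_powr H B q)))
      (op_scale H (M_const (1 / q) s)
        (geo_mean H (1 / q) (op_fun H g (op_powr H A p)) (op_fun H g (op_powr H B q))))
    \<and> (\<forall>\<xi>\<in>carrier H.
      Re (ip H (op_fun H g (geo_mean H (1 / q) (op_powr H A p) (op_powr H B q)) \<xi>) \<xi>)
      \<le> M_const (1 / q) s *
        Re (ip H (op_fun H g (op_powr H A p) \<xi>) \<xi>) powr (1 / p) *
        Re (ip H (op_fun H g (op_powr H B q) \<xi>) \<xi>) powr (1 / q))"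
proof -
  interpret hilbert_space H by fact
  have q: "0 < 1 / q" "1 / q < 1" and p: "1 / p = 1 - 1 / q" using assms(4-6) by auto
  have "positive_definite H (op_powr H A p)" "positive_definite H (op_powr H B q)"
    using assms(7,8) by (auto intro: op_powr_positive_definite)
  from geo_mean_inequality[OF assms(2,3) this q assms(9,11,12)]
  show ?thesis by (simp only: p) blast
qed

end
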